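(* Let $1<p<\infty$ and let $\Omega\subset\mathbb{R}^N$ be an open bounded set. Then $\lambda^1_{L,p}(\Omega)>0$ if and only if the following is true: for every $u\in X^p_0(\Omega)$ satisfying weakly $L_{\Delta_p}u\ge0$ in $\Omega$, $u=0$ in $\mathbb{R}^N\setminus\Omega$, either $u\equiv0$ in $\Omega$ or $u>0$ in $\Omega$ in the sense that $$\operatorname*{ess\,inf}_K u>0\quad\text{for all compact sets }K\subset\Omega.$$
   Context: $\Omega\neq\emptyset$, $g(a)=|a|^{p-2}a$ (with $g(0)=0$), $\Gamma$ is the Gamma function, $\psi=\Gamma'/\Gamma$, $\gamma=-\Gamma'(1)$, $C_{N,p}=\frac{p\,\Gamma(N/2)}{2\pi^{N/2}}$, $\rho_N(p)=2\ln2-\gamma+\frac p2\psi(\frac N2)$, $$X^p_0(\Omega)=\Big\{u\in L^p(\mathbb{R}^N): u=0\text{ a.e. on }\mathbb{R}^N\setminus\Omega,\ \int_{\mathbb{R}^N}\int_{B_1(x)}\frac{|u(x)-u(y)|^p}{|x-y|^N}\,dy\,dx<\infty\Big\}.$$ For $u,v\in X^p_0(\Omega)$, $$\begin{aligned}\mathcal{E}_{L,p}(u,v)&=\frac{C_{N,p}}{2}\iint_{|x-y|<1}\frac{g(u(x)-u(y))(v(x)-v(y))}{|x-y|^N}\,dx\,dy+\rho_N(p)\int_{\mathbb{R}^N}g(u(x))v(x)\,dx\\&\quad+\frac{C_{N,p}}{2}\iint_{|x-y|\ge1}\frac{g(u(x)-u(y))(v(x)-v(y))-g(u(x))v(x)-g(u(y))v(y)}{|x-y|^N}\,dx\,dy.\end{aligned}$$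 $\lambda^1_{L,p}(\Omega)=\inf\{\mathcal{E}_{L,p}(u,u):u\in X^p_0(\Omega),\ \|u\|_{L^p(\Omega)}=1\}$. A function $u$ satisfies weakly $L_{\Delta_p}u\ge0$ in $\Omega$, $u=0$ in $\mathbb{R}^N\setminus\Omega$, if $u\in X^p_0(\Omega)$ and $\mathcal{E}_{L,p}(u,\varphi)\ge0$ for all nonnegative $\varphi\in X^p_0(\Omega)$. *)

theory Defs
  imports "HOL-Analysis.Analysis"
begin

text \<open>
  \<open>\<real>\<^sup>N\<close> is an arbitrary type \<open>'a\<close> of class \<open>euclidean_space\<close>, with \<open>N = DIM('a)\<close>. Functions are
  pointwise defined, real valued and Lebesgue measurable, so an element of \<open>L\<^sup>p\<close> is given by any of
  its representatives and pointwise assertions about it are read almost everywhere.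
\<close>

text \<open>At \<open>a = 0\<close> the value is \<open>0\<close> for every \<open>p\<close>, because of the factor \<open>a\<close>.\<close>

definition g_pow :: "real \<Rightarrow> real \<Rightarrow> real" where
  "g_pow p a = \<bar>a\<bar> powr (p - 2) * a"

definition C_const :: "real \<Rightarrow> real \<Rightarrow> real" where
  "C_const N p = p * Gamma (N / 2) / (2 * pi powr (N / 2))"

text \<open>
  The library defines \<open>Digamma\<close> by a series and \<open>euler_mascheroni\<close> as a limit of harmonic sums. The
  next two facts identify them with \<open>\<Gamma>' / \<Gamma>\<close> and \<open>- \<Gamma>'(1)\<close>.
\<close>

lemma Digamma_eq_deriv_Gamma: "Digamma x = deriv Gamma x / Gamma x" if "x > 0" for x :: real
proof -
  have "x \<notin> \<int>\<^sub>\<le>\<^sub>0"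
    using that by (auto elim!: nonpos_Ints_cases)
  then have "deriv Gamma x = Gamma x * Digamma x"
    by (intro DERIV_imp_deriv has_field_derivative_Gamma)
  then show ?thesis
    using Gamma_real_pos[OF that] by simp
qed

lemma euler_mascheroni_eq_deriv_Gamma: "euler_mascheroni = - deriv Gamma (1::real)"
  using Digamma_eq_deriv_Gamma[of 1] by simp

definition rho_const :: "real \<Rightarrow> real \<Rightarrow> real" where
  "rho_const N p = 2 * ln 2 - euler_mascheroni + p / 2 * Digamma (N / 2)"

definition X0 :: "real \<Rightarrow> 'a::euclidean_space set \<Rightarrow> ('a \<Rightarrow> real) set" where
  "X0 p \<Omega> = {u.
     u \<in> borel_measurable lebesgue \<and>
     integrable lebesgue (\<lambda>x. \<bar>u x\<bar> powr p) \<and>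
     (AE x in lebesgue. x \<notin> \<Omega> \<longrightarrow> u x = 0) \<and>
     (\<integral>\<^sup>+x. (\<integral>\<^sup>+y \<in> ball x 1.
        ennreal (\<bar>u x - u y\<bar> powr p / norm (x - y) ^ DIM('a)) \<partial>lebesgue) \<partial>lebesgue) < \<infinity>}"

definition Lp_norm :: "real \<Rightarrow> 'a::euclidean_space set \<Rightarrow> ('a \<Rightarrow> real) \<Rightarrow> real" where
  "Lp_norm p \<Omega> u = (LINT x:\<Omega>|lebesgue. \<bar>u x\<bar> powr p) powr (1 / p)"

text \<open>The double integrals are taken with respect to Lebesgue measure on \<open>\<real>\<^sup>N \<times> \<real>\<^sup>N\<close>.\<close>

definition E_form :: "real \<Rightarrow> ('a::euclidean_space \<Rightarrow> real) \<Rightarrow> ('a \<Rightarrow> real) \<Rightarrow> real" where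
  "E_form p u v =
     C_const DIM('a) p / 2 *
       (LINT z:{(x, y). norm (x - y) < 1}|lebesgue.
          (case z of (x, y) \<Rightarrow>
             g_pow p (u x - u y) * (v x - v y) / norm (x - y) ^ DIM('a)))
     + rho_const DIM('a) p * (LINT x|lebesgue. g_pow p (u x) * v x)
     + C_const DIM('a) p / 2 *
       (LINT z:{(x, y). norm (x - y) \<ge> 1}|lebesgue.
          (case z of (x, y) \<Rightarrow>
             (g_pow p (u x - u y) * (v x - v y) - g_pow p (u x) * v x - g_pow p (u y) * v y)
               / norm (x - y) ^ DIM('a)))"

definition lambda1 :: "real \<Rightarrow> 'a::euclidean_space set \<Rightarrow> ereal" where
  "lambda1 p \<Omega> = Inf {ereal (E_form p u u) | u. u \<in> X0 p \<Omega> \<and> Lp_norm p \<Omega> u = 1}"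

definition weak_supersolution ::
    "real \<Rightarrow> 'a::euclidean_space set \<Rightarrow> ('a \<Rightarrow> real) \<Rightarrow> bool" where
  "weak_supersolution p \<Omega> u \<longleftrightarrow>
     u \<in> X0 p \<Omega> \<and>
     (\<forall>\<phi> \<in> X0 p \<Omega>. (AE x in lebesgue. 0 \<le> \<phi> x) \<longrightarrow> 0 \<le> E_form p u \<phi>)"

text \<open>The value is \<open>\<infinity>\<close> when \<open>K\<close> is a null set, in particular for \<open>K = {}\<close>.\<close>

definition ess_inf :: "'a::euclidean_space set \<Rightarrow> ('a \<Rightarrow> real) \<Rightarrow> ereal" where
  "ess_inf K u = Sup {c. AE x in lebesgue. x \<in> K \<longrightarrow> c \<le> ereal (u x)}"

end

theory Submission
  imports Defs "HOL-Complex_Analysis.Great_Picard"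
begin

text \<open>
  Everything rests on a rewriting of the form. Elements of \<open>X\<^sup>p\<^sub>0(\<Omega>)\<close> vanish off \<open>\<Omega>\<close>, so the integrand over
  \<open>\<bar>x - y\<bar> \<ge> 1\<close> is zero unless both points lie in the bounded set \<open>\<Omega>\<close>, where the kernel is at most \<open>1\<close>
  and the subtracted terms can be integrated on their own. Hence (lemma \<open>E_form_eq_form\<close>)
  \<open>E(u, v) = C/2 \<integral>\<integral> k(x, y) g(u x - u y) (v x - v y) + \<integral> V g(u) v\<close>
  with a nonnegative symmetric kernel \<open>k\<close>, equal to \<open>\<bar>x - y\<bar>\<^sup>-\<^sup>N\<close> when \<open>\<bar>x - y\<bar> < 1\<close> or \<open>x, y \<in> \<Omega>\<close>, and a bounded
  potential \<open>V\<close>.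

  Suppose \<open>\<lambda>\<^sup>1\<^sub>L\<^sub>,\<^sub>p(\<Omega>) > 0\<close> and let \<open>u\<close> be a supersolution. Testing with the negative part gives
  \<open>0 \<le> E(u, u\<^sup>-) \<le> - E(u\<^sup>-, u\<^sup>-)\<close>, so \<open>u\<^sup>- = 0\<close> (\<open>supersolution_nonneg\<close>). If \<open>u \<ge> 0\<close> is not zero, then
  \<open>u \<ge> \<delta>\<close> on a set \<open>A \<subseteq> \<Omega>\<close> of positive measure. Compare \<open>u\<close> with \<open>\<epsilon> \<psi>\<close>, where \<open>\<psi>\<close> is a Lipschitz cutoff
  that is \<open>1\<close> on \<open>K\<close>. Since \<open>k\<close> is bounded below on \<open>\<Omega> \<times> \<Omega>\<close>, every point with \<open>u < \<epsilon> \<psi>\<close> interacts directly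
  with \<open>A\<close>, however far away and in whichever component of \<open>\<Omega>\<close>; this contributes at most
  \<open>- c \<delta>\<^sup>p\<^sup>-\<^sup>1 \<bar>A\<bar>\<close> to the equation, while all other terms are \<open>O(\<epsilon>\<^sup>p\<^sup>-\<^sup>1)\<close>. For small \<open>\<epsilon>\<close> the test function
  \<open>(\<epsilon> \<psi> - u)\<^sup>+\<close> must vanish, that is \<open>u \<ge> \<epsilon>\<close> on \<open>K\<close> (\<open>nonneg_supersolution_locally_bounded_below\<close>).

  Suppose conversely \<open>\<lambda>\<^sup>1\<^sub>L\<^sub>,\<^sub>p(\<Omega>) \<le> 0\<close>. A minimizer \<open>u\<close> of the Rayleigh quotient exists (\<open>minimizer_exists\<close>),
  may be taken nonnegative, and solves \<open>E(u, \<phi>) = \<mu> \<integral> g(u) \<phi>\<close> with \<open>\<mu> \<le> 0\<close>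
  (\<open>Euler_Lagrange\<close>). Then \<open>- u\<close> is a supersolution that is neither zero nor positive, so the maximum
  principle fails.

  Existence of the minimizer needs the compactness of \<open>X\<^sup>p\<^sub>0(\<Omega>)\<close> in \<open>L\<^sup>p\<close> (\<open>compact_embedding\<close>), although the
  energy controls no derivative of positive order. Let \<open>P\<^sub>j u\<close> be the average of \<open>u\<close> over dyadic cubes of
  side \<open>2\<^sup>-\<^sup>j\<close>. By Jensen's inequality \<open>\<parallel>u - P\<^sub>j u\<parallel>\<^sup>p\<close> is at most the double integral of \<open>\<bar>u x - u y\<bar>\<^sup>p\<close>
  against the kernel that is \<open>2\<^sup>j\<^sup>N\<close> on pairs in a common cube. The sum of these kernels over \<open>j\<close>
  is a geometric series bounded by a multiple of \<open>\<bar>x - y\<bar>\<^sup>-\<^sup>N\<close>, so \<open>\<Sum>\<^sub>j \<parallel>u - P\<^sub>j u\<parallel>\<^sup>p\<close>, taken over the scales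
  \<open>j \<ge> N\<close>, is bounded by a multiple of the energy. Among \<open>m\<close> scales the average error is therefore \<open>O(1/m)\<close>,
  and a diagonal subsequence along which all averages converge is Cauchy in \<open>L\<^sup>p\<close>.
\<close>

section \<open>The nonlinearity \<open>g\<close> and its pointwise inequalities\<close>

lemma g_pow_abs: "\<bar>g_pow p a\<bar> = \<bar>a\<bar> powr (p - 1)"
proof (cases "a = 0")
  case False
  have "\<bar>g_pow p a\<bar> = \<bar>a\<bar> powr (p - 2) * \<bar>a\<bar> powr 1"
    by (simp add: g_pow_def abs_mult)
  also have "\<dots> = \<bar>a\<bar> powr (p - 1)"
    by (subst powr_add[symmetric]) simp
  finally show ?thesis .
qed (simp add: g_pow_def)

lemma g_pow_minus: "g_pow p (- a) = - g_pow p a"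
  by (simp add: g_pow_def)

lemma g_pow_nonneg: "a \<ge> 0 \<Longrightarrow> g_pow p a = a powr (p - 1)"
  using g_pow_abs[of p a] by (simp add: g_pow_def)

lemma g_pow_nonpos: "a \<le> 0 \<Longrightarrow> g_pow p a = - ((- a) powr (p - 1))"
  using g_pow_minus[of p "-a"] g_pow_nonneg[of "-a" p] by simp

lemma g_pow_mult_self: "g_pow p a * a = \<bar>a\<bar> powr p"
proof (cases "a = 0")
  case False
  have "g_pow p a * a = \<bar>a\<bar> powr (p - 2) * \<bar>a\<bar> powr 2"
    by (simp add: g_pow_def power2_eq_square)
  also have "\<dots> = \<bar>a\<bar> powr p"
    by (subst powr_add[symmetric]) simp
  finally show ?thesis .
qed (simp add: g_pow_def)

lemma powr_pred_mult: "a \<ge> 0 \<Longrightarrow> a powr (p - 1) * a = a powr p" for a :: real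
  using g_pow_mult_self[of p a] by (simp add: g_pow_nonneg)

lemma g_pow_mono:
  assumes "1 < p" "a \<le> b"
  shows "g_pow p a \<le> g_pow p b"
proof (cases "a \<ge> 0")
  case True
  then show ?thesis using assms by (simp add: g_pow_nonneg powr_mono2)
next
  case False
  show ?thesis
  proof (cases "b \<ge> 0")
    case True
    have "- ((- a) powr (p - 1)) \<le> 0" by simp
    also have "0 \<le> b powr (p - 1)" by simp
    finally show ?thesis using True False by (simp add: g_pow_nonneg g_pow_nonpos)
  next
    case b: False
    then show ?thesis using assms False by (simp add: g_pow_nonpos powr_mono2)
  qed
qed

lemma g_pow_measurable [measurable]: "g_pow p \<in> borel_measurable borel"
  unfolding g_pow_def[abs_def] by measurable

text \<open>The graph of the convex function \<open>\<bar>\<cdot>\<bar>\<^sup>p\<close> lies above its tangents; after expansion this is exactly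
  Young's inequality for the conjugate exponents \<open>p\<close> and \<open>p / (p - 1)\<close>.\<close>

lemma powr_above_tangent:
  assumes "1 < p"
  shows "\<bar>a\<bar> powr p + p * g_pow p a * (b - a) \<le> \<bar>b\<bar> powr p"
proof -
  define q where "q = p / (p - 1)"
  have q: "q > 1" "1 / p + 1 / q = 1" "(p - 1) * q = p"
    using assms by (auto simp: q_def field_simps)
  have "g_pow p a * b \<le> \<bar>g_pow p a\<bar> * \<bar>b\<bar>"
    by (metis abs_ge_self abs_mult)
  also have "\<dots> = \<bar>b\<bar> * \<bar>a\<bar> powr (p - 1)" by (simp add: g_pow_abs)
  also have "\<dots> \<le> \<bar>b\<bar> powr p / p + (\<bar>a\<bar> powr (p - 1)) powr q / q"
    by (rule Youngs_inequality) (use assms q in auto)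
  also have "(\<bar>a\<bar> powr (p - 1)) powr q = \<bar>a\<bar> powr p"
    using q by (simp add: powr_powr)
  also have "\<bar>b\<bar> powr p / p + \<bar>a\<bar> powr p / q = (\<bar>b\<bar> powr p + (p - 1) * \<bar>a\<bar> powr p) / p"
    using assms by (simp add: q_def field_simps)
  finally have "p * (g_pow p a * b) \<le> \<bar>b\<bar> powr p + (p - 1) * \<bar>a\<bar> powr p"
    using assms by (simp add: field_simps)
  moreover have "p * g_pow p a * (b - a) = p * (g_pow p a * b) - p * \<bar>a\<bar> powr p"
    unfolding g_pow_mult_self[of p a, symmetric] by (simp add: algebra_simps)
  ultimately show ?thesis by (simp add: left_diff_distrib)
qed

lemma powr_add_le:
  fixes a b p :: real
  assumes "0 \<le> p" "0 \<le> a" "0 \<le> b"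
  shows "(a + b) powr p \<le> 2 powr p * (a powr p + b powr p)"
proof -
  have "(a + b) powr p \<le> (2 * max a b) powr p"
    using assms by (intro powr_mono2) auto
  also have "\<dots> = 2 powr p * max a b powr p" using assms by (simp add: powr_mult)
  also have "\<dots> \<le> 2 powr p * (a powr p + b powr p)"
    by (intro mult_left_mono) (auto simp: max_def)
  finally show ?thesis .
qed

lemma abs_add_powr_le:
  fixes a b p :: real
  assumes "0 \<le> p"
  shows "\<bar>a + b\<bar> powr p \<le> 2 powr p * (\<bar>a\<bar> powr p + \<bar>b\<bar> powr p)"
  by (rule order_trans[OF powr_mono2 powr_add_le]) (use assms in auto)

lemma powr_pred_mult_le:
  fixes a b p :: real
  assumes "1 < p" "0 \<le> a" "0 \<le> b"
  shows "a powr (p - 1) * b \<le> a powr p + b powr p"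
proof (cases "a \<le> b")
  case True
  have "a powr (p - 1) * b \<le> b powr (p - 1) * b"
    using assms True by (intro mult_right_mono powr_mono2) auto
  then show ?thesis using assms by (simp add: powr_pred_mult add_increasing)
next
  case False
  have "a powr (p - 1) * b \<le> a powr (p - 1) * a"
    using assms False by (intro mult_left_mono) auto
  then show ?thesis using assms by (simp add: powr_pred_mult add_increasing2)
qed

lemma abs_g_pow_mult_le:
  assumes "1 < p"
  shows "\<bar>g_pow p a * b\<bar> \<le> \<bar>a\<bar> powr p + \<bar>b\<bar> powr p"
  using powr_pred_mult_le[OF assms, of "\<bar>a\<bar>" "\<bar>b\<bar>"] by (simp add: abs_mult g_pow_abs)

lemma tendsto_g_pow:
  assumes "1 < p" "(f \<longlongrightarrow> a) F"
  shows "((\<lambda>x. g_pow p (f x)) \<longlongrightarrow> g_pow p a) F"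
proof (cases "a = 0")
  case False
  then show ?thesis unfolding g_pow_def using assms by (auto intro!: tendsto_intros)
next
  case True
  have "((\<lambda>x. \<bar>f x\<bar>) \<longlongrightarrow> 0) F" using assms(2) True tendsto_rabs_zero by auto
  then have "((\<lambda>x. \<bar>f x\<bar> powr (p - 1)) \<longlongrightarrow> 0 powr (p - 1)) F"
    using assms(1) by (intro tendsto_powr') auto
  then have "((\<lambda>x. \<bar>g_pow p (f x)\<bar>) \<longlongrightarrow> 0) F" by (simp add: g_pow_abs)
  then show ?thesis using True by (simp add: g_pow_def tendsto_rabs_zero_iff)
qed

text \<open>The tangent inequality reduces the claim to \<open>\<bar>a\<bar>\<^sup>p\<^sup>-\<^sup>1 \<bar>a - b\<bar>\<close>, which is small relative to \<open>\<bar>a\<bar>\<^sup>p\<close> if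
  \<open>\<bar>a - b\<bar> \<le> \<eta> \<bar>a\<bar>\<close> and is dominated by \<open>\<bar>a - b\<bar>\<^sup>p\<close> otherwise. It makes \<open>p\<close>-th power integrals continuous
  under \<open>L\<^sup>p\<close> convergence.\<close>

lemma powr_diff_le:
  fixes a b p \<eta> :: real
  assumes "1 < p" "0 < \<eta>"
  shows "\<bar>\<bar>a\<bar> powr p - \<bar>b\<bar> powr p\<bar> \<le> p * (\<eta> * (\<bar>a\<bar> powr p + \<bar>b\<bar> powr p) + \<eta> powr (1 - p) * \<bar>a - b\<bar> powr p)"
proof -
  have *: "\<bar>a\<bar> powr p - \<bar>b\<bar> powr p \<le> p * (\<eta> * (\<bar>a\<bar> powr p + \<bar>b\<bar> powr p) + \<eta> powr (1 - p) * \<bar>a - b\<bar> powr p)" for a b :: real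
  proof -
    define d where "d = \<bar>a - b\<bar>"
    have d0: "d \<ge> 0" by (simp add: d_def)
    have 1: "\<bar>a\<bar> powr (p - 1) * d \<le> \<eta> * \<bar>a\<bar> powr p + \<eta> powr (1 - p) * d powr p"
    proof (cases "d \<le> \<eta> * \<bar>a\<bar>")
      case True
      have "\<bar>a\<bar> powr (p - 1) * d \<le> \<bar>a\<bar> powr (p - 1) * (\<eta> * \<bar>a\<bar>)"
        using True by (intro mult_left_mono) auto
      also have "\<dots> = \<eta> * \<bar>a\<bar> powr p" using powr_pred_mult[of "\<bar>a\<bar>" p] by simp
      finally show ?thesis by (simp add: add_increasing2)
    next
      case False
      have "\<bar>a\<bar> powr (p - 1) * d \<le> (d / \<eta>) powr (p - 1) * d"
        using False assms by (intro mult_right_mono powr_mono2) (auto simp: field_simps d_def)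
      also have "\<dots> = \<eta> powr (1 - p) * (d powr (p - 1) * d)"
        using assms d0 by (simp add: powr_divide powr_minus_divide[of \<eta> "p - 1", simplified])
      finally show ?thesis using assms d0 by (simp add: powr_pred_mult add_increasing)
    qed
    have "\<bar>a\<bar> powr p - \<bar>b\<bar> powr p \<le> p * (g_pow p a * (a - b))"
      using powr_above_tangent[OF assms(1), of a b] by (simp add: algebra_simps)
    also have "\<dots> \<le> p * \<bar>g_pow p a * (a - b)\<bar>"
      using assms by (intro mult_left_mono) auto
    also have "\<dots> = p * (\<bar>a\<bar> powr (p - 1) * d)"
      by (simp add: abs_mult g_pow_abs d_def)
    also have "\<dots> \<le> p * (\<eta> * \<bar>a\<bar> powr p + \<eta> powr (1 - p) * d powr p)"
      using assms 1 by (intro mult_left_mono) auto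
    also have "\<dots> \<le> p * (\<eta> * (\<bar>a\<bar> powr p + \<bar>b\<bar> powr p) + \<eta> powr (1 - p) * d powr p)"
      using assms by (intro mult_left_mono add_mono) auto
    finally show ?thesis by (simp add: d_def)
  qed
  show ?thesis
    using *[of a b] *[of b a] by (auto simp: abs_le_iff abs_minus_commute add.commute)
qed

text \<open>The negative part is a decreasing contraction: its increment never has the sign of \<open>a - b\<close> and is
  no larger in absolute value. This makes the negative part the right test function for a supersolution.\<close>

lemma g_pow_neg_part_le:
  assumes "1 < p"
  shows "g_pow p (a - b) * (max 0 (- a) - max 0 (- b)) \<le> - (\<bar>max 0 (- a) - max 0 (- b)\<bar> powr p)"
proof -
  define n where "n = max 0 (- a) - max 0 (- b)"
  have key: "\<bar>n\<bar> powr p \<le> \<bar>a - b\<bar> powr (p - 1) * \<bar>n\<bar>"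
  proof -
    have "\<bar>n\<bar> powr p = \<bar>n\<bar> powr (p - 1) * \<bar>n\<bar>" by (simp add: powr_pred_mult)
    also have "\<dots> \<le> \<bar>a - b\<bar> powr (p - 1) * \<bar>n\<bar>"
      using assms by (intro mult_right_mono powr_mono2) (auto simp: n_def)
    finally show ?thesis .
  qed
  show ?thesis
  proof (cases "a \<le> b")
    case True
    then have "n \<ge> 0" by (auto simp: n_def)
    then show ?thesis using key True unfolding n_def[symmetric]
      by (simp add: g_pow_nonpos)
  next
    case False
    then have "n \<le> 0" by (auto simp: n_def)
    then show ?thesis using key False unfolding n_def[symmetric]
      by (simp add: g_pow_nonneg)
  qed
qed

text \<open>The pointwise inequality behind the strong maximum principle, for a barrier \<open>w \<le> \<epsilon>\<close> and the test
  function \<open>f = (w - u)\<^sup>+\<close>. Where \<open>f x \<ge> f y\<close> and \<open>f x > 0\<close>, the increment of \<open>u\<close> is at most that of \<open>w\<close>, and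
  monotonicity of \<open>g\<close> lets \<open>w\<close> take the place of \<open>u\<close>. If moreover \<open>u y \<ge> \<delta>\<close>, then \<open>u x - u y \<le> \<epsilon> - \<delta>\<close>, and the
  pair contributes a definite negative amount.\<close>

lemma g_pow_barrier_le:
  fixes ux uy wx wy \<epsilon> \<delta> p :: real
  assumes "1 < p" "0 < \<epsilon>" "2 * \<epsilon> \<le> \<delta>" "0 \<le> ux" "0 \<le> uy" "0 \<le> wx" "0 \<le> wy" "wx \<le> \<epsilon>" "wy \<le> \<epsilon>"
  defines "fx \<equiv> max 0 (wx - ux)" and "fy \<equiv> max 0 (wy - uy)"
  shows "g_pow p (ux - uy) * (fx - fy)
    \<le> \<bar>wx - wy\<bar> powr (p - 1) * (fx + fy)
      - ((\<delta> - \<epsilon>) powr (p - 1) - \<epsilon> powr (p - 1)) * ((if \<delta> \<le> uy then fx else 0) + (if \<delta> \<le> ux then fy else 0))"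
proof -
  define m where "m = (\<delta> - \<epsilon>) powr (p - 1) - \<epsilon> powr (p - 1)"
  have *: "g_pow p (ux - uy) * (fx - fy) \<le> \<bar>wx - wy\<bar> powr (p - 1) * (fx + fy)
      - m * ((if \<delta> \<le> uy then fx else 0) + (if \<delta> \<le> ux then fy else 0))"
    if "0 \<le> ux" "0 \<le> uy" "0 \<le> wx" "0 \<le> wy" "wx \<le> \<epsilon>" "wy \<le> \<epsilon>" "fx \<ge> fy" "fx = max 0 (wx - ux)" "fy = max 0 (wy - uy)"
    for ux uy wx wy fx fy :: real
  proof -
    have w: "g_pow p (wx - wy) * (fx - fy) \<le> \<bar>wx - wy\<bar> powr (p - 1) * (fx + fy)"
    proof -
      have "g_pow p (wx - wy) * (fx - fy) \<le> \<bar>g_pow p (wx - wy)\<bar> * \<bar>fx - fy\<bar>"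
        by (metis abs_ge_self abs_mult)
      also have "\<dots> \<le> \<bar>wx - wy\<bar> powr (p - 1) * (fx + fy)"
        unfolding g_pow_abs using that by (intro mult_left_mono) auto
      finally show ?thesis .
    qed
    show ?thesis
    proof (cases "fx = 0")
      case True
      then have "fy = 0" using that by auto
      then show ?thesis using True by simp
    next
      case False
      then have fx: "fx > 0" "ux < wx" "fx = wx - ux" using that by (auto simp: max_def split: if_splits)
      then have nux: "\<not> \<delta> \<le> ux" using that assms by auto
      show ?thesis
      proof (cases "\<delta> \<le> uy")
        case True
        then have fy: "fy = 0" using that assms by (auto simp: max_def)
        have "(\<delta> - \<epsilon>) powr (p - 1) \<le> (uy - ux) powr (p - 1)"
          using assms True fx that by (intro powr_mono2) auto
        then have "g_pow p (ux - uy) \<le> - ((\<delta> - \<epsilon>) powr (p - 1))"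
          using True nux by (simp add: g_pow_nonpos)
        also have "\<dots> \<le> - m" by (simp add: m_def)
        finally have "g_pow p (ux - uy) * fx \<le> - m * fx" using fx by (intro mult_right_mono) auto
        moreover have "0 \<le> \<bar>wx - wy\<bar> powr (p - 1) * fx" using fx by auto
        ultimately show ?thesis using True nux fy by simp
      next
        case False
        have "ux - uy \<le> wx - wy" using fx that by (auto simp: max_def split: if_splits)
        then have "g_pow p (ux - uy) \<le> g_pow p (wx - wy)" using assms by (intro g_pow_mono) auto
        then have "g_pow p (ux - uy) * (fx - fy) \<le> g_pow p (wx - wy) * (fx - fy)"
          using that by (intro mult_right_mono) auto
        also note w
        finally show ?thesis using False nux by simp
      qed
    qed
  qed
  show ?thesis
  proof (cases "fx \<ge> fy")
    case True
    then show ?thesis using *[OF assms(4-9) _ assms(10,11)[THEN meta_eq_to_obj_eq]] unfolding m_def by simp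
  next
    case False
    have "g_pow p (uy - ux) * (fy - fx) = g_pow p (ux - uy) * (fx - fy)"
      using g_pow_minus[of p "ux - uy"] by (simp add: algebra_simps)
    moreover have "g_pow p (uy - ux) * (fy - fx) \<le> \<bar>wy - wx\<bar> powr (p - 1) * (fy + fx)
      - m * ((if \<delta> \<le> ux then fy else 0) + (if \<delta> \<le> uy then fx else 0))"
      by (rule *) (use assms(4-9) False in \<open>auto simp: fx_def fy_def\<close>)
    ultimately show ?thesis
      unfolding m_def by (simp only: abs_minus_commute[of wy wx] add.commute)
  qed
qed

section \<open>The form as a nonnegative kernel plus a bounded potential\<close>

abbreviation lborel2 :: "('a::euclidean_space \<times> 'a) measure" where
  "lborel2 \<equiv> lborel \<Otimes>\<^sub>M lborel"

lemma AE_lborel2_fst: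
  assumes "AE x in lborel. P x"
  shows "AE z in (lborel2 :: ('a::euclidean_space \<times> 'a) measure). P (fst z)"
proof -
  obtain N where N: "N \<in> null_sets lborel" "{x. \<not> P x} \<subseteq> N"
    using assms by (auto elim!: AE_E simp: null_sets_def)
  have [measurable]: "N \<in> sets borel" using N by (auto simp: null_sets_def)
  have "AE z in (lborel2 :: ('a \<times> 'a) measure). fst z \<notin> N"
    by (rule lborel_pair.AE_pair_measure, measurable) (use AE_not_in[OF N(1)] in auto)
  then show ?thesis using N by (auto elim!: eventually_mono)
qed

lemma AE_lborel2_snd:
  assumes "AE x in lborel. P x"
  shows "AE z in (lborel2 :: ('a::euclidean_space \<times> 'a) measure). P (snd z)"
proof -
  obtain N where N: "N \<in> null_sets lborel" "{x. \<not> P x} \<subseteq> N"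
    using assms by (auto elim!: AE_E simp: null_sets_def)
  have [measurable]: "N \<in> sets borel" using N by (auto simp: null_sets_def)
  have "AE z in (lborel2 :: ('a \<times> 'a) measure). snd z \<notin> N"
    by (rule lborel_pair.AE_pair_measure, measurable) (use AE_not_in[OF N(1)] in auto)
  then show ?thesis using N by (auto elim!: eventually_mono)
qed

text \<open>Lebesgue measurable functions have Borel representatives, and for those the completed measure can be
  replaced by \<open>lborel\<close>, whose square is a product measure to which Fubini's theorem applies.\<close>

lemma integral_lebesgue_AE_borel:
  fixes f g :: "'a::euclidean_space \<Rightarrow> real"
  assumes [measurable]: "f \<in> borel_measurable borel" and eq: "AE x in lborel. g x = f x"
  shows "(LINT x|lebesgue. g x) = (LINT x|lborel. f x)"
proof -
  have f: "f \<in> borel_measurable lebesgue" by (intro measurable_completion) simp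
  have AE: "AE x in lebesgue. f x = g x" using AE_completion[OF eq] by (auto elim!: eventually_mono)
  have "g \<in> borel_measurable lebesgue" by (rule borel_measurable_AE[OF f AE])
  then have "(LINT x|lebesgue. g x) = (LINT x|lebesgue. f x)"
    using f AE by (intro integral_cong_AE) (auto elim!: eventually_mono)
  then show ?thesis by (simp add: integral_completion)
qed

lemma integrable_lborel2_swap:
  fixes f :: "'a::euclidean_space \<times> 'a \<Rightarrow> real"
  assumes "integrable lborel2 f"
  shows "integrable lborel2 (\<lambda>z. f (snd z, fst z))"
  using lborel_pair.integrable_product_swap[OF assms] by (simp add: case_prod_unfold)

lemma integral_lborel2_swap:
  fixes f :: "'a::euclidean_space \<times> 'a \<Rightarrow> real"
  assumes "f \<in> borel_measurable lborel2"
  shows "(LINT z|lborel2. f (snd z, fst z)) = (LINT z|lborel2. f z)"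
  using lborel_pair.integral_product_swap[OF assms] by (simp add: case_prod_unfold)

text \<open>Schur's test for the trivial exponent: a kernel whose sections have mass at most \<open>H\<close>
  sends integrable functions to integrable functions.\<close>

lemma schur_integrable:
  fixes h :: "'a::euclidean_space \<times> 'a \<Rightarrow> real" and f :: "'a \<Rightarrow> real"
  assumes [measurable]: "h \<in> borel_measurable lborel2" and h0: "\<And>z. 0 \<le> h z"
    and H: "\<And>x. (\<integral>\<^sup>+y. ennreal (h (x, y)) \<partial>lborel) \<le> ennreal H" "0 \<le> H"
    and f: "integrable lborel f"
  shows "integrable lborel2 (\<lambda>z. h z * f (fst z))"
    and "(LINT z|lborel2. h z * f (fst z)) = (LINT x|lborel. (LINT y|lborel. h (x, y)) * f x)"
    and "(\<And>x. 0 \<le> f x) \<Longrightarrow> (LINT z|lborel2. h z * f (fst z)) \<le> H * (LINT x|lborel. f x)"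
proof -
  have [measurable]: "f \<in> borel_measurable borel" using f by auto
  have inth: "integrable lborel (\<lambda>y. h (x, y))" for x
    using H(1)[of x] h0 by (intro integrableI_bounded) (auto intro: order_le_less_trans)
  have "(\<integral>\<^sup>+z. ennreal (norm (h z * f (fst z))) \<partial>lborel2)
      = (\<integral>\<^sup>+x. \<integral>\<^sup>+y. ennreal (norm (h (x, y) * f x)) \<partial>lborel \<partial>lborel)"
    by (subst lborel.nn_integral_fst[symmetric]) auto
  also have "\<dots> = (\<integral>\<^sup>+x. \<integral>\<^sup>+y. ennreal (h (x, y)) * ennreal \<bar>f x\<bar> \<partial>lborel \<partial>lborel)"
    using h0 by (intro nn_integral_cong) (simp add: abs_mult ennreal_mult)
  also have "\<dots> = (\<integral>\<^sup>+x. (\<integral>\<^sup>+y. ennreal (h (x, y)) \<partial>lborel) * ennreal \<bar>f x\<bar> \<partial>lborel)"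
    by (intro nn_integral_cong nn_integral_multc) auto
  also have "\<dots> \<le> (\<integral>\<^sup>+x. ennreal H * ennreal \<bar>f x\<bar> \<partial>lborel)"
    by (intro nn_integral_mono mult_right_mono H) auto
  also have "\<dots> = ennreal H * (\<integral>\<^sup>+x. ennreal \<bar>f x\<bar> \<partial>lborel)"
    by (intro nn_integral_cmult) auto
  also have "\<dots> < \<infinity>"
    using f by (auto simp: integrable_iff_bounded ennreal_mult_less_top)
  finally show int: "integrable lborel2 (\<lambda>z. h z * f (fst z))"
    by (intro integrableI_bounded) auto
  have fst: "integrable lborel (\<lambda>x. LINT y|lborel. h (x, y) * f x)"
    using lborel_pair.integrable_fst'[OF int] by simp
  show eq: "(LINT z|lborel2. h z * f (fst z)) = (LINT x|lborel. (LINT y|lborel. h (x, y)) * f x)"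
    by (subst lborel_pair.integral_fst'[OF int, symmetric]) simp
  have le: "(LINT y|lborel. h (x, y)) \<le> H" for x
  proof -
    have "ennreal (LINT y|lborel. h (x, y)) = (\<integral>\<^sup>+y. ennreal (h (x, y)) \<partial>lborel)"
      using inth h0 by (intro nn_integral_eq_integral[symmetric]) auto
    then show ?thesis using H by (metis ennreal_le_iff)
  qed
  show "(LINT z|lborel2. h z * f (fst z)) \<le> H * (LINT x|lborel. f x)" if "\<And>x. 0 \<le> f x"
  proof -
    have "(LINT x|lborel. (LINT y|lborel. h (x, y)) * f x) \<le> (LINT x|lborel. H * f x)"
      using fst f le that by (intro integral_mono mult_right_mono) auto
    then show ?thesis using eq by simp
  qed
qed

lemma C_const_pos: "1 < p \<Longrightarrow> 0 < N \<Longrightarrow> 0 < C_const N p"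
  by (simp add: C_const_def Gamma_real_pos)

text \<open>The exponent and the domain are fixed once and for all, so that the kernel, the potential and the
  function space can be named without parameters.\<close>

locale log_laplacian_domain =
  fixes p :: real and \<Omega> :: "'a::euclidean_space set"
  assumes p: "1 < p" and open_\<Omega>: "open \<Omega>" and bounded_\<Omega>: "bounded \<Omega>"
begin

lemma measurable_\<Omega> [measurable]: "\<Omega> \<in> sets borel"
  using open_\<Omega> by simp

lemma emeasure_\<Omega>: "emeasure lborel \<Omega> = ennreal (measure lborel \<Omega>)"
proof -
  have "emeasure lborel \<Omega> < \<infinity>" using bounded_\<Omega> by (rule emeasure_bounded_finite)
  then show ?thesis by (simp add: emeasure_eq_ennreal_measure)
qed

lemma integrable_on_\<Omega>: "integrable lborel (indicator \<Omega> :: 'a \<Rightarrow> real)"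
  using emeasure_\<Omega> by (simp add: integrable_indicator_iff)

text \<open>All interactions that remain after the subtracted terms have been moved into the potential. On the
  diagonal the value is \<open>0\<close>, as \<open>1 / 0 = 0\<close>.\<close>

definition kern :: "'a \<times> 'a \<Rightarrow> real" where
  "kern z = (if norm (fst z - snd z) < 1 \<or> (fst z \<in> \<Omega> \<and> snd z \<in> \<Omega>)
     then 1 / norm (fst z - snd z) ^ DIM('a) else 0)"

definition far :: "'a \<times> 'a \<Rightarrow> real" where
  "far z = (if norm (fst z - snd z) \<ge> 1 \<and> fst z \<in> \<Omega> \<and> snd z \<in> \<Omega>
     then 1 / norm (fst z - snd z) ^ DIM('a) else 0)"

definition pot :: "'a \<Rightarrow> real" where
  "pot x = rho_const DIM('a) p - C_const DIM('a) p * (LINT y|lborel. far (x, y))"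

lemma measurable_kern [measurable]: "kern \<in> borel_measurable lborel2"
  unfolding kern_def[abs_def] by measurable

lemma measurable_far [measurable]: "far \<in> borel_measurable lborel2"
  unfolding far_def[abs_def] by measurable

lemma measurable_pot [measurable]: "pot \<in> borel_measurable borel"
proof -
  have "(\<lambda>x. LINT y|lborel. far (x, y)) \<in> borel_measurable lborel" by measurable
  then show ?thesis unfolding pot_def[abs_def] by measurable
qed

lemma kern_nonneg: "0 \<le> kern z" by (simp add: kern_def)
lemma far_nonneg: "0 \<le> far z" by (simp add: far_def)
lemma kern_swap: "kern (y, x) = kern (x, y)" by (auto simp: kern_def norm_minus_commute)
lemma far_swap: "far (y, x) = far (x, y)" by (auto simp: far_def norm_minus_commute)

lemma far_le: "far (x, y) \<le> indicator \<Omega> y"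
proof (cases "norm (x - y) \<ge> 1")
  case True
  then have "1 \<le> norm (x - y) ^ DIM('a)" by (simp add: one_le_power)
  then show ?thesis by (auto simp: far_def divide_le_eq)
qed (simp add: far_def)

lemma nn_integral_far: "(\<integral>\<^sup>+y. ennreal (far (x, y)) \<partial>lborel) \<le> ennreal (measure lborel \<Omega>)"
proof -
  have "(\<integral>\<^sup>+y. ennreal (far (x, y)) \<partial>lborel) \<le> (\<integral>\<^sup>+y. indicator \<Omega> y \<partial>lborel)"
    using ennreal_leI[OF far_le, of x] by (intro nn_integral_mono) (simp add: ennreal_indicator)
  then show ?thesis by (simp add: emeasure_\<Omega>)
qed

definition pot_bound :: real where
  "pot_bound = \<bar>rho_const DIM('a) p\<bar> + C_const DIM('a) p * measure lborel \<Omega>"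

lemma abs_pot_le: "\<bar>pot x\<bar> \<le> pot_bound"
proof -
  have "(LINT y|lborel. far (x, y)) \<le> (LINT y|lborel. indicator \<Omega> y)"
    using integrable_on_\<Omega> far_le far_nonneg by (intro integral_mono') auto
  moreover have "0 \<le> (LINT y|lborel. far (x, y))" using far_nonneg by (intro integral_nonneg_AE) auto
  moreover have "0 < C_const DIM('a) p" using p by (intro C_const_pos) auto
  ultimately have "\<bar>C_const DIM('a) p * (LINT y|lborel. far (x, y))\<bar> \<le> C_const DIM('a) p * measure lborel \<Omega>"
    by (auto simp: abs_mult intro!: mult_left_mono)
  then show ?thesis unfolding pot_def pot_bound_def by linarith
qed

lemma pot_bound_nonneg: "0 \<le> pot_bound"
  using abs_pot_le[of 0] by linarith

text \<open>Borel representatives that vanish everywhere off \<open>\<Omega>\<close>. The energy is taken with respect to \<open>kern\<close>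
  instead of \<open>\<bar>x - y\<bar> < 1\<close>; for functions in \<open>L\<^sup>p\<close> the additional pairs contribute a finite amount.\<close>

definition X0_borel :: "('a \<Rightarrow> real) set" where
  "X0_borel = {u \<in> borel_measurable borel. (\<forall>x. x \<notin> \<Omega> \<longrightarrow> u x = 0) \<and>
     integrable lborel (\<lambda>x. \<bar>u x\<bar> powr p) \<and>
     integrable lborel2 (\<lambda>z. kern z * \<bar>u (fst z) - u (snd z)\<bar> powr p)}"

definition form :: "('a \<Rightarrow> real) \<Rightarrow> ('a \<Rightarrow> real) \<Rightarrow> real" where
  "form u v = C_const DIM('a) p / 2 *
       (LINT z|lborel2. kern z * (g_pow p (u (fst z) - u (snd z)) * (v (fst z) - v (snd z))))
     + (LINT x|lborel. pot x * (g_pow p (u x) * v x))"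

lemma X0_borel_measurable: "u \<in> X0_borel \<Longrightarrow> u \<in> borel_measurable borel"
  by (simp add: X0_borel_def)

lemma X0_borel_zero: "u \<in> X0_borel \<Longrightarrow> x \<notin> \<Omega> \<Longrightarrow> u x = 0"
  by (simp add: X0_borel_def)

lemma X0_borel_integrable: "u \<in> X0_borel \<Longrightarrow> integrable lborel (\<lambda>x. \<bar>u x\<bar> powr p)"
  by (simp add: X0_borel_def)

lemma X0_borel_energy: "u \<in> X0_borel \<Longrightarrow> integrable lborel2 (\<lambda>z. kern z * \<bar>u (fst z) - u (snd z)\<bar> powr p)"
  by (simp add: X0_borel_def)

lemma X0_borel_energy_nonneg: "0 \<le> kern z * \<bar>a\<bar> powr p"
  by (simp add: kern_nonneg)

lemma X0_borel_integrable_g: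
  assumes u: "u \<in> X0_borel" and v: "v \<in> X0_borel"
  shows "integrable lborel (\<lambda>x. g_pow p (u x) * v x)"
proof -
  note [measurable] = X0_borel_measurable[OF u] X0_borel_measurable[OF v]
  show ?thesis
  proof (rule Bochner_Integration.integrable_bound)
    show "integrable lborel (\<lambda>x. \<bar>u x\<bar> powr p + \<bar>v x\<bar> powr p)"
      using X0_borel_integrable u v by auto
    show "AE x in lborel. norm (g_pow p (u x) * v x) \<le> norm (\<bar>u x\<bar> powr p + \<bar>v x\<bar> powr p)"
      using abs_g_pow_mult_le[OF p] by auto
  qed measurable
qed

lemma integrable_pot:
  fixes f :: "'a \<Rightarrow> real"
  assumes "integrable lborel f"
  shows "integrable lborel (\<lambda>x. pot x * f x)"
proof (rule Bochner_Integration.integrable_bound)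
  show "integrable lborel (\<lambda>x. pot_bound * f x)" using assms by auto
  have [measurable]: "f \<in> borel_measurable borel" using assms by auto
  show "(\<lambda>x. pot x * f x) \<in> borel_measurable lborel" by measurable
  show "AE x in lborel. norm (pot x * f x) \<le> norm (pot_bound * f x)"
    using abs_pot_le pot_bound_nonneg by (auto simp: abs_mult intro!: mult_right_mono)
qed

lemma X0_borel_integrable_kern_g:
  assumes u: "u \<in> X0_borel" and v: "v \<in> X0_borel"
  shows "integrable lborel2 (\<lambda>z. kern z * (g_pow p (u (fst z) - u (snd z)) * (v (fst z) - v (snd z))))"
proof -
  note [measurable] = X0_borel_measurable[OF u] X0_borel_measurable[OF v]
  show ?thesis
  proof (rule Bochner_Integration.integrable_bound)
    show "integrable lborel2 (\<lambda>z. kern z * \<bar>u (fst z) - u (snd z)\<bar> powr p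
        + kern z * \<bar>v (fst z) - v (snd z)\<bar> powr p)"
      using X0_borel_energy u v by auto
    show "AE z in lborel2. norm (kern z * (g_pow p (u (fst z) - u (snd z)) * (v (fst z) - v (snd z))))
        \<le> norm (kern z * \<bar>u (fst z) - u (snd z)\<bar> powr p + kern z * \<bar>v (fst z) - v (snd z)\<bar> powr p)"
    proof (rule AE_I2)
      fix z
      have "\<bar>kern z * (g_pow p (u (fst z) - u (snd z)) * (v (fst z) - v (snd z)))\<bar>
        = kern z * \<bar>g_pow p (u (fst z) - u (snd z)) * (v (fst z) - v (snd z))\<bar>"
        using kern_nonneg[of z] by (simp add: abs_mult)
      also have "\<dots> \<le> kern z * (\<bar>u (fst z) - u (snd z)\<bar> powr p + \<bar>v (fst z) - v (snd z)\<bar> powr p)"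
        using kern_nonneg abs_g_pow_mult_le[OF p] by (intro mult_left_mono)
      finally show "norm (kern z * (g_pow p (u (fst z) - u (snd z)) * (v (fst z) - v (snd z))))
        \<le> norm (kern z * \<bar>u (fst z) - u (snd z)\<bar> powr p + kern z * \<bar>v (fst z) - v (snd z)\<bar> powr p)"
        by (simp add: distrib_left)
    qed
  qed measurable
qed

lemma form_self:
  "form u u = C_const DIM('a) p / 2 * (LINT z|lborel2. kern z * \<bar>u (fst z) - u (snd z)\<bar> powr p)
     + (LINT x|lborel. pot x * \<bar>u x\<bar> powr p)"
  by (simp add: form_def g_pow_mult_self)

lemma C_pos: "0 < C_const DIM('a) p"
  using p by (intro C_const_pos) auto

lemma X0_borel_add:
  assumes u: "u \<in> X0_borel" and v: "v \<in> X0_borel"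
  shows "(\<lambda>x. u x + c * v x) \<in> X0_borel"
proof -
  note [measurable] = X0_borel_measurable[OF u] X0_borel_measurable[OF v]
  have le: "\<bar>a + c * b\<bar> powr p \<le> 2 powr p * (\<bar>a\<bar> powr p + \<bar>c\<bar> powr p * \<bar>b\<bar> powr p)" for a b
    using abs_add_powr_le[of p a "c * b"] p by (simp add: abs_mult powr_mult)
  have "integrable lborel (\<lambda>x. \<bar>u x + c * v x\<bar> powr p)"
  proof (rule Bochner_Integration.integrable_bound)
    show "integrable lborel (\<lambda>x. 2 powr p * (\<bar>u x\<bar> powr p + \<bar>c\<bar> powr p * \<bar>v x\<bar> powr p))"
      using X0_borel_integrable u v by auto
  qed (use u v le in auto)
  moreover have "integrable lborel2 (\<lambda>z. kern z * \<bar>(u (fst z) + c * v (fst z)) - (u (snd z) + c * v (snd z))\<bar> powr p)"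
  proof (rule Bochner_Integration.integrable_bound)
    show "integrable lborel2 (\<lambda>z. 2 powr p * (kern z * \<bar>u (fst z) - u (snd z)\<bar> powr p
        + \<bar>c\<bar> powr p * (kern z * \<bar>v (fst z) - v (snd z)\<bar> powr p)))"
      using X0_borel_energy[OF u] X0_borel_energy[OF v] by auto
    show "AE z in lborel2. norm (kern z * \<bar>(u (fst z) + c * v (fst z)) - (u (snd z) + c * v (snd z))\<bar> powr p)
      \<le> norm (2 powr p * (kern z * \<bar>u (fst z) - u (snd z)\<bar> powr p
        + \<bar>c\<bar> powr p * (kern z * \<bar>v (fst z) - v (snd z)\<bar> powr p)))"
    proof (rule AE_I2)
      fix z
      have "kern z * \<bar>(u (fst z) + c * v (fst z)) - (u (snd z) + c * v (snd z))\<bar> powr p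
        = kern z * \<bar>(u (fst z) - u (snd z)) + c * (v (fst z) - v (snd z))\<bar> powr p"
        by (simp add: algebra_simps)
      also have "\<dots> \<le> kern z * (2 powr p * (\<bar>u (fst z) - u (snd z)\<bar> powr p + \<bar>c\<bar> powr p * \<bar>v (fst z) - v (snd z)\<bar> powr p))"
        using kern_nonneg le by (intro mult_left_mono)
      finally show "norm (kern z * \<bar>(u (fst z) + c * v (fst z)) - (u (snd z) + c * v (snd z))\<bar> powr p)
        \<le> norm (2 powr p * (kern z * \<bar>u (fst z) - u (snd z)\<bar> powr p
        + \<bar>c\<bar> powr p * (kern z * \<bar>v (fst z) - v (snd z)\<bar> powr p)))"
        using kern_nonneg[of z] by (simp add: algebra_simps)
    qed
  qed measurable
  moreover have "(\<lambda>x. u x + c * v x) \<in> borel_measurable borel" by measurable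
  ultimately show ?thesis using X0_borel_zero u v by (simp add: X0_borel_def)
qed

lemma X0_borel_zero_fun: "(\<lambda>x. 0) \<in> X0_borel"
  by (simp add: X0_borel_def)

lemma X0_borel_scale: "u \<in> X0_borel \<Longrightarrow> (\<lambda>x. c * u x) \<in> X0_borel"
  using X0_borel_add[OF X0_borel_zero_fun, of u c] by simp

text \<open>Truncations act on the space because both integrals only see \<open>\<bar>u x\<bar>\<close> and increments of \<open>u\<close>; used for
  positive parts, negative parts and the absolute value.\<close>

lemma X0_borel_contraction:
  fixes \<theta> :: "real \<Rightarrow> real"
  assumes u: "u \<in> X0_borel" and [measurable]: "\<theta> \<in> borel_measurable borel"
    and lip: "\<And>a b. \<bar>\<theta> a - \<theta> b\<bar> \<le> \<bar>a - b\<bar>" and 0: "\<theta> 0 = 0"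
  shows "(\<lambda>x. \<theta> (u x)) \<in> X0_borel"
proof -
  note [measurable] = X0_borel_measurable[OF u]
  have "integrable lborel (\<lambda>x. \<bar>\<theta> (u x)\<bar> powr p)"
    by (rule Bochner_Integration.integrable_bound[OF X0_borel_integrable[OF u]])
      (use u lip[of _ 0] 0 p in \<open>auto intro!: powr_mono2\<close>)
  moreover have "integrable lborel2 (\<lambda>z. kern z * \<bar>\<theta> (u (fst z)) - \<theta> (u (snd z))\<bar> powr p)"
    by (rule Bochner_Integration.integrable_bound[OF X0_borel_energy[OF u]])
      (use u lip p kern_nonneg in \<open>auto intro!: powr_mono2 mult_left_mono\<close>)
  moreover have "(\<lambda>x. \<theta> (u x)) \<in> borel_measurable borel" by measurable
  ultimately show ?thesis using X0_borel_zero[OF u] 0 by (simp add: X0_borel_def)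
qed

lemma integrable_far:
  fixes f :: "'a \<Rightarrow> real"
  assumes "integrable lborel f"
  shows "integrable lborel2 (\<lambda>z. far z * f (fst z))"
    and "integrable lborel2 (\<lambda>z. far z * f (snd z))"
    and "(LINT z|lborel2. far z * f (fst z)) = (LINT x|lborel. (LINT y|lborel. far (x, y)) * f x)"
    and "(LINT z|lborel2. far z * f (snd z)) = (LINT x|lborel. (LINT y|lborel. far (x, y)) * f x)"
proof -
  have [measurable]: "f \<in> borel_measurable borel" using assms by auto
  note S = schur_integrable[OF measurable_far far_nonneg nn_integral_far _ assms]
  show 1: "integrable lborel2 (\<lambda>z. far z * f (fst z))" by (rule S(1)) simp
  show 2: "(LINT z|lborel2. far z * f (fst z)) = (LINT x|lborel. (LINT y|lborel. far (x, y)) * f x)"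
    by (rule S(2)) simp
  have swap: "far (snd z, fst z) = far z" for z using far_swap[of "snd z" "fst z"] by simp
  show "integrable lborel2 (\<lambda>z. far z * f (snd z))"
    using integrable_lborel2_swap[OF 1] by (simp add: swap)
  have "(LINT z|lborel2. far z * f (snd z)) = (LINT z|lborel2. far (snd z, fst z) * f (fst (snd z, fst z)))"
    by (simp add: swap)
  also have "\<dots> = (LINT z|lborel2. far z * f (fst z))"
    by (rule integral_lborel2_swap[where f = "\<lambda>z. far z * f (fst z)"]) measurable
  finally show "(LINT z|lborel2. far z * f (snd z)) = (LINT x|lborel. (LINT y|lborel. far (x, y)) * f x)"
    using 2 by simp
qed

text \<open>Because elements of \<open>X0_borel\<close> vanish off \<open>\<Omega>\<close>, the integrand over \<open>\<bar>x - y\<bar> \<ge> 1\<close> is zero unless both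
  points lie in \<open>\<Omega>\<close>, and there the kernel is bounded by \<open>1\<close>. So the two subtracted terms can be
  integrated separately and become part of the potential.\<close>

lemma E_form_eq_form:
  assumes u: "u \<in> X0_borel" and v: "v \<in> X0_borel"
    and u': "AE x in lborel. u' x = u x" and v': "AE x in lborel. v' x = v x"
  shows "E_form p u' v' = form u v"
proof -
  note [measurable] = X0_borel_measurable[OF u] X0_borel_measurable[OF v]
  define G where "G z = g_pow p (u (fst z) - u (snd z)) * (v (fst z) - v (snd z))" for z
  define f where "f x = g_pow p (u x) * v x" for x
  have [measurable]: "G \<in> borel_measurable lborel2" unfolding G_def[abs_def] by measurable
  have [measurable]: "f \<in> borel_measurable borel" unfolding f_def[abs_def] by measurable
  have f: "integrable lborel f" using X0_borel_integrable_g[OF u v] by (simp add: f_def[abs_def])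
  have kG: "integrable lborel2 (\<lambda>z. kern z * G z)"
    using X0_borel_integrable_kern_g[OF u v] by (simp add: G_def)
  define nr where "nr z = (if norm (fst z - snd z) < 1 then kern z * G z else 0)" for z
  define fr where "fr z = (if norm (fst z - snd z) < 1 then 0 else kern z * G z)
      - far z * f (fst z) - far z * f (snd z)" for z
  have nr: "integrable lborel2 nr" unfolding nr_def[abs_def]
    by (rule Bochner_Integration.integrable_bound[OF kG]) auto
  have fr1: "integrable lborel2 (\<lambda>z. if norm (fst z - snd z) < 1 then 0 else kern z * G z)"
    by (rule Bochner_Integration.integrable_bound[OF kG]) auto
  have fr: "integrable lborel2 fr" unfolding fr_def[abs_def]
    using fr1 integrable_far(1,2)[OF f] by auto
  have [measurable]: "nr \<in> borel_measurable lborel2" "fr \<in> borel_measurable lborel2"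
    using nr fr by auto
  have AE2: "AE z in lborel2. u' (fst z) = u (fst z) \<and> u' (snd z) = u (snd z) \<and> v' (fst z) = v (fst z) \<and> v' (snd z) = v (snd z)"
    using AE_lborel2_fst[OF u'] AE_lborel2_snd[OF u'] AE_lborel2_fst[OF v'] AE_lborel2_snd[OF v'] by eventually_elim auto
  have m: "f \<in> borel_measurable borel" if "f \<in> borel_measurable lborel2" for f :: "'a \<times> 'a \<Rightarrow> real"
    using that unfolding lborel_prod by simp
  have "(LINT z:{(x, y). norm (x - y) < 1}|lebesgue.
          (case z of (x, y) \<Rightarrow> g_pow p (u' x - u' y) * (v' x - v' y) / norm (x - y) ^ DIM('a))) = (LINT z|lborel. nr z)"
    unfolding set_lebesgue_integral_def
  proof (rule integral_lebesgue_AE_borel)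
    show "AE z in lborel. indicat_real {(x, y). norm (x - y) < 1} z *\<^sub>R
         (case z of (x, y) \<Rightarrow> g_pow p (u' x - u' y) * (v' x - v' y) / norm (x - y) ^ DIM('a)) = nr z"
      using AE2 unfolding lborel_prod by eventually_elim (auto simp: nr_def G_def kern_def)
  qed (rule m, measurable)
  moreover have "(LINT z:{(x, y). norm (x - y) \<ge> 1}|lebesgue.
          (case z of (x, y) \<Rightarrow> (g_pow p (u' x - u' y) * (v' x - v' y) - g_pow p (u' x) * v' x - g_pow p (u' y) * v' y)
               / norm (x - y) ^ DIM('a))) = (LINT z|lborel. fr z)"
    unfolding set_lebesgue_integral_def
  proof (rule integral_lebesgue_AE_borel)
    have g0: "g_pow p 0 = 0" by (simp add: g_pow_def)
    have "indicat_real {(x, y). norm (x - y) \<ge> 1} z *\<^sub>R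
         (case z of (x, y) \<Rightarrow> (g_pow p (u x - u y) * (v x - v y) - g_pow p (u x) * v x - g_pow p (u y) * v y) / norm (x - y) ^ DIM('a)) = fr z"
      for z
    proof (cases "fst z \<in> \<Omega> \<and> snd z \<in> \<Omega>")
      case True
      then show ?thesis
        by (cases z) (auto simp: fr_def G_def f_def kern_def far_def diff_divide_distrib)
    next
      case False
      then have "fst z \<notin> \<Omega> \<or> snd z \<notin> \<Omega>" by simp
      then show ?thesis
        using X0_borel_zero[OF u] X0_borel_zero[OF v] g0 g_pow_minus[of p]
        by (cases z) (auto simp: fr_def G_def f_def kern_def far_def)
    qed
    note 1 = this
    show "AE z in lborel. indicat_real {(x, y). norm (x - y) \<ge> 1} z *\<^sub>R
         (case z of (x, y) \<Rightarrow> (g_pow p (u' x - u' y) * (v' x - v' y) - g_pow p (u' x) * v' x - g_pow p (u' y) * v' y)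
               / norm (x - y) ^ DIM('a)) = fr z"
      using AE2 unfolding lborel_prod by eventually_elim (simp add: 1[symmetric] case_prod_unfold)
  qed (rule m, measurable)
  moreover have "(LINT x|lebesgue. g_pow p (u' x) * v' x) = (LINT x|lborel. f x)"
    by (rule integral_lebesgue_AE_borel, measurable) (use u' v' in eventually_elim, simp add: f_def)
  ultimately have E: "E_form p u' v' = C_const DIM('a) p / 2 * (LINT z|lborel2. nr z) + rho_const DIM('a) p * (LINT x|lborel. f x)
      + C_const DIM('a) p / 2 * (LINT z|lborel2. fr z)"
    unfolding E_form_def lborel_prod by simp
  have "(LINT z|lborel2. nr z) + (LINT z|lborel2. fr z) = (LINT z|lborel2. nr z + fr z)"
    using nr fr by simp
  also have "\<dots> = (LINT z|lborel2. kern z * G z - far z * f (fst z) - far z * f (snd z))"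
    by (intro Bochner_Integration.integral_cong) (auto simp: nr_def fr_def)
  also have "\<dots> = (LINT z|lborel2. kern z * G z) - 2 * (LINT x|lborel. (LINT y|lborel. far (x, y)) * f x)"
    using kG integrable_far[OF f] by simp
  finally have K: "(LINT z|lborel2. nr z) + (LINT z|lborel2. fr z)
     = (LINT z|lborel2. kern z * G z) - 2 * (LINT x|lborel. (LINT y|lborel. far (x, y)) * f x)" .
  have intk: "integrable lborel (\<lambda>x. (LINT y|lborel. far (x, y)) * f x)"
    using lborel_pair.integrable_fst'[OF integrable_far(1)[OF f]] by simp
  have "(LINT x|lborel. pot x * f x)
      = (LINT x|lborel. rho_const DIM('a) p * f x - C_const DIM('a) p * ((LINT y|lborel. far (x, y)) * f x))"
    by (intro Bochner_Integration.integral_cong) (auto simp: pot_def algebra_simps)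
  also have "\<dots> = rho_const DIM('a) p * (LINT x|lborel. f x)
      - C_const DIM('a) p * (LINT x|lborel. (LINT y|lborel. far (x, y)) * f x)"
    using f intk by simp
  finally have P: "(LINT x|lborel. pot x * f x) = rho_const DIM('a) p * (LINT x|lborel. f x)
      - C_const DIM('a) p * (LINT x|lborel. (LINT y|lborel. far (x, y)) * f x)" .
  have "E_form p u' v' = C_const DIM('a) p / 2 * ((LINT z|lborel2. nr z) + (LINT z|lborel2. fr z))
     + rho_const DIM('a) p * (LINT x|lborel. f x)"
    unfolding E by (simp add: algebra_simps)
  also have "\<dots> = C_const DIM('a) p / 2 * (LINT z|lborel2. kern z * G z) + (LINT x|lborel. pot x * f x)"
    unfolding K P by (simp add: algebra_simps)
  finally show ?thesis by (simp add: form_def G_def f_def)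
qed

lemma nn_integral_near:
  fixes u u' :: "'a \<Rightarrow> real"
  assumes [measurable]: "u \<in> borel_measurable borel" and u': "AE x in lborel. u' x = u x"
  shows "(\<integral>\<^sup>+x. (\<integral>\<^sup>+y \<in> ball x 1. ennreal (\<bar>u' x - u' y\<bar> powr p / norm (x - y) ^ DIM('a)) \<partial>lebesgue) \<partial>lebesgue)
    = (\<integral>\<^sup>+z. ennreal (if norm (fst z - snd z) < 1 then kern z * \<bar>u (fst z) - u (snd z)\<bar> powr p else 0) \<partial>lborel2)"
proof -
  have "(\<integral>\<^sup>+y \<in> ball x 1. ennreal (\<bar>u x - u' y\<bar> powr p / norm (x - y) ^ DIM('a)) \<partial>lebesgue)
    = (\<integral>\<^sup>+y. ennreal (if norm (x - y) < 1 then kern (x, y) * \<bar>u x - u y\<bar> powr p else 0) \<partial>lborel)" for x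
    unfolding nn_integral_completion
    by (rule nn_integral_cong_AE, use u' in eventually_elim) (auto simp: kern_def dist_norm)
  then have "(\<integral>\<^sup>+x. (\<integral>\<^sup>+y \<in> ball x 1. ennreal (\<bar>u' x - u' y\<bar> powr p / norm (x - y) ^ DIM('a)) \<partial>lebesgue) \<partial>lebesgue)
    = (\<integral>\<^sup>+x. (\<integral>\<^sup>+y. ennreal (if norm (x - y) < 1 then kern (x, y) * \<bar>u x - u y\<bar> powr p else 0) \<partial>lborel) \<partial>lborel)"
    unfolding nn_integral_completion[of lborel "\<lambda>x. \<integral>\<^sup>+y\<in>ball x 1. _ x y \<partial>lebesgue"]
    by (intro nn_integral_cong_AE, use u' in eventually_elim) simp
  also have "\<dots> = (\<integral>\<^sup>+z. ennreal (if norm (fst z - snd z) < 1 then kern z * \<bar>u (fst z) - u (snd z)\<bar> powr p else 0) \<partial>lborel2)"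
    by (subst lborel.nn_integral_fst[symmetric]) (measurable, simp cong: if_cong)
  finally show ?thesis .
qed

text \<open>Multiplying a Borel representative by the indicator of \<open>\<Omega>\<close> turns "zero almost everywhere off \<open>\<Omega>\<close>"
  into "zero everywhere off \<open>\<Omega>\<close>". Pairs in \<open>\<Omega>\<close> at distance at least \<open>1\<close> are controlled by the \<open>L\<^sup>p\<close> norm.\<close>

lemma X0_representative:
  assumes "u \<in> X0 p \<Omega>"
  obtains v where "v \<in> X0_borel" "AE x in lborel. u x = v x"
proof -
  have um: "u \<in> borel_measurable lebesgue" and ui: "integrable lebesgue (\<lambda>x. \<bar>u x\<bar> powr p)"
    and u0: "AE x in lborel. x \<notin> \<Omega> \<longrightarrow> u x = 0"
    and ue: "(\<integral>\<^sup>+x. (\<integral>\<^sup>+y \<in> ball x 1. ennreal (\<bar>u x - u y\<bar> powr p / norm (x - y) ^ DIM('a)) \<partial>lebesgue) \<partial>lebesgue) < \<infinity>"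
    using assms by (auto simp: X0_def AE_completion_iff)
  obtain w where w: "w \<in> borel_measurable lborel" "AE x in lborel. u x = w x"
    using completion_ex_borel_measurable_real[OF um] by auto
  have [measurable]: "w \<in> borel_measurable borel" using w by simp
  define v where "v x = w x * indicator \<Omega> x" for x
  have [measurable]: "v \<in> borel_measurable borel" unfolding v_def[abs_def] by measurable
  have uv: "AE x in lborel. u x = v x"
    using w(2) u0 by eventually_elim (auto simp: v_def indicator_def)
  have "integrable lebesgue (\<lambda>x. \<bar>v x\<bar> powr p)"
  proof (rule integrable_cong_AE_imp[OF ui])
    show "(\<lambda>x. \<bar>v x\<bar> powr p) \<in> borel_measurable lebesgue" by (intro measurable_completion) simp
    show "AE x in lebesgue. \<bar>u x\<bar> powr p = \<bar>v x\<bar> powr p"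
      using uv by (auto simp: AE_completion_iff elim: eventually_mono)
  qed
  then have vi: "integrable lborel (\<lambda>x. \<bar>v x\<bar> powr p)" by (simp add: integrable_completion)
  have near: "integrable lborel2 (\<lambda>z. if norm (fst z - snd z) < 1 then kern z * \<bar>v (fst z) - v (snd z)\<bar> powr p else 0)"
  proof (rule integrableI_bounded)
    have "(\<integral>\<^sup>+z. ennreal (norm (if norm (fst z - snd z) < 1 then kern z * \<bar>v (fst z) - v (snd z)\<bar> powr p else 0)) \<partial>lborel2)
      = (\<integral>\<^sup>+z. ennreal (if norm (fst z - snd z) < 1 then kern z * \<bar>v (fst z) - v (snd z)\<bar> powr p else 0) \<partial>lborel2)"
      using kern_nonneg by (intro nn_integral_cong) auto
    also have "\<dots> < \<infinity>" using ue nn_integral_near[of v u] uv by simp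
    finally show "(\<integral>\<^sup>+z. ennreal (norm (if norm (fst z - snd z) < 1 then kern z * \<bar>v (fst z) - v (snd z)\<bar> powr p else 0)) \<partial>lborel2) < \<infinity>" .
  qed measurable
  have fr: "integrable lborel2 (\<lambda>z. 2 powr p * (far z * \<bar>v (fst z)\<bar> powr p + far z * \<bar>v (snd z)\<bar> powr p))"
    using integrable_far(1,2)[OF vi] by auto
  have "integrable lborel2 (\<lambda>z. kern z * \<bar>v (fst z) - v (snd z)\<bar> powr p)"
  proof (rule Bochner_Integration.integrable_bound[OF Bochner_Integration.integrable_add[OF near fr]])
    show "AE z in lborel2. norm (kern z * \<bar>v (fst z) - v (snd z)\<bar> powr p)
      \<le> norm ((if norm (fst z - snd z) < 1 then kern z * \<bar>v (fst z) - v (snd z)\<bar> powr p else 0)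
          + 2 powr p * (far z * \<bar>v (fst z)\<bar> powr p + far z * \<bar>v (snd z)\<bar> powr p))"
    proof (rule AE_I2)
      fix z :: "'a \<times> 'a"
      show "norm (kern z * \<bar>v (fst z) - v (snd z)\<bar> powr p)
      \<le> norm ((if norm (fst z - snd z) < 1 then kern z * \<bar>v (fst z) - v (snd z)\<bar> powr p else 0)
          + 2 powr p * (far z * \<bar>v (fst z)\<bar> powr p + far z * \<bar>v (snd z)\<bar> powr p))"
      proof (cases "norm (fst z - snd z) < 1")
        case True
        then show ?thesis using kern_nonneg[of z] by (simp add: far_def)
      next
        case False
        then have "kern z = far z" by (simp add: kern_def far_def)
        moreover have "\<bar>v (fst z) - v (snd z)\<bar> powr p \<le> 2 powr p * (\<bar>v (fst z)\<bar> powr p + \<bar>v (snd z)\<bar> powr p)"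
          using abs_add_powr_le[of p "v (fst z)" "- v (snd z)"] p by simp
        then have "far z * \<bar>v (fst z) - v (snd z)\<bar> powr p \<le> far z * (2 powr p * (\<bar>v (fst z)\<bar> powr p + \<bar>v (snd z)\<bar> powr p))"
          using far_nonneg by (intro mult_left_mono)
        ultimately show ?thesis using False far_nonneg[of z]
          by (simp add: algebra_simps)
      qed
    qed
  qed measurable
  then have "v \<in> X0_borel" using vi by (simp add: X0_borel_def v_def)
  then show thesis using that uv by blast
qed

lemma X0_borel_imp_X0:
  assumes "u \<in> X0_borel"
  shows "u \<in> X0 p \<Omega>"
proof -
  note [measurable] = X0_borel_measurable[OF assms]
  have "u \<in> borel_measurable lebesgue" by (intro measurable_completion) simp
  moreover have "integrable lebesgue (\<lambda>x. \<bar>u x\<bar> powr p)"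
    using X0_borel_integrable[OF assms] by (simp add: integrable_completion)
  moreover have "(\<integral>\<^sup>+z. ennreal (if norm (fst z - snd z) < 1 then kern z * \<bar>u (fst z) - u (snd z)\<bar> powr p else 0) \<partial>lborel2) < \<infinity>"
  proof -
    have "(\<integral>\<^sup>+z. ennreal (if norm (fst z - snd z) < 1 then kern z * \<bar>u (fst z) - u (snd z)\<bar> powr p else 0) \<partial>lborel2)
      \<le> (\<integral>\<^sup>+z. ennreal (norm (kern z * \<bar>u (fst z) - u (snd z)\<bar> powr p)) \<partial>lborel2)"
      by (intro nn_integral_mono ennreal_leI) auto
    also have "\<dots> < \<infinity>" using X0_borel_energy[OF assms] by (simp add: integrable_iff_bounded)
    finally show ?thesis .
  qed
  ultimately show ?thesis using nn_integral_near[of u u] X0_borel_zero[OF assms] by (simp add: X0_def)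
qed

lemma Lp_norm_eq:
  assumes u: "u \<in> X0_borel" and u': "AE x in lborel. u' x = u x"
  shows "Lp_norm p \<Omega> u' = (LINT x|lborel. \<bar>u x\<bar> powr p) powr (1 / p)"
proof -
  note [measurable] = X0_borel_measurable[OF u]
  have "(LINT x:\<Omega>|lebesgue. \<bar>u' x\<bar> powr p) = (LINT x|lborel. \<bar>u x\<bar> powr p)"
    unfolding set_lebesgue_integral_def
    by (rule integral_lebesgue_AE_borel, measurable, use u' in eventually_elim)
      (use X0_borel_zero[OF u] in \<open>auto simp: indicator_def\<close>)
  then show ?thesis by (simp add: Lp_norm_def)
qed

lemma Lp_norm_eq_1_iff:
  assumes u: "u \<in> X0_borel" and u': "AE x in lborel. u' x = u x"
  shows "Lp_norm p \<Omega> u' = 1 \<longleftrightarrow> (LINT x|lborel. \<bar>u x\<bar> powr p) = 1"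
proof -
  define I where "I = (LINT x|lborel. \<bar>u x\<bar> powr p)"
  have "0 \<le> I" by (simp add: I_def)
  then have "(I powr (1 / p)) powr p = I" using p by (simp add: powr_powr)
  then show ?thesis unfolding Lp_norm_eq[OF assms] I_def[symmetric]
    by (metis powr_one_eq_one)
qed

lemma form_scale:
  assumes u: "u \<in> X0_borel"
  shows "form (\<lambda>x. c * u x) (\<lambda>x. c * u x) = \<bar>c\<bar> powr p * form u u"
proof -
  have 1: "kern z * \<bar>c * u (fst z) - c * u (snd z)\<bar> powr p = \<bar>c\<bar> powr p * (kern z * \<bar>u (fst z) - u (snd z)\<bar> powr p)" for z
    by (simp add: abs_mult powr_mult flip: right_diff_distrib)
  have 2: "pot x * \<bar>c * u x\<bar> powr p = \<bar>c\<bar> powr p * (pot x * \<bar>u x\<bar> powr p)" for x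
    by (simp add: abs_mult powr_mult)
  show ?thesis unfolding form_self 1 2 integral_mult_right_zero by (simp add: algebra_simps)
qed

lemma normalize_X0_borel:
  assumes u: "u \<in> X0_borel" and pos: "0 < (LINT x|lborel. \<bar>u x\<bar> powr p)"
  obtains c where "0 < c" "(LINT x|lborel. \<bar>c * u x\<bar> powr p) = 1"
    "c powr p * (LINT x|lborel. \<bar>u x\<bar> powr p) = 1"
proof
  define I where "I = (LINT x|lborel. \<bar>u x\<bar> powr p)"
  have I: "I > 0" using pos by (simp add: I_def)
  define c where "c = I powr (- (1 / p))"
  show "0 < c" using I by (simp add: c_def)
  have "c powr p = I powr (- 1)" using p by (simp add: c_def powr_powr)
  then show *: "c powr p * (LINT x|lborel. \<bar>u x\<bar> powr p) = 1"
    using I unfolding I_def[symmetric] by (simp add: powr_minus)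
  have "(LINT x|lborel. \<bar>c * u x\<bar> powr p) = (LINT x|lborel. c powr p * \<bar>u x\<bar> powr p)"
    using \<open>0 < c\<close> by (simp add: abs_mult powr_mult)
  then show "(LINT x|lborel. \<bar>c * u x\<bar> powr p) = 1" using * by simp
qed

lemma X0_borel_norm_zero_iff:
  assumes u: "u \<in> X0_borel"
  shows "(LINT x|lborel. \<bar>u x\<bar> powr p) = 0 \<longleftrightarrow> (AE x in lborel. u x = 0)"
  using integral_nonneg_eq_0_iff_AE[OF X0_borel_integrable[OF u]] p by simp

text \<open>The infimum is over the unit sphere of \<open>L\<^sup>p\<close>; homogeneity of degree \<open>p\<close> extends its sign to every
  nonzero function.\<close>

lemma lambda1_pos_imp_form_pos:
  assumes "lambda1 p \<Omega> > 0" and u: "u \<in> X0_borel" and le: "form u u \<le> 0"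
  shows "AE x in lborel. u x = 0"
proof (rule ccontr)
  assume "\<not> (AE x in lborel. u x = 0)"
  then have "(LINT x|lborel. \<bar>u x\<bar> powr p) \<noteq> 0" using X0_borel_norm_zero_iff[OF u] by simp
  moreover have "0 \<le> (LINT x|lborel. \<bar>u x\<bar> powr p)" by simp
  ultimately have "0 < (LINT x|lborel. \<bar>u x\<bar> powr p)" by linarith
  then obtain c where c: "0 < c" "(LINT x|lborel. \<bar>c * u x\<bar> powr p) = 1"
    using normalize_X0_borel[OF u] by metis
  define w where "w x = c * u x" for x
  have w: "w \<in> X0_borel" using X0_borel_scale[OF u] by (simp add: w_def[abs_def])
  have "Lp_norm p \<Omega> w = 1" using Lp_norm_eq_1_iff[OF w] c by (simp add: w_def)
  then have "lambda1 p \<Omega> \<le> ereal (E_form p w w)"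
    unfolding lambda1_def using X0_borel_imp_X0[OF w] by (intro Inf_lower) auto
  then have "0 < form w w" using assms(1) E_form_eq_form[OF w w] by (auto dest: less_le_trans)
  moreover have "form w w = c powr p * form u u"
    using form_scale[OF u, of c] c by (simp add: w_def[abs_def])
  ultimately show False using le c by (simp add: zero_less_mult_iff)
qed

lemma lambda1_nonpos_imp_form_small:
  assumes "\<not> lambda1 p \<Omega> > 0" and "0 < e"
  obtains u where "u \<in> X0_borel" "(LINT x|lborel. \<bar>u x\<bar> powr p) = 1" "form u u < e"
proof -
  have "lambda1 p \<Omega> < ereal e" using assms by (metis ereal_less(2) le_less_trans not_le)
  then obtain u where u: "u \<in> X0 p \<Omega>" "Lp_norm p \<Omega> u = 1" "ereal (E_form p u u) < ereal e"
    unfolding lambda1_def Inf_less_iff by auto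
  obtain v where v: "v \<in> X0_borel" "AE x in lborel. u x = v x" using X0_representative[OF u(1)] .
  show thesis
    using that[OF v(1)] u E_form_eq_form[OF v(1) v(1) v(2) v(2)] Lp_norm_eq_1_iff[OF v] by simp
qed

end

section \<open>Positive lower bounds for nonnegative supersolutions\<close>

lemma dyadic_bracket:
  fixes r :: real
  assumes "0 < r" "r < 1"
  obtains k where "(1/2) ^ Suc k \<le> r" "r < (1/2) ^ k"
proof -
  obtain n where n: "(1/2::real) ^ n \<le> r" using real_arch_pow_inv[OF assms(1), of "1/2"] by (auto intro: less_imp_le)
  define m where "m = (LEAST n. (1/2::real) ^ n \<le> r)"
  have m: "(1/2) ^ m \<le> r" unfolding m_def by (rule LeastI[where P="\<lambda>n. (1/2::real) ^ n \<le> r", OF n])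
  then have "m \<noteq> 0" using assms by (cases m) auto
  then obtain k where k: "m = Suc k" by (cases m) auto
  have "\<not> (1/2) ^ k \<le> r"
  proof
    assume "(1/2) ^ k \<le> r"
    then have "m \<le> k" unfolding m_def by (rule Least_le)
    then show False using k by simp
  qed
  then show thesis using that[of k] m k by simp
qed

text \<open>The singularity \<open>\<bar>z\<bar>\<^sup>-\<^sup>N\<close> only just fails to be integrable, so any positive power of \<open>\<bar>z\<bar>\<close> repairs
  it: on the dyadic shell of radius \<open>2\<^sup>-\<^sup>k\<close> the integral is of order \<open>2\<^sup>-\<^sup>k\<^sup>s\<close>.\<close>

lemma nn_integral_log_kernel_powr_bounded:
  fixes s :: real
  assumes "0 < s"
  obtains J where "0 \<le> J"
    "\<And>x::'a::euclidean_space. (\<integral>\<^sup>+y. ennreal (if norm (x - y) < 1 then norm (x - y) powr s / norm (x - y) ^ DIM('a) else 0) \<partial>lborel) \<le> ennreal J"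
proof -
  define \<omega> where "\<omega> = unit_ball_vol DIM('a)"
  have \<omega>: "\<omega> \<ge> 0" by (simp add: \<omega>_def)
  define c where "c k = ((1/2) powr s) ^ k * 2 ^ (Suc k * DIM('a))" for k
  have c0: "c k \<ge> 0" for k by (simp add: c_def)
  have lt: "(1/2::real) powr s < 1" using powr_less_mono2[of s "1/2" 1] assms by simp
  define d where "d k = (2 ^ DIM('a) * \<omega>) * ((1/2) powr s) ^ k" for k
  have d0: "d k \<ge> 0" for k using \<omega> by (simp add: d_def)
  have d: "summable d" unfolding d_def[abs_def] using lt by (intro summable_mult summable_geometric) auto
  have "(\<integral>\<^sup>+y. ennreal (if norm (x - y) < 1 then norm (x - y) powr s / norm (x - y) ^ DIM('a) else 0) \<partial>lborel) \<le> ennreal (suminf d)" for x :: 'a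
  proof -
    have "ennreal (if norm (x - y) < 1 then norm (x - y) powr s / norm (x - y) ^ DIM('a) else 0)
       \<le> (\<Sum>k. ennreal (c k) * indicator (ball x ((1/2) ^ k)) y)" for y
    proof (cases "norm (x - y) < 1 \<and> x \<noteq> y")
      case True
      define r where "r = norm (x - y)"
      have r: "0 < r" "r < 1" using True by (auto simp: r_def)
      obtain k where k: "(1/2) ^ Suc k \<le> r" "r < (1/2) ^ k" using dyadic_bracket[OF r] .
      have "r powr s \<le> ((1/2) ^ k) powr s" using k r assms by (intro powr_mono2) auto
      also have "\<dots> = ((1/2) powr s) ^ k" by (simp add: powr_power powr_powr powr_realpow[symmetric] mult.commute)
      finally have 1: "r powr s \<le> ((1/2) powr s) ^ k" .
      have "1 / r \<le> 2 ^ Suc k" using k r by (simp add: field_simps power_divide)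
      then have "(1 / r) ^ DIM('a) \<le> (2 ^ Suc k) ^ DIM('a)" using r by (intro power_mono) auto
      then have 2: "1 / r ^ DIM('a) \<le> 2 ^ (Suc k * DIM('a))" unfolding power_mult by (simp add: power_divide)
      have "r powr s / r ^ DIM('a) = r powr s * (1 / r ^ DIM('a))" by simp
      also have "\<dots> \<le> c k" unfolding c_def using r by (intro mult_mono 1 2) auto
      finally have "ennreal (r powr s / r ^ DIM('a)) \<le> ennreal (c k) * indicator (ball x ((1/2) ^ k)) y"
        using k by (auto simp: r_def dist_norm intro: ennreal_leI)
      also have "\<dots> \<le> (\<Sum>k. ennreal (c k) * indicator (ball x ((1/2) ^ k)) y)"
        using sum_le_suminf[OF summableI, of "{k}" "\<lambda>k. ennreal (c k) * indicator (ball x ((1/2) ^ k)) y"]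
        by (simp only: sum.insert_if finite.intros sum.empty empty_iff if_False) simp
      finally show ?thesis using True by (simp add: r_def)
    qed auto
    then have "(\<integral>\<^sup>+y. ennreal (if norm (x - y) < 1 then norm (x - y) powr s / norm (x - y) ^ DIM('a) else 0) \<partial>lborel)
      \<le> (\<integral>\<^sup>+y. (\<Sum>k. ennreal (c k) * indicator (ball x ((1/2) ^ k)) y) \<partial>lborel)"
      by (intro nn_integral_mono)
    also have "\<dots> = (\<Sum>k. \<integral>\<^sup>+y. ennreal (c k) * indicator (ball x ((1/2) ^ k)) y \<partial>lborel)"
      by (intro nn_integral_suminf) (auto intro!: borel_measurable_times_ennreal borel_measurable_indicator)
    also have "\<dots> = (\<Sum>k. ennreal (d k))"
    proof (rule suminf_cong)
      fix k
      have "(\<integral>\<^sup>+y. ennreal (c k) * indicator (ball x ((1/2) ^ k)) y \<partial>lborel) = ennreal (c k) * ennreal (\<omega> * ((1/2) ^ k) ^ DIM('a))"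
        by (simp add: nn_integral_cmult_indicator emeasure_ball \<omega>_def)
      also have "\<dots> = ennreal (c k * (\<omega> * ((1/2) ^ k) ^ DIM('a)))"
        using c0 by (intro ennreal_mult[symmetric]) (auto simp: \<omega>)
      also have "c k * (\<omega> * ((1/2) ^ k) ^ DIM('a)) = d k"
        by (simp add: c_def d_def power_add power_mult[symmetric] power_divide field_simps)
      finally show "(\<integral>\<^sup>+y. ennreal (c k) * indicator (ball x ((1/2) ^ k)) y \<partial>lborel) = ennreal (d k)" .
    qed
    also have "\<dots> = ennreal (suminf d)" using d0 d by (intro suminf_ennreal2) auto
    finally show ?thesis .
  qed
  then show thesis using that[of "suminf d"] d0 d by (simp add: suminf_nonneg)
qed

lemma lipschitz_cutoff:
  fixes K \<Omega> :: "'a::euclidean_space set"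
  assumes "compact K" "K \<subseteq> \<Omega>" "open \<Omega>"
  obtains \<psi> :: "'a \<Rightarrow> real" and L where "0 \<le> L" "\<And>x. 0 \<le> \<psi> x" "\<And>x. \<psi> x \<le> 1"
    "\<And>x. x \<in> K \<Longrightarrow> \<psi> x = 1" "\<And>x. x \<notin> \<Omega> \<Longrightarrow> \<psi> x = 0"
    "\<And>x y. \<bar>\<psi> x - \<psi> y\<bar> \<le> L * norm (x - y)"
proof (cases "K = {}")
  case True
  then show thesis using that[of 0 "\<lambda>_. 0"] by simp
next
  case False
  have "K \<inter> - \<Omega> = {}" "closed (- \<Omega>)" using assms by auto
  then obtain d where d: "0 < d" "\<And>x y. x \<in> K \<Longrightarrow> y \<in> - \<Omega> \<Longrightarrow> d \<le> dist x y"
    using separate_compact_closed[OF assms(1)] by metis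
  define \<psi> where "\<psi> x = max 0 (1 - infdist x K / d)" for x
  show thesis
  proof
    show "0 \<le> 1 / d" using d by simp
    show "0 \<le> \<psi> x" for x by (simp add: \<psi>_def)
    show "\<psi> x \<le> 1" for x using d infdist_nonneg[of x K] by (simp add: \<psi>_def)
    show "\<psi> x = 1" if "x \<in> K" for x using that by (simp add: \<psi>_def)
    show "\<psi> x = 0" if "x \<notin> \<Omega>" for x
    proof -
      have "d \<le> infdist x K" unfolding infdist_def using False that d
        by (auto intro!: cINF_greatest simp: dist_commute)
      then show ?thesis using d by (simp add: \<psi>_def)
    qed
    show "\<bar>\<psi> x - \<psi> y\<bar> \<le> 1 / d * norm (x - y)" for x y
    proof -
      have "\<bar>\<psi> x - \<psi> y\<bar> \<le> \<bar>infdist x K / d - infdist y K / d\<bar>" by (auto simp: \<psi>_def)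
      also have "\<dots> = \<bar>infdist x K - infdist y K\<bar> / d" using d by (simp flip: diff_divide_distrib)
      also have "\<dots> \<le> dist x y / d" using d infdist_triangle_abs by (intro divide_right_mono) auto
      finally show ?thesis by (simp add: dist_norm)
    qed
  qed
qed

context log_laplacian_domain
begin

text \<open>Near the diagonal a Lipschitz increment to the power \<open>s\<close> cancels the singularity of the kernel; away
  from it the increment is at most \<open>1\<close> and the kernel is integrable over \<open>\<Omega>\<close>. It is used with \<open>s = p\<close> for
  the energy of the cutoff and with \<open>s = p - 1\<close> for the equation tested against it.\<close>

lemma kern_lipschitz_section_bound:
  fixes \<psi> :: "'a \<Rightarrow> real"
  assumes "0 < s" "0 \<le> L" "\<And>x. 0 \<le> \<psi> x" "\<And>x. \<psi> x \<le> 1"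
    and lip: "\<And>x y. \<bar>\<psi> x - \<psi> y\<bar> \<le> L * norm (x - y)"
  obtains H where "0 \<le> H" "\<And>x. (\<integral>\<^sup>+y. ennreal (kern (x, y) * \<bar>\<psi> x - \<psi> y\<bar> powr s) \<partial>lborel) \<le> ennreal H"
proof -
  obtain J where J: "0 \<le> J"
    "\<And>x::'a. (\<integral>\<^sup>+y. ennreal (if norm (x - y) < 1 then norm (x - y) powr s / norm (x - y) ^ DIM('a) else 0) \<partial>lborel) \<le> ennreal J"
    using nn_integral_log_kernel_powr_bounded[OF assms(1), where 'a = 'a] by blast
  show thesis
  proof
    show "0 \<le> L powr s * J + measure lborel \<Omega>" using J by simp
    fix x
    have "ennreal (kern (x, y) * \<bar>\<psi> x - \<psi> y\<bar> powr s)
      \<le> ennreal (L powr s) * ennreal (if norm (x - y) < 1 then norm (x - y) powr s / norm (x - y) ^ DIM('a) else 0) + ennreal (far (x, y))" for y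
    proof (cases "norm (x - y) < 1")
      case True
      have "\<bar>\<psi> x - \<psi> y\<bar> powr s \<le> (L * norm (x - y)) powr s"
        using assms by (intro powr_mono2) auto
      also have "\<dots> = L powr s * norm (x - y) powr s" using assms by (simp add: powr_mult)
      finally have "kern (x, y) * \<bar>\<psi> x - \<psi> y\<bar> powr s \<le> kern (x, y) * (L powr s * norm (x - y) powr s)"
        using kern_nonneg by (intro mult_left_mono)
      also have "\<dots> = L powr s * (norm (x - y) powr s / norm (x - y) ^ DIM('a))"
        using True by (simp add: kern_def)
      finally have "kern (x, y) * \<bar>\<psi> x - \<psi> y\<bar> powr s \<le> L powr s * (norm (x - y) powr s / norm (x - y) ^ DIM('a))" .
      then show ?thesis using True by (simp add: far_def ennreal_mult[symmetric] ennreal_leI)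
    next
      case False
      have "\<bar>\<psi> x - \<psi> y\<bar> \<le> 1" using assms(3,4)[of x] assms(3,4)[of y] by linarith
      then have "\<bar>\<psi> x - \<psi> y\<bar> powr s \<le> 1" using assms(1) by (metis abs_ge_zero less_imp_le powr_mono2 powr_one_eq_one)
      then have "kern (x, y) * \<bar>\<psi> x - \<psi> y\<bar> powr s \<le> kern (x, y)"
        using kern_nonneg by (intro mult_left_le) auto
      also have "kern (x, y) = far (x, y)" using False by (simp add: kern_def far_def)
      finally show ?thesis using False by (simp add: ennreal_leI)
    qed
    then have "(\<integral>\<^sup>+y. ennreal (kern (x, y) * \<bar>\<psi> x - \<psi> y\<bar> powr s) \<partial>lborel)
      \<le> (\<integral>\<^sup>+y. ennreal (L powr s) * ennreal (if norm (x - y) < 1 then norm (x - y) powr s / norm (x - y) ^ DIM('a) else 0) + ennreal (far (x, y)) \<partial>lborel)"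
      by (intro nn_integral_mono)
    also have "\<dots> = ennreal (L powr s) * (\<integral>\<^sup>+y. ennreal (if norm (x - y) < 1 then norm (x - y) powr s / norm (x - y) ^ DIM('a) else 0) \<partial>lborel) + (\<integral>\<^sup>+y. ennreal (far (x, y)) \<partial>lborel)"
      by (simp add: nn_integral_add nn_integral_cmult)
    also have "\<dots> \<le> ennreal (L powr s) * ennreal J + ennreal (measure lborel \<Omega>)"
      by (intro add_mono mult_left_mono J(2) nn_integral_far) auto
    also have "\<dots> = ennreal (L powr s * J + measure lborel \<Omega>)"
      using J by (simp add: ennreal_mult)
    finally show "(\<integral>\<^sup>+y. ennreal (kern (x, y) * \<bar>\<psi> x - \<psi> y\<bar> powr s) \<partial>lborel) \<le> ennreal (L powr s * J + measure lborel \<Omega>)" .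
  qed
qed

lemma lipschitz_cutoff_in_X0_borel:
  fixes \<psi> :: "'a \<Rightarrow> real"
  assumes "0 \<le> L" "\<And>x. 0 \<le> \<psi> x" "\<And>x. \<psi> x \<le> 1" and [measurable]: "\<psi> \<in> borel_measurable borel"
    and zero: "\<And>x. x \<notin> \<Omega> \<Longrightarrow> \<psi> x = 0"
    and lip: "\<And>x y. \<bar>\<psi> x - \<psi> y\<bar> \<le> L * norm (x - y)"
  shows "\<psi> \<in> X0_borel"
proof -
  define h where "h z = kern z * \<bar>\<psi> (fst z) - \<psi> (snd z)\<bar> powr p" for z
  have [measurable]: "h \<in> borel_measurable lborel2" unfolding h_def[abs_def] by measurable
  have h0: "0 \<le> h z" for z by (simp add: h_def kern_nonneg)
  obtain H where "0 \<le> H" "\<And>x. (\<integral>\<^sup>+y. ennreal (kern (x, y) * \<bar>\<psi> x - \<psi> y\<bar> powr p) \<partial>lborel) \<le> ennreal H"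
    using kern_lipschitz_section_bound[of p L \<psi>] assms p by auto
  then have i1: "integrable lborel2 (\<lambda>z. h z * indicator \<Omega> (fst z))"
    using integrable_on_\<Omega> h0 by (intro schur_integrable(1)[of _ H]) (auto simp: h_def)
  have "h (snd z, fst z) = h z" for z
    using kern_swap[of "snd z" "fst z"] by (simp add: h_def abs_minus_commute)
  then have i2: "integrable lborel2 (\<lambda>z. h z * indicator \<Omega> (snd z))"
    using integrable_lborel2_swap[OF i1] by simp
  have "integrable lborel2 h"
  proof (rule Bochner_Integration.integrable_bound[OF Bochner_Integration.integrable_add[OF i1 i2]])
    show "AE z in lborel2. norm (h z) \<le> norm (h z * indicator \<Omega> (fst z) + h z * indicator \<Omega> (snd z))"
    proof (rule AE_I2)
      fix z
      show "norm (h z) \<le> norm (h z * indicator \<Omega> (fst z) + h z * indicator \<Omega> (snd z))"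
        using h0[of z] zero[of "fst z"] zero[of "snd z"]
        by (cases "fst z \<in> \<Omega>"; cases "snd z \<in> \<Omega>") (auto simp: h_def)
    qed
  qed measurable
  moreover have "integrable lborel (\<lambda>x. \<bar>\<psi> x\<bar> powr p)"
  proof (rule Bochner_Integration.integrable_bound[OF integrable_on_\<Omega>])
    have "\<bar>\<psi> x\<bar> powr p \<le> indicator \<Omega> x" for x
      using assms(2,3)[of x] zero[of x] p powr_mono2[of p "\<psi> x" 1] by (cases "x \<in> \<Omega>") auto
    then show "AE x in lborel. norm (\<bar>\<psi> x\<bar> powr p) \<le> norm (indicat_real \<Omega> x)" by auto
  qed measurable
  ultimately show ?thesis using zero by (simp add: X0_borel_def h_def[abs_def])
qed

lemma X0_borel_integrable_bounded:
  fixes f :: "'a \<Rightarrow> real"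
  assumes [measurable]: "f \<in> borel_measurable borel" and "\<And>x. x \<notin> \<Omega> \<Longrightarrow> f x = 0" "\<And>x. \<bar>f x\<bar> \<le> B"
  shows "integrable lborel f"
proof (rule Bochner_Integration.integrable_bound)
  show "integrable lborel (\<lambda>x. B * indicator \<Omega> x)" using integrable_on_\<Omega> by auto
  have "\<bar>f x\<bar> \<le> \<bar>B * indicator \<Omega> x\<bar>" for x
    using assms(2)[of x] assms(3)[of x] by (cases "x \<in> \<Omega>") auto
  then show "AE x in lborel. norm (f x) \<le> norm (B * indicat_real \<Omega> x)" by simp
qed measurable

text \<open>The nonlocal substitute for connectedness: any two points of \<open>\<Omega>\<close> interact, with a strength bounded
  below in terms of the size of \<open>\<Omega>\<close>.\<close>

lemma kern_lower_bound:
  obtains q where "0 < q" "\<And>x y. x \<in> \<Omega> \<Longrightarrow> y \<in> \<Omega> \<Longrightarrow> x \<noteq> y \<Longrightarrow> q \<le> kern (x, y)"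
proof -
  obtain D where D: "0 < D" "\<And>x. x \<in> \<Omega> \<Longrightarrow> norm x \<le> D"
    using bounded_\<Omega> by (auto simp: bounded_pos)
  show thesis
  proof
    show "0 < 1 / (2 * D) ^ DIM('a)" using D by simp
    fix x y assume xy: "x \<in> \<Omega>" "y \<in> \<Omega>" "x \<noteq> y"
    have "norm (x - y) \<le> 2 * D" using D(2)[OF xy(1)] D(2)[OF xy(2)] norm_triangle_ineq4[of x y] by linarith
    then have "norm (x - y) ^ DIM('a) \<le> (2 * D) ^ DIM('a)" by (intro power_mono) auto
    then show "1 / (2 * D) ^ DIM('a) \<le> kern (x, y)"
      using xy D by (auto simp: kern_def intro!: divide_left_mono mult_pos_pos)
  qed
qed

lemma positive_superlevel_set:
  fixes u :: "'a \<Rightarrow> real"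
  assumes [measurable]: "u \<in> borel_measurable borel" and "\<And>x. 0 \<le> u x" "\<not> (AE x in lborel. u x = 0)"
  obtains \<delta> where "0 < \<delta>" "emeasure lborel {x. \<delta> \<le> u x} \<noteq> 0"
proof (rule ccontr)
  note wit = that
  assume no: "\<not> thesis"
  have *: "emeasure lborel {x. \<delta> \<le> u x} = 0" if "0 < \<delta>" for \<delta> using that no wit by blast
  have "AE x in lborel. \<not> 1 / real (Suc n) \<le> u x" for n
    by (rule AE_I[OF _ *[of "1 / real (Suc n)"]]) auto
  then have "AE x in lborel. \<forall>n. \<not> 1 / real (Suc n) \<le> u x" by (simp add: AE_all_countable)
  then have "AE x in lborel. u x = 0"
  proof eventually_elim
    case (elim x)
    show ?case
    proof (rule ccontr)
      assume "u x \<noteq> 0"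
      then have "0 < u x" using assms(2)[of x] by simp
      then obtain n where "inverse (real (Suc n)) < u x" using reals_Archimedean by blast
      then show False using spec[OF elim, where x = n] by (simp add: inverse_eq_divide)
    qed
  qed
  then show False using assms by simp
qed

text \<open>With \<open>\<Phi> = \<integral> (\<epsilon> \<psi> - u)\<^sup>+\<close>, the pointwise barrier inequality integrates to
  \<open>0 \<le> (\<epsilon>\<^sup>p\<^sup>-\<^sup>1 T - C b q \<bar>A\<bar>) \<Phi>\<close>, where \<open>b = (\<delta>/2)\<^sup>p\<^sup>-\<^sup>1\<close> and \<open>q\<close> is the lower bound of the kernel on \<open>\<Omega> \<times> \<Omega>\<close>.
  The bracket is negative for small \<open>\<epsilon>\<close>, so \<open>\<Phi> = 0\<close>.\<close>

lemma nonneg_supersolution_locally_bounded_below: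
  assumes u: "u \<in> X0_borel" and u0: "\<And>x. 0 \<le> u x"
    and super: "\<And>\<phi>. \<phi> \<in> X0_borel \<Longrightarrow> (\<And>x. 0 \<le> \<phi> x) \<Longrightarrow> 0 \<le> form u \<phi>"
    and nz: "\<not> (AE x in lborel. u x = 0)"
    and K: "compact K" "K \<subseteq> \<Omega>"
  obtains \<epsilon> where "0 < \<epsilon>" "AE x in lborel. x \<in> K \<longrightarrow> \<epsilon> \<le> u x"
proof -
  note [measurable] = X0_borel_measurable[OF u]
  obtain \<psi> L where \<psi>: "0 \<le> L" "\<And>x. 0 \<le> \<psi> x" "\<And>x. \<psi> x \<le> 1" "\<And>x. x \<in> K \<Longrightarrow> \<psi> x = 1"
    "\<And>x. x \<notin> \<Omega> \<Longrightarrow> \<psi> x = 0" "\<And>x y. \<bar>\<psi> x - \<psi> y\<bar> \<le> L * norm (x - y)"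
    using lipschitz_cutoff[OF K open_\<Omega>] by metis
  have "L-lipschitz_on UNIV \<psi>" using \<psi> by (intro lipschitz_onI) (auto simp: dist_norm)
  then have "continuous_on UNIV \<psi>" by (rule lipschitz_on_continuous_on)
  then have [measurable]: "\<psi> \<in> borel_measurable borel" by (rule borel_measurable_continuous_onI)
  have \<psi>X0_borel: "\<psi> \<in> X0_borel" using \<psi> by (intro lipschitz_cutoff_in_X0_borel[of L]) auto
  obtain \<delta> where \<delta>: "0 < \<delta>" "emeasure lborel {x. \<delta> \<le> u x} \<noteq> 0"
    using positive_superlevel_set[OF _ u0 nz] by auto
  define A where "A = {x. \<delta> \<le> u x}"
  have [measurable]: "A \<in> sets borel" unfolding A_def by measurable
  have A\<Omega>: "A \<subseteq> \<Omega>" using X0_borel_zero[OF u] \<delta> by (force simp: A_def)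
  have "emeasure lborel A \<le> emeasure lborel \<Omega>" using A\<Omega> by (intro emeasure_mono) auto
  then have Afin: "emeasure lborel A < \<infinity>" by (simp add: emeasure_\<Omega> order_le_less_trans)
  define a where "a = measure lborel A"
  have Aa: "emeasure lborel A = ennreal a" using Afin by (simp add: a_def emeasure_eq_ennreal_measure)
  have "a \<noteq> 0" using \<delta>(2) Aa unfolding A_def by auto
  then have a: "0 < a" unfolding a_def using measure_nonneg[of lborel A] by linarith
  obtain q where q: "0 < q" "\<And>x y. x \<in> \<Omega> \<Longrightarrow> y \<in> \<Omega> \<Longrightarrow> x \<noteq> y \<Longrightarrow> q \<le> kern (x, y)"
    using kern_lower_bound by metis
  define h where "h z = kern z * \<bar>\<psi> (fst z) - \<psi> (snd z)\<bar> powr (p - 1)" for z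
  have [measurable]: "h \<in> borel_measurable lborel2" unfolding h_def[abs_def] by measurable
  have h0: "0 \<le> h z" for z by (simp add: h_def kern_nonneg)
  have hswap: "h (snd z, fst z) = h z" for z
    using kern_swap[of "snd z" "fst z"] by (simp add: h_def abs_minus_commute)
  obtain H where H: "0 \<le> H" "\<And>x. (\<integral>\<^sup>+y. ennreal (kern (x, y) * \<bar>\<psi> x - \<psi> y\<bar> powr (p - 1)) \<partial>lborel) \<le> ennreal H"
    using kern_lipschitz_section_bound[of "p - 1" L \<psi>] \<psi> p by auto
  define C where "C = C_const DIM('a) p"
  have C: "0 < C" using C_pos by (simp add: C_def)
  define b where "b = (\<delta> / 2) powr (p - 1)"
  have b: "0 < b" using \<delta> by (simp add: b_def)
  \<comment> \<open>\<open>T\<close> collects the factors of \<open>\<epsilon>\<^sup>p\<^sup>-\<^sup>1\<close>. The choice of \<open>\<tau>\<close> makes \<open>\<tau> T - C b q a = - \<tau>\<close>, and \<open>\<epsilon>\<close> is chosen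
    so that \<open>\<epsilon>\<^sup>p\<^sup>-\<^sup>1 \<le> \<tau>\<close> and \<open>\<delta> - \<epsilon> \<ge> \<delta> / 2\<close>.\<close>
  define T where "T = C * H + C * q * a + pot_bound"
  have T: "0 \<le> T" using C H q a pot_bound_nonneg by (simp add: T_def)
  define \<tau> where "\<tau> = C * b * q * a / (T + 1)"
  have \<tau>: "0 < \<tau>" using C b q a T by (simp add: \<tau>_def)
  define \<epsilon> where "\<epsilon> = min (\<delta> / 2) (\<tau> powr (1 / (p - 1)))"
  have \<epsilon>: "0 < \<epsilon>" "2 * \<epsilon> \<le> \<delta>" using \<delta> \<tau> by (auto simp: \<epsilon>_def)
  have "\<epsilon> powr (p - 1) \<le> (\<tau> powr (1 / (p - 1))) powr (p - 1)"
    using p \<epsilon> by (intro powr_mono2) (auto simp: \<epsilon>_def)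
  also have "\<dots> = \<tau>" using p \<tau> by (simp add: powr_powr)
  finally have \<epsilon>\<tau>: "\<epsilon> powr (p - 1) \<le> \<tau>" .
  define e where "e = \<epsilon> powr (p - 1)"
  define m where "m = (\<delta> - \<epsilon>) powr (p - 1) - e"
  have "b \<le> (\<delta> - \<epsilon>) powr (p - 1)" unfolding b_def using \<epsilon> \<delta> p by (intro powr_mono2) auto
  then have m: "b - e \<le> m" by (simp add: m_def)
  have "e \<le> (\<delta> - \<epsilon>) powr (p - 1)" unfolding e_def using \<epsilon> p by (intro powr_mono2) auto
  then have m0: "0 \<le> m" by (simp add: m_def)
  have "e * T - C * b * q * a \<le> \<tau> * T - C * b * q * a"
    using \<epsilon>\<tau> T by (intro diff_right_mono mult_right_mono) (auto simp: e_def)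
  also have "\<dots> = - \<tau>" using T by (simp add: \<tau>_def field_simps)
  finally have neg: "e * T - C * b * q * a < 0" using \<tau> by linarith
  define w where "w x = \<epsilon> * \<psi> x" for x
  define f where "f x = max 0 (w x - u x)" for x
  have f0: "0 \<le> f x" for x by (simp add: f_def)
  have "(\<lambda>x. \<epsilon> * \<psi> x + (-1) * u x) \<in> X0_borel" by (intro X0_borel_add X0_borel_scale \<psi>X0_borel u)
  then have fX: "f \<in> X0_borel"
    using X0_borel_contraction[of "\<lambda>x. \<epsilon> * \<psi> x + (-1) * u x" "max 0"] by (auto simp: f_def[abs_def] w_def)
  note [measurable] = X0_borel_measurable[OF fX]
  have w: "0 \<le> w x" "w x \<le> \<epsilon>" for x using \<psi>(2,3)[of x] \<epsilon> by (auto simp: w_def mult_left_le)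
  have f_int: "integrable lborel f"
  proof (rule X0_borel_integrable_bounded[of _ \<epsilon>])
    show "\<bar>f x\<bar> \<le> \<epsilon>" for x using w[of x] u0[of x] \<epsilon> by (auto simp: f_def)
    show "f x = 0" if "x \<notin> \<Omega>" for x using X0_borel_zero[OF fX that] .
  qed measurable
  define \<Phi> where "\<Phi> = (LINT x|lborel. f x)"
  have \<Phi>: "0 \<le> \<Phi>" using f0 by (simp add: \<Phi>_def)
  have S1: "integrable lborel2 (\<lambda>z. h z * f (fst z))" "(LINT z|lborel2. h z * f (fst z)) \<le> H * \<Phi>"
    using schur_integrable(1,3)[of h H f] H h0 f_int f0 by (auto simp: h_def \<Phi>_def)
  have S2: "integrable lborel2 (\<lambda>z. h z * f (snd z))" "(LINT z|lborel2. h z * f (snd z)) \<le> H * \<Phi>"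
    using integrable_lborel2_swap[OF S1(1)] integral_lborel2_swap[of "\<lambda>z. h z * f (fst z)"] S1(2) by (auto simp: hswap)
  have S3: "integrable lborel2 (\<lambda>z. indicator A (snd z) * f (fst z))"
    "(LINT z|lborel2. indicator A (snd z) * f (fst z)) = a * \<Phi>"
    using schur_integrable(1,2)[of "\<lambda>z. indicator A (snd z)" a f] f_int a Aa by (auto simp: a_def \<Phi>_def ennreal_indicator)
  have S4: "integrable lborel2 (\<lambda>z. indicator A (fst z) * f (snd z))"
    "(LINT z|lborel2. indicator A (fst z) * f (snd z)) = a * \<Phi>"
    using integrable_lborel2_swap[OF S3(1)] integral_lborel2_swap[of "\<lambda>z. indicator A (snd z) * f (fst z)"] S3(2) by auto
  define B where "B z = e * (h z * f (fst z) + h z * f (snd z))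
      - m * q * (indicator A (snd z) * f (fst z) + indicator A (fst z) * f (snd z))" for z
  have B_int: "integrable lborel2 B" unfolding B_def[abs_def] using S1 S2 S3 S4 by auto
  have "(LINT z|lborel2. B z) = e * ((LINT z|lborel2. h z * f (fst z)) + (LINT z|lborel2. h z * f (snd z))) - m * q * (a * \<Phi> + a * \<Phi>)"
    unfolding B_def using S1(1) S2(1) S3 S4 by simp
  also have "\<dots> \<le> e * (H * \<Phi> + H * \<Phi>) - m * q * (a * \<Phi> + a * \<Phi>)"
    using S1(2) S2(2) by (intro diff_right_mono mult_left_mono add_mono) (auto simp: e_def)
  finally have B_le: "(LINT z|lborel2. B z) \<le> 2 * (e * H - m * q * a) * \<Phi>" by (simp add: algebra_simps)
  have "(LINT z|lborel2. kern z * (g_pow p (u (fst z) - u (snd z)) * (f (fst z) - f (snd z)))) \<le> (LINT z|lborel2. B z)"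
  proof (rule integral_mono[OF X0_borel_integrable_kern_g[OF u fX] B_int])
    fix z :: "'a \<times> 'a"
    define x y where "x = fst z" and "y = snd z"
    define ind where "ind = (if \<delta> \<le> u y then f x else 0) + (if \<delta> \<le> u x then f y else 0)"
    have z: "z = (x, y)" by (simp add: x_def y_def)
    have "g_pow p (u x - u y) * (f x - f y) \<le> \<bar>w x - w y\<bar> powr (p - 1) * (f x + f y) - m * ind"
      unfolding f_def m_def e_def ind_def
      by (rule g_pow_barrier_le) (use p \<epsilon> u0 w in auto)
    also have "\<bar>w x - w y\<bar> powr (p - 1) = e * \<bar>\<psi> x - \<psi> y\<bar> powr (p - 1)"
      using \<epsilon> by (simp add: w_def e_def abs_mult powr_mult flip: right_diff_distrib)
    finally have "kern z * (g_pow p (u x - u y) * (f x - f y))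
        \<le> kern z * (e * \<bar>\<psi> x - \<psi> y\<bar> powr (p - 1) * (f x + f y) - m * ind)"
      using kern_nonneg by (intro mult_left_mono)
    also have "\<dots> = e * (h z * f x + h z * f y) - m * (kern z * ind)"
      by (simp add: h_def z algebra_simps)
    also have "\<dots> \<le> e * (h z * f x + h z * f y) - m * (q * ind)"
    proof -
      \<comment> \<open>The bound \<open>q\<close> fails on the diagonal, where \<open>kern\<close> is \<open>0\<close>; but \<open>u x < \<epsilon> < \<delta> \<le> u y\<close> excludes \<open>x = y\<close>.\<close>
      have dist: "q * f x \<le> kern (x, y) * f x" if "\<delta> \<le> u y" for x y
      proof (cases "f x = 0")
        case False
        then have "u x < w x" using f0[of x] by (auto simp: f_def)
        then have "x \<noteq> y" using w(2)[of x] that \<epsilon> by auto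
        moreover have "x \<in> \<Omega>" using False X0_borel_zero[OF fX] by blast
        moreover have "y \<in> \<Omega>" using A\<Omega> that by (auto simp: A_def)
        ultimately show ?thesis using q f0 by (intro mult_right_mono) auto
      qed simp
      have "q * ind \<le> kern z * ind"
        using dist[of y x] dist[of x y] kern_swap[of x y] by (auto simp: ind_def z distrib_left)
      then show ?thesis using m0 by (intro diff_left_mono mult_left_mono)
    qed
    also have "\<dots> = B z" by (auto simp: B_def ind_def A_def z)
    finally show "kern z * (g_pow p (u (fst z) - u (snd z)) * (f (fst z) - f (snd z))) \<le> B z" by (simp add: z)
  qed
  with B_le have D: "(LINT z|lborel2. kern z * (g_pow p (u (fst z) - u (snd z)) * (f (fst z) - f (snd z)))) \<le> 2 * (e * H - m * q * a) * \<Phi>"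
    by linarith
  have "(LINT x|lborel. pot x * (g_pow p (u x) * f x)) \<le> (LINT x|lborel. pot_bound * e * f x)"
  proof (rule integral_mono)
    show "integrable lborel (\<lambda>x. pot x * (g_pow p (u x) * f x))"
      by (rule integrable_pot[OF X0_borel_integrable_g[OF u fX]])
    show "integrable lborel (\<lambda>x. pot_bound * e * f x)" using f_int by auto
    fix x
    have "g_pow p (u x) * f x \<le> e * f x"
    proof (cases "f x = 0")
      case False
      then have "u x < \<epsilon>" using f0[of x] w(2)[of x] by (auto simp: f_def max_def split: if_splits)
      then have "g_pow p (u x) \<le> e" using u0[of x] p by (simp add: g_pow_nonneg e_def powr_mono2)
      then show ?thesis using f0 by (intro mult_right_mono) auto
    qed simp
    moreover have "0 \<le> g_pow p (u x) * f x" using u0 f0 by (simp add: g_pow_nonneg)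
    ultimately have "\<bar>pot x\<bar> * (g_pow p (u x) * f x) \<le> pot_bound * (e * f x)"
      using abs_pot_le[of x] pot_bound_nonneg f0[of x] by - (rule mult_mono, auto simp: e_def)
    moreover have "pot x * (g_pow p (u x) * f x) \<le> \<bar>pot x\<bar> * (g_pow p (u x) * f x)"
      using \<open>0 \<le> g_pow p (u x) * f x\<close> by (intro mult_right_mono) auto
    ultimately show "pot x * (g_pow p (u x) * f x) \<le> pot_bound * e * f x" by simp
  qed
  then have P: "(LINT x|lborel. pot x * (g_pow p (u x) * f x)) \<le> pot_bound * e * \<Phi>" by (simp add: \<Phi>_def)
  have "0 \<le> form u f" using super fX f0 by simp
  also have "\<dots> \<le> C / 2 * (2 * (e * H - m * q * a) * \<Phi>) + pot_bound * e * \<Phi>"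
    unfolding form_def C_def[symmetric] using C D P by (intro add_mono mult_left_mono) auto
  also have "\<dots> = (C * e * H - C * q * a * m + pot_bound * e) * \<Phi>" by (simp add: algebra_simps)
  also have "\<dots> \<le> (C * e * H - C * q * a * (b - e) + pot_bound * e) * \<Phi>"
    using m C q a \<Phi> by (intro mult_right_mono add_right_mono diff_left_mono mult_left_mono) auto
  also have "\<dots> = (e * T - C * b * q * a) * \<Phi>" by (simp add: T_def algebra_simps)
  finally have "0 \<le> (e * T - C * b * q * a) * \<Phi>" .
  then have "\<Phi> = 0" using neg \<Phi> by (simp add: zero_le_mult_iff)
  then have "AE x in lborel. f x = 0"
    using integral_nonneg_eq_0_iff_AE[OF f_int] f0 by (simp add: \<Phi>_def)
  then have "AE x in lborel. x \<in> K \<longrightarrow> \<epsilon> \<le> u x"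
    by eventually_elim (auto simp: f_def w_def \<psi>(4) max_def split: if_splits)
  then show thesis using that \<epsilon> by blast
qed

end

section \<open>The Euler-Lagrange equation\<close>

lemma powr_difference_quotient:
  fixes a b t p :: real
  assumes "1 < p" "t \<noteq> 0"
  shows "\<bar>(\<bar>a + t * b\<bar> powr p - \<bar>a\<bar> powr p) / t - p * (g_pow p a * b)\<bar>
      \<le> p * (\<bar>g_pow p (a + t * b) - g_pow p a\<bar> * \<bar>b\<bar>)"
    and "\<bar>t\<bar> \<le> 1 \<Longrightarrow> \<bar>(\<bar>a + t * b\<bar> powr p - \<bar>a\<bar> powr p) / t\<bar> \<le> p * (2 + 2 powr p) * (\<bar>a\<bar> powr p + \<bar>b\<bar> powr p)"
proof -
  define D where "D = \<bar>a + t * b\<bar> powr p - \<bar>a\<bar> powr p"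
  have lo: "p * g_pow p a * (t * b) \<le> D"
    using powr_above_tangent[OF assms(1), of a "a + t * b"] by (simp add: D_def)
  have up: "D \<le> p * g_pow p (a + t * b) * (t * b)"
    using powr_above_tangent[OF assms(1), of "a + t * b" a] by (simp add: D_def)
  have "\<bar>D - p * g_pow p a * (t * b)\<bar> \<le> p * g_pow p (a + t * b) * (t * b) - p * g_pow p a * (t * b)"
    using lo up by simp
  also have "\<dots> = p * ((g_pow p (a + t * b) - g_pow p a) * (t * b))" by (simp add: algebra_simps)
  also have "\<dots> \<le> p * \<bar>(g_pow p (a + t * b) - g_pow p a) * (t * b)\<bar>"
    using assms by (intro mult_left_mono) auto
  finally have 1: "\<bar>D - p * g_pow p a * (t * b)\<bar> \<le> \<bar>t\<bar> * (p * (\<bar>g_pow p (a + t * b) - g_pow p a\<bar> * \<bar>b\<bar>))"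
    by (simp add: abs_mult mult_ac)
  have "D / t - p * (g_pow p a * b) = (D - p * g_pow p a * (t * b)) / t"
    using assms by (simp add: field_simps)
  then have "\<bar>D / t - p * (g_pow p a * b)\<bar> = \<bar>D - p * g_pow p a * (t * b)\<bar> / \<bar>t\<bar>" by simp
  then show "\<bar>(\<bar>a + t * b\<bar> powr p - \<bar>a\<bar> powr p) / t - p * (g_pow p a * b)\<bar>
      \<le> p * (\<bar>g_pow p (a + t * b) - g_pow p a\<bar> * \<bar>b\<bar>)"
    unfolding D_def[symmetric] using 1 assms(2) by (metis pos_divide_le_eq zero_less_abs_iff mult.commute)
  show "\<bar>(\<bar>a + t * b\<bar> powr p - \<bar>a\<bar> powr p) / t\<bar> \<le> p * (2 + 2 powr p) * (\<bar>a\<bar> powr p + \<bar>b\<bar> powr p)" if t: "\<bar>t\<bar> \<le> 1"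
  proof -
    define S where "S = \<bar>a\<bar> powr p + \<bar>b\<bar> powr p"
    have "\<bar>t * b\<bar> powr p \<le> \<bar>b\<bar> powr p"
      using t assms by (intro powr_mono2) (auto simp: abs_mult mult_left_le_one_le)
    then have "\<bar>a + t * b\<bar> powr p \<le> 2 powr p * S"
      using abs_add_powr_le[of p a "t * b"] assms unfolding S_def
      by (meson add_left_mono dual_order.trans less_imp_le mult_left_mono powr_ge_zero zero_less_one)
    moreover have "\<bar>b\<bar> powr p \<le> S" by (simp add: S_def)
    ultimately have "\<bar>g_pow p (a + t * b) * b\<bar> \<le> 2 powr p * S + S"
      using abs_g_pow_mult_le[OF assms(1), of "a + t * b" b] by linarith
    then have g1: "\<bar>g_pow p (a + t * b) * b\<bar> \<le> (1 + 2 powr p) * S"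
      by (simp add: distrib_right)
    have g2: "\<bar>g_pow p a * b\<bar> \<le> S" using abs_g_pow_mult_le[OF assms(1), of a b] by (simp add: S_def)
    have "\<bar>D\<bar> \<le> \<bar>p * g_pow p a * (t * b)\<bar> + \<bar>p * g_pow p (a + t * b) * (t * b)\<bar>"
      using lo up by linarith
    also have "\<dots> = \<bar>t\<bar> * (p * (\<bar>g_pow p a * b\<bar> + \<bar>g_pow p (a + t * b) * b\<bar>))"
      using assms by (simp add: abs_mult algebra_simps)
    also have "\<dots> \<le> \<bar>t\<bar> * (p * (S + (1 + 2 powr p) * S))"
      using assms g1 g2 by (intro mult_left_mono add_mono) auto
    also have "\<dots> = \<bar>t\<bar> * (p * (2 + 2 powr p) * S)" by (simp add: algebra_simps)
    finally show ?thesis unfolding D_def[symmetric] S_def[symmetric] abs_divide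
      using assms(2) by (metis pos_divide_le_eq zero_less_abs_iff mult.commute)
  qed
qed

text \<open>Differentiation of a weighted \<open>p\<close>-th power integral along a line. The two tangent inequalities
  at the ends of the increment pin the difference quotient between \<open>p g(f) h\<close> and \<open>p g(f + t h) h\<close>,
  which supplies both the limit and the dominating function.\<close>

lemma weighted_powr_integral_derivative:
  fixes f h W :: "'b \<Rightarrow> real" and t :: "nat \<Rightarrow> real"
  assumes p: "1 < p" and [measurable]: "W \<in> borel_measurable M" "f \<in> borel_measurable M" "h \<in> borel_measurable M"
    and f: "integrable M (\<lambda>x. W x * \<bar>f x\<bar> powr p)" and h: "integrable M (\<lambda>x. W x * \<bar>h x\<bar> powr p)"
    and fh: "\<And>n. integrable M (\<lambda>x. W x * \<bar>f x + t n * h x\<bar> powr p)"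
    and t: "\<And>n. t n \<noteq> 0" "\<And>n. \<bar>t n\<bar> \<le> 1" "t \<longlonglongrightarrow> 0"
  shows "(\<lambda>n. ((LINT x|M. W x * \<bar>f x + t n * h x\<bar> powr p) - (LINT x|M. W x * \<bar>f x\<bar> powr p)) / t n)
    \<longlonglongrightarrow> p * (LINT x|M. W x * (g_pow p (f x) * h x))"
proof -
  define Q where "Q n x = W x * ((\<bar>f x + t n * h x\<bar> powr p - \<bar>f x\<bar> powr p) / t n)" for n x
  define w where "w x = p * (2 + 2 powr p) * (\<bar>W x * \<bar>f x\<bar> powr p\<bar> + \<bar>W x * \<bar>h x\<bar> powr p\<bar>)" for x
  have "(\<lambda>n. LINT x|M. Q n x) \<longlonglongrightarrow> (LINT x|M. W x * (p * (g_pow p (f x) * h x)))"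
  proof (rule integral_dominated_convergence)
    show "integrable M w" unfolding w_def using f h by auto
    show "AE x in M. (\<lambda>n. Q n x) \<longlonglongrightarrow> W x * (p * (g_pow p (f x) * h x))"
    proof (rule AE_I2)
      fix x
      have "(\<lambda>n. f x + t n * h x) \<longlonglongrightarrow> f x + 0 * h x" by (intro tendsto_intros t)
      then have "(\<lambda>n. g_pow p (f x + t n * h x)) \<longlonglongrightarrow> g_pow p (f x)" using p by (intro tendsto_g_pow) auto
      then have "(\<lambda>n. g_pow p (f x + t n * h x) - g_pow p (f x)) \<longlonglongrightarrow> 0" by (simp add: LIM_zero)
      then have "(\<lambda>n. p * (\<bar>g_pow p (f x + t n * h x) - g_pow p (f x)\<bar> * \<bar>h x\<bar>)) \<longlonglongrightarrow> p * (0 * \<bar>h x\<bar>)"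
        by (intro tendsto_intros tendsto_rabs_zero)
      then have "(\<lambda>n. p * (\<bar>g_pow p (f x + t n * h x) - g_pow p (f x)\<bar> * \<bar>h x\<bar>)) \<longlonglongrightarrow> 0"
        by simp
      then have "(\<lambda>n. (\<bar>f x + t n * h x\<bar> powr p - \<bar>f x\<bar> powr p) / t n - p * (g_pow p (f x) * h x)) \<longlonglongrightarrow> 0"
        by (rule Lim_null_comparison[rotated])
          (intro always_eventually allI, unfold real_norm_def, rule powr_difference_quotient(1)[OF p t(1)])
      then have "(\<lambda>n. (\<bar>f x + t n * h x\<bar> powr p - \<bar>f x\<bar> powr p) / t n) \<longlonglongrightarrow> p * (g_pow p (f x) * h x)"
        by (rule LIM_zero_cancel)
      then show "(\<lambda>n. Q n x) \<longlonglongrightarrow> W x * (p * (g_pow p (f x) * h x))" unfolding Q_def by (intro tendsto_intros)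
    qed
    show "AE x in M. norm (Q n x) \<le> w x" for n
    proof (rule AE_I2)
      fix x
      have "norm (Q n x) \<le> \<bar>W x\<bar> * (p * (2 + 2 powr p) * (\<bar>f x\<bar> powr p + \<bar>h x\<bar> powr p))"
        unfolding Q_def real_norm_def abs_mult[of "W x"] using powr_difference_quotient(2)[OF p t(1) t(2)] by (intro mult_left_mono) auto
      also have "\<dots> = w x" by (simp add: w_def abs_mult algebra_simps)
      finally show "norm (Q n x) \<le> w x" .
    qed
  qed (auto simp: Q_def)
  moreover have "(LINT x|M. Q n x) = ((LINT x|M. W x * \<bar>f x + t n * h x\<bar> powr p) - (LINT x|M. W x * \<bar>f x\<bar> powr p)) / t n" for n
  proof -
    have "(LINT x|M. Q n x) = (LINT x|M. (W x * \<bar>f x + t n * h x\<bar> powr p - W x * \<bar>f x\<bar> powr p) / t n)"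
      by (intro Bochner_Integration.integral_cong) (auto simp: Q_def algebra_simps diff_divide_distrib)
    then show ?thesis using f fh[of n] by simp
  qed
  moreover have "(LINT x|M. W x * (p * (g_pow p (f x) * h x))) = p * (LINT x|M. W x * (g_pow p (f x) * h x))"
  proof -
    have "W x * (p * (g_pow p (f x) * h x)) = p * (W x * (g_pow p (f x) * h x))" for x by simp
    then show ?thesis by (simp only: integral_mult_right_zero)
  qed
  ultimately show ?thesis by simp
qed

context log_laplacian_domain
begin

lemma form_uminus_right: "form u (\<lambda>x. - v x) = - form u v"
proof -
  have "kern z * (g_pow p (u (fst z) - u (snd z)) * (- v (fst z) - - v (snd z)))
    = - (kern z * (g_pow p (u (fst z) - u (snd z)) * (v (fst z) - v (snd z))))" for z
    by (simp add: algebra_simps)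
  then show ?thesis by (simp add: form_def)
qed

lemma form_uminus_left: "form (\<lambda>x. - u x) v = - form u v"
proof -
  have "- a - - b = - (a - b)" for a b :: real by simp
  then have "g_pow p (- a - - b) = - g_pow p (a - b)" for a b
    by (simp only: g_pow_minus)
  then show ?thesis
    unfolding form_def by (simp only: g_pow_minus mult_minus_left mult_minus_right Bochner_Integration.integral_minus minus_add_distrib)
qed

text \<open>The functional \<open>v \<mapsto> E(v, v) - \<mu> \<integral> \<bar>v\<bar>\<^sup>p\<close> is nonnegative and vanishes at \<open>u\<close>. Its right derivative at \<open>u\<close>
  in the direction \<open>\<phi>\<close> is \<open>p (E(u, \<phi>) - \<mu> \<integral> g(u) \<phi>)\<close>, hence nonnegative, and the direction \<open>- \<phi>\<close> gives the
  opposite inequality.\<close>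

lemma Euler_Lagrange:
  assumes u: "u \<in> X0_borel" and \<phi>: "\<phi> \<in> X0_borel"
    and ge: "\<And>v. v \<in> X0_borel \<Longrightarrow> \<mu> * (LINT x|lborel. \<bar>v x\<bar> powr p) \<le> form v v"
    and eq: "form u u = \<mu> * (LINT x|lborel. \<bar>u x\<bar> powr p)"
  shows "form u \<phi> = \<mu> * (LINT x|lborel. g_pow p (u x) * \<phi> x)"
proof -
  have *: "\<mu> * (LINT x|lborel. g_pow p (u x) * \<phi> x) \<le> form u \<phi>" if \<phi>: "\<phi> \<in> X0_borel" for \<phi>
  proof -
    note [measurable] = X0_borel_measurable[OF u] X0_borel_measurable[OF \<phi>]
    define t where "t n = 1 / real (Suc n)" for n
    have t: "t n > 0" "t n \<noteq> 0" "\<bar>t n\<bar> \<le> 1" for n by (auto simp: t_def)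
    have tlim: "t \<longlonglongrightarrow> 0" unfolding t_def by (rule LIMSEQ_Suc[OF lim_1_over_n])
    define U where "U n x = u x + t n * \<phi> x" for n x
    have U: "U n \<in> X0_borel" for n using X0_borel_add[OF u \<phi>, of "t n"] by (simp add: U_def[abs_def])
    have Ud: "U n x - U n y = (u x - u y) + t n * (\<phi> x - \<phi> y)" for n x y by (simp add: U_def algebra_simps)
    define A where "A v = (LINT z|lborel2. kern z * \<bar>v (fst z) - v (snd z)\<bar> powr p)" for v :: "'a \<Rightarrow> real"
    define B where "B v = (LINT x|lborel. pot x * \<bar>v x\<bar> powr p)" for v :: "'a \<Rightarrow> real"
    define N where "N v = (LINT x|lborel. 1 * \<bar>v x\<bar> powr p)" for v :: "'a \<Rightarrow> real"
    have 1: "(\<lambda>n. (A (U n) - A u) / t n) \<longlonglongrightarrow> p * (LINT z|lborel2. kern z * (g_pow p (u (fst z) - u (snd z)) * (\<phi> (fst z) - \<phi> (snd z))))"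
      unfolding A_def Ud
      by (rule weighted_powr_integral_derivative[OF p _ _ _ X0_borel_energy[OF u] X0_borel_energy[OF \<phi>] X0_borel_energy[OF U, unfolded Ud] t(2,3) tlim]) measurable
    have 2: "(\<lambda>n. (B (U n) - B u) / t n) \<longlonglongrightarrow> p * (LINT x|lborel. pot x * (g_pow p (u x) * \<phi> x))"
      unfolding B_def U_def
      by (rule weighted_powr_integral_derivative[OF p _ _ _ integrable_pot[OF X0_borel_integrable[OF u]] integrable_pot[OF X0_borel_integrable[OF \<phi>]]
            integrable_pot[OF X0_borel_integrable[OF U], unfolded U_def] t(2,3) tlim]) measurable
    have 3: "(\<lambda>n. (N (U n) - N u) / t n) \<longlonglongrightarrow> p * (LINT x|lborel. 1 * (g_pow p (u x) * \<phi> x))"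
      unfolding N_def U_def
      by (rule weighted_powr_integral_derivative[OF p])
        (use t tlim X0_borel_integrable[OF u] X0_borel_integrable[OF \<phi>] X0_borel_integrable[OF U, unfolded U_def] in auto)
    define C where "C = C_const DIM('a) p"
    have F: "form v v = C / 2 * A v + B v" for v by (simp add: form_self A_def B_def C_def)
    have "(\<lambda>n. C / 2 * ((A (U n) - A u) / t n) + (B (U n) - B u) / t n - \<mu> * ((N (U n) - N u) / t n))
      \<longlonglongrightarrow> C / 2 * (p * (LINT z|lborel2. kern z * (g_pow p (u (fst z) - u (snd z)) * (\<phi> (fst z) - \<phi> (snd z)))))
        + p * (LINT x|lborel. pot x * (g_pow p (u x) * \<phi> x)) - \<mu> * (p * (LINT x|lborel. 1 * (g_pow p (u x) * \<phi> x)))"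
      by (intro tendsto_intros 1 2 3)
    moreover have "C / 2 * ((A (U n) - A u) / t n) + (B (U n) - B u) / t n - \<mu> * ((N (U n) - N u) / t n) \<ge> 0" for n
    proof -
      have "0 \<le> (form (U n) (U n) - \<mu> * N (U n)) - (form u u - \<mu> * N u)"
        using ge[OF U, of n] eq by (simp add: N_def)
      then have "0 \<le> ((form (U n) (U n) - \<mu> * N (U n)) - (form u u - \<mu> * N u)) / t n"
        using t(1)[of n] by simp
      also have "\<dots> = C / 2 * ((A (U n) - A u) / t n) + (B (U n) - B u) / t n - \<mu> * ((N (U n) - N u) / t n)"
        unfolding F by (simp add: diff_divide_distrib add_divide_distrib algebra_simps)
      finally show ?thesis .
    qed
    ultimately have "0 \<le> C / 2 * (p * (LINT z|lborel2. kern z * (g_pow p (u (fst z) - u (snd z)) * (\<phi> (fst z) - \<phi> (snd z)))))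
        + p * (LINT x|lborel. pot x * (g_pow p (u x) * \<phi> x)) - \<mu> * (p * (LINT x|lborel. 1 * (g_pow p (u x) * \<phi> x)))"
      by (intro LIMSEQ_le_const) auto
    also have "\<dots> = p * (form u \<phi> - \<mu> * (LINT x|lborel. g_pow p (u x) * \<phi> x))"
      by (simp add: form_def C_def algebra_simps)
    finally show ?thesis using p by (simp add: zero_le_mult_iff)
  qed
  have "(\<lambda>x. - \<phi> x) \<in> X0_borel" using X0_borel_scale[OF \<phi>, of "-1"] by simp
  from *[OF this] *[OF \<phi>] show ?thesis
    by (simp add: form_uminus_right)
qed

end

section \<open>Averages over dyadic cubes\<close>

text \<open>Membership in a common half-open dyadic cube of side \<open>2\<^sup>-\<^sup>j\<close>, an equivalence relation for each \<open>j\<close>.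
  Stating it through floors avoids an explicit family of cubes.\<close>

definition same_cube :: "nat \<Rightarrow> 'a::euclidean_space \<Rightarrow> 'a \<Rightarrow> bool" where
  "same_cube j x y \<longleftrightarrow> (\<forall>b\<in>Basis. \<lfloor>2 ^ j * (x \<bullet> b)\<rfloor> = \<lfloor>2 ^ j * (y \<bullet> b)\<rfloor>)"

lemma measurable_same_cube [measurable]:
  "Measurable.pred lborel2 (\<lambda>z :: 'a::euclidean_space \<times> 'a. same_cube j (fst z) (snd z))"
  unfolding same_cube_def by measurable

lemma measurable_same_cube_snd [measurable]:
  "Measurable.pred lborel (\<lambda>y :: 'a::euclidean_space. same_cube j x y)"
  unfolding same_cube_def by measurable

lemma same_cube_dist:
  fixes x y :: "'a::euclidean_space"
  assumes "same_cube j x y"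
  shows "norm (x - y) \<le> DIM('a) / 2 ^ j"
proof -
  have "\<bar>(x - y) \<bullet> b\<bar> \<le> 1 / 2 ^ j" if "b \<in> Basis" for b
  proof -
    have "\<lfloor>2 ^ j * (x \<bullet> b)\<rfloor> = \<lfloor>2 ^ j * (y \<bullet> b)\<rfloor>" using assms that by (simp add: same_cube_def)
    then have "\<bar>2 ^ j * (x \<bullet> b) - 2 ^ j * (y \<bullet> b)\<bar> \<le> 1" by linarith
    then have "2 ^ j * \<bar>(x - y) \<bullet> b\<bar> \<le> 1" by (simp add: inner_diff_left abs_mult flip: right_diff_distrib)
    then show ?thesis by (simp add: field_simps)
  qed
  then have "(\<Sum>b\<in>Basis. \<bar>(x - y) \<bullet> b\<bar>) \<le> (\<Sum>b\<in>(Basis::'a set). 1 / 2 ^ j)" by (intro sum_mono)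
  then show ?thesis using norm_le_l1[of "x - y"] by simp
qed

lemma same_cube_box:
  fixes j :: nat and x :: "'a::euclidean_space"
  defines "l \<equiv> (\<Sum>b\<in>Basis. (of_int \<lfloor>2 ^ j * (x \<bullet> b)\<rfloor> / 2 ^ j) *\<^sub>R b)"
  defines "u \<equiv> l + (\<Sum>b\<in>Basis. (1 / 2 ^ j) *\<^sub>R b)"
  shows "box l u \<subseteq> {y. same_cube j x y}" "{y. same_cube j x y} \<subseteq> cbox l u"
    "\<And>b. b \<in> Basis \<Longrightarrow> u \<bullet> b = l \<bullet> b + 1 / 2 ^ j"
proof -
  have l: "l \<bullet> b = of_int \<lfloor>2 ^ j * (x \<bullet> b)\<rfloor> / 2 ^ j" if "b \<in> Basis" for b
    using that by (simp add: l_def)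
  show u: "u \<bullet> b = l \<bullet> b + 1 / 2 ^ j" if "b \<in> Basis" for b
    using that by (simp add: u_def inner_add_left)
  show "box l u \<subseteq> {y. same_cube j x y}"
  proof
    fix y assume y: "y \<in> box l u"
    have "\<lfloor>2 ^ j * (x \<bullet> b)\<rfloor> = \<lfloor>2 ^ j * (y \<bullet> b)\<rfloor>" if b: "b \<in> Basis" for b
    proof -
      have "of_int \<lfloor>2 ^ j * (x \<bullet> b)\<rfloor> / 2 ^ j < y \<bullet> b" "y \<bullet> b < of_int \<lfloor>2 ^ j * (x \<bullet> b)\<rfloor> / 2 ^ j + 1 / 2 ^ j"
        using y b l[OF b] u[OF b] by (auto simp: mem_box)
      then have "of_int \<lfloor>2 ^ j * (x \<bullet> b)\<rfloor> < 2 ^ j * (y \<bullet> b)" "2 ^ j * (y \<bullet> b) < of_int \<lfloor>2 ^ j * (x \<bullet> b)\<rfloor> + 1"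
        by (simp_all add: field_simps)
      then show ?thesis by linarith
    qed
    then show "y \<in> {y. same_cube j x y}" by (simp add: same_cube_def)
  qed
  show "{y. same_cube j x y} \<subseteq> cbox l u"
  proof
    fix y assume "y \<in> {y. same_cube j x y}"
    then have y: "\<lfloor>2 ^ j * (x \<bullet> b)\<rfloor> = \<lfloor>2 ^ j * (y \<bullet> b)\<rfloor>" if "b \<in> Basis" for b
      using that by (simp add: same_cube_def)
    have "l \<bullet> b \<le> y \<bullet> b \<and> y \<bullet> b \<le> u \<bullet> b" if b: "b \<in> Basis" for b
    proof -
      have "of_int \<lfloor>2 ^ j * (x \<bullet> b)\<rfloor> \<le> 2 ^ j * (y \<bullet> b)" "2 ^ j * (y \<bullet> b) \<le> of_int \<lfloor>2 ^ j * (x \<bullet> b)\<rfloor> + 1"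
        unfolding y[OF b] by linarith+
      then have "of_int \<lfloor>2 ^ j * (x \<bullet> b)\<rfloor> / 2 ^ j \<le> y \<bullet> b" "y \<bullet> b \<le> (of_int \<lfloor>2 ^ j * (x \<bullet> b)\<rfloor> + 1) / 2 ^ j"
        by (simp_all add: divide_le_eq le_divide_eq mult.commute)
      then show ?thesis using l[OF b] u[OF b] by (simp add: add_divide_distrib)
    qed
    then show "y \<in> cbox l u" by (simp add: mem_box)
  qed
qed

lemma emeasure_same_cube:
  fixes x :: "'a::euclidean_space"
  shows "emeasure lborel {y. same_cube j x y} = ennreal (1 / 2 ^ (j * DIM('a)))"
proof -
  obtain l u where b: "box l u \<subseteq> {y. same_cube j x y}" "{y. same_cube j x y} \<subseteq> cbox l u"
    "\<And>b. b \<in> Basis \<Longrightarrow> u \<bullet> b = l \<bullet> b + 1 / 2 ^ j"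
    using same_cube_box[where j = j and x = x] by blast
  have "(\<Prod>b\<in>Basis. (u - l) \<bullet> b) = (\<Prod>b\<in>(Basis::'a set). 1 / 2 ^ j)"
    using b(3) by (intro prod.cong) (auto simp: inner_diff_left)
  also have "\<dots> = 1 / 2 ^ (j * DIM('a))" by (simp add: power_mult power_divide)
  finally have v: "(\<Prod>b\<in>Basis. (u - l) \<bullet> b) = 1 / 2 ^ (j * DIM('a))" .
  have [measurable]: "{y. same_cube j x y} \<in> sets borel"
    using measurable_same_cube_snd[of j x] by (simp add: pred_def)
  have "emeasure lborel (box l u) = ennreal (1 / 2 ^ (j * DIM('a)))"
    unfolding v[symmetric] using b(3) by (intro emeasure_lborel_box) auto
  moreover have "emeasure lborel (cbox l u) = ennreal (1 / 2 ^ (j * DIM('a)))"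
    unfolding v[symmetric] using b(3) by (intro emeasure_lborel_cbox) auto
  moreover have "emeasure lborel (box l u) \<le> emeasure lborel {y. same_cube j x y}"
    "emeasure lborel {y. same_cube j x y} \<le> emeasure lborel (cbox l u)"
    by (rule emeasure_mono[OF b(1)], simp) (rule emeasure_mono[OF b(2)], simp)
  ultimately show ?thesis by simp
qed

text \<open>Cubes have interior, so countably many base points reach every cube of every scale. This makes the
  diagonal argument applicable to all averages at once.\<close>

lemma same_cube_meets_dense:
  fixes x :: "'a::euclidean_space"
  assumes "\<And>S::'a set. open S \<Longrightarrow> S \<noteq> {} \<Longrightarrow> \<exists>d\<in>D. d \<in> S"
  obtains d where "d \<in> D" "same_cube j x d"
proof -
  obtain l u where b: "box l u \<subseteq> {y. same_cube j x y}" "\<And>b. b \<in> Basis \<Longrightarrow> u \<bullet> b = l \<bullet> b + 1 / 2 ^ j"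
    using same_cube_box[where j = j and x = x] by blast
  have "box l u \<noteq> {}" using b(2) by (simp add: box_ne_empty)
  then show thesis using assms[OF open_box] b(1) that by blast
qed

definition cube_avg :: "nat \<Rightarrow> ('a::euclidean_space \<Rightarrow> real) \<Rightarrow> 'a \<Rightarrow> real" where
  "cube_avg j f x = 2 ^ (j * DIM('a)) * (LINT y|lborel. (if same_cube j x y then f y else 0))"

lemma measurable_cube_avg [measurable]:
  fixes f :: "'a::euclidean_space \<Rightarrow> real"
  assumes [measurable]: "f \<in> borel_measurable borel"
  shows "cube_avg j f \<in> borel_measurable borel"
proof -
  have [measurable]: "Measurable.pred (lborel \<Otimes>\<^sub>M lborel) (\<lambda>(x :: 'a, y). same_cube j x y)"
    using measurable_same_cube[of j] by (simp add: case_prod_unfold)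
  have "(\<lambda>x. LINT y|lborel. (if same_cube j x y then f y else 0)) \<in> borel_measurable lborel"
    by measurable
  then show ?thesis unfolding cube_avg_def[abs_def] by measurable
qed

lemma cube_avg_cong: "same_cube j x y \<Longrightarrow> cube_avg j f x = cube_avg j f y"
  by (simp add: cube_avg_def same_cube_def)

lemma integrable_restrict:
  fixes f :: "'b \<Rightarrow> real"
  assumes "integrable M f" and [measurable]: "Measurable.pred M P"
  shows "integrable M (\<lambda>y. if P y then f y else 0)"
proof -
  have [measurable]: "f \<in> borel_measurable M" using assms by auto
  show ?thesis by (rule Bochner_Integration.integrable_bound[OF assms(1)]) auto
qed

lemma cube_avg_diff:
  assumes "integrable lborel f" "integrable lborel g"
  shows "cube_avg j (\<lambda>x. f x - g x) x = cube_avg j f x - cube_avg j g x"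
proof -
  have "(LINT y|lborel. (if same_cube j x y then f y - g y else 0))
    = (LINT y|lborel. (if same_cube j x y then f y else 0) - (if same_cube j x y then g y else 0))"
    by (intro Bochner_Integration.integral_cong) auto
  then show ?thesis using assms by (simp add: cube_avg_def integrable_restrict right_diff_distrib)
qed

lemma abs_cube_avg_le:
  fixes f :: "'a::euclidean_space \<Rightarrow> real"
  assumes "integrable lborel f"
  shows "\<bar>cube_avg j f x\<bar> \<le> 2 ^ (j * DIM('a)) * (LINT y|lborel. \<bar>f y\<bar>)"
proof -
  have "\<bar>LINT y|lborel. (if same_cube j x y then f y else 0)\<bar> \<le> (LINT y|lborel. \<bar>if same_cube j x y then f y else 0\<bar>)"
    by (rule integral_abs_bound)
  also have "\<dots> \<le> (LINT y|lborel. \<bar>f y\<bar>)"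
    using assms integrable_restrict[OF assms measurable_same_cube_snd] by (intro integral_mono integrable_abs) auto
  finally show ?thesis by (simp add: cube_avg_def abs_mult)
qed

text \<open>Jensen's inequality for the normalized measure on one cube, obtained by integrating the
  tangent inequality at the mean value.\<close>

lemma cube_avg_powr_le:
  fixes f :: "'a::euclidean_space \<Rightarrow> real"
  assumes p: "1 < p" and f: "integrable lborel f" and fp: "integrable lborel (\<lambda>x. \<bar>f x\<bar> powr p)"
  shows "\<bar>c - cube_avg j f x\<bar> powr p
    \<le> 2 ^ (j * DIM('a)) * (LINT y|lborel. (if same_cube j x y then \<bar>c - f y\<bar> powr p else 0))"
proof -
  define I where "I y = (if same_cube j x y then 1 else 0 :: real)" for y
  define k where "k = (2::real) ^ (j * DIM('a))"
  have k: "k > 0" by (simp add: k_def)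
  have [measurable]: "f \<in> borel_measurable borel" using f by auto
  have Im [measurable]: "I \<in> borel_measurable borel" unfolding I_def[abs_def] by measurable
  have Ii: "I = indicator {y. same_cube j x y}" by (auto simp: I_def fun_eq_iff)
  have S [measurable]: "{y. same_cube j x y} \<in> sets borel"
    using measurable_same_cube_snd[of j x] by (simp add: pred_def)
  have I: "integrable lborel I" "(LINT y|lborel. I y) = 1 / k"
    unfolding Ii using emeasure_same_cube[of j x] by (auto simp: integrable_indicator_iff measure_def k_def)
  have If: "integrable lborel (\<lambda>y. I y * f y)"
    by (rule Bochner_Integration.integrable_bound[OF f]) (auto simp: I_def)
  have Ifp: "integrable lborel (\<lambda>y. I y * \<bar>c - f y\<bar> powr p)"
  proof (rule Bochner_Integration.integrable_bound)
    show "integrable lborel (\<lambda>y. 2 powr p * (\<bar>c\<bar> powr p * I y + \<bar>f y\<bar> powr p))" using I fp by auto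
    show "AE y in lborel. norm (I y * \<bar>c - f y\<bar> powr p) \<le> norm (2 powr p * (\<bar>c\<bar> powr p * I y + \<bar>f y\<bar> powr p))"
      using abs_add_powr_le[of p c "- f _"] p by (auto simp: I_def)
  qed measurable
  have avg: "cube_avg j f x = k * (LINT y|lborel. I y * f y)"
    unfolding cube_avg_def k_def by (rule arg_cong[where f = "\<lambda>t. _ * t"], rule Bochner_Integration.integral_cong) (auto simp: I_def)
  define m where "m = c - cube_avg j f x"
  have "(LINT y|lborel. I y * (\<bar>m\<bar> powr p + p * g_pow p m * ((c - f y) - m))) \<le> (LINT y|lborel. I y * \<bar>c - f y\<bar> powr p)"
  proof (rule integral_mono[OF _ Ifp])
    have "integrable lborel (\<lambda>y. (\<bar>m\<bar> powr p + p * g_pow p m * (c - m)) * I y - p * g_pow p m * (I y * f y))" using I If by auto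
    then show "integrable lborel (\<lambda>y. I y * (\<bar>m\<bar> powr p + p * g_pow p m * ((c - f y) - m)))"
      by (simp add: algebra_simps)
    show "I y * (\<bar>m\<bar> powr p + p * g_pow p m * ((c - f y) - m)) \<le> I y * \<bar>c - f y\<bar> powr p" for y
      by (intro mult_left_mono powr_above_tangent p) (auto simp: I_def)
  qed
  also have "(LINT y|lborel. I y * (\<bar>m\<bar> powr p + p * g_pow p m * ((c - f y) - m)))
    = (LINT y|lborel. (\<bar>m\<bar> powr p + p * g_pow p m * (c - m)) * I y - p * g_pow p m * (I y * f y))"
    by (intro Bochner_Integration.integral_cong) (auto simp: algebra_simps)
  also have "\<dots> = (\<bar>m\<bar> powr p + p * g_pow p m * (c - m)) * (1 / k) - p * g_pow p m * (cube_avg j f x / k)"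
    using I If k by (simp add: avg)
  also have "\<dots> = \<bar>m\<bar> powr p / k" using k by (simp add: m_def field_simps)
  finally have "\<bar>m\<bar> powr p \<le> k * (LINT y|lborel. I y * \<bar>c - f y\<bar> powr p)"
    using k by (simp add: field_simps)
  also have "(LINT y|lborel. I y * \<bar>c - f y\<bar> powr p) = (LINT y|lborel. (if same_cube j x y then \<bar>c - f y\<bar> powr p else 0))"
    by (intro Bochner_Integration.integral_cong) (auto simp: I_def)
  finally show ?thesis by (simp add: m_def k_def)
qed

lemma geometric_sum_le_last:
  fixes Q :: real
  assumes "2 \<le> Q"
  shows "(\<Sum>j\<le>m. Q ^ j) \<le> 2 * Q ^ m"
proof (induction m)
  case (Suc m)
  have "2 * Q ^ m \<le> Q * Q ^ m" using assms by (intro mult_right_mono) auto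
  then show ?case using Suc by simp
qed simp

text \<open>A pair at distance \<open>d\<close> shares a cube only at scales \<open>2\<^sup>-\<^sup>j\<close> above \<open>d\<close>, up to a dimensional factor.
  The inverse cube volumes grow geometrically in \<open>j\<close>, so their sum over those scales is at most
  twice its last term, which is of order \<open>d\<^sup>-\<^sup>N\<close>: up to a constant, the logarithmic kernel dominates the
  superposition of all cube kernels.\<close>

lemma sum_cube_kernels_le:
  fixes x y :: "'a::euclidean_space"
  assumes "finite J" "x \<noteq> y"
  shows "(\<Sum>j\<in>J. if same_cube j x y then 2 ^ (j * DIM('a)) else 0)
    \<le> 2 * real DIM('a) ^ DIM('a) * (1 / norm (x - y) ^ DIM('a))"
proof -
  define J' where "J' = {j \<in> J. same_cube j x y}"
  define Q where "Q = (2::real) ^ DIM('a)"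
  have d: "norm (x - y) > 0" using assms by simp
  have Q: "2 \<le> Q" unfolding Q_def using power_increasing[of 1 "DIM('a)" "2::real"] DIM_positive[where 'a = 'a] by simp
  have fin: "finite J'" using assms by (simp add: J'_def)
  have "(\<Sum>j\<in>J. if same_cube j x y then 2 ^ (j * DIM('a)) else 0) = (\<Sum>j\<in>J'. Q ^ j)"
    using assms(1) unfolding J'_def Q_def by (simp add: sum.inter_filter power_mult[symmetric] mult.commute)
  also have "\<dots> \<le> 2 * real DIM('a) ^ DIM('a) * (1 / norm (x - y) ^ DIM('a))"
  proof (cases "J' = {}")
    case False
    define m where "m = Max J'"
    have "m \<in> J'" using fin False by (simp add: m_def)
    then have "norm (x - y) \<le> DIM('a) / 2 ^ m" using same_cube_dist by (auto simp: J'_def)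
    then have "2 ^ m \<le> DIM('a) / norm (x - y)" using d by (simp add: field_simps)
    then have "(2 ^ m) ^ DIM('a) \<le> (DIM('a) / norm (x - y)) ^ DIM('a)" by (intro power_mono) auto
    then have Qm: "Q ^ m \<le> real DIM('a) ^ DIM('a) * (1 / norm (x - y) ^ DIM('a))"
      by (simp add: Q_def power_divide power_mult[symmetric] mult.commute)
    have "(\<Sum>j\<in>J'. Q ^ j) \<le> (\<Sum>j\<le>m. Q ^ j)"
      using fin Q by (intro sum_mono2) (auto simp: m_def)
    also have "\<dots> \<le> 2 * Q ^ m" by (rule geometric_sum_le_last[OF Q])
    finally show ?thesis using Qm by simp
  qed simp
  finally show ?thesis .
qed

context log_laplacian_domain
begin

lemma X0_borel_L1:
  assumes u: "u \<in> X0_borel"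
  shows "integrable lborel u" "(LINT x|lborel. \<bar>u x\<bar>) \<le> measure lborel \<Omega> + (LINT x|lborel. \<bar>u x\<bar> powr p)"
proof -
  note [measurable] = X0_borel_measurable[OF u]
  have le: "\<bar>u x\<bar> \<le> indicator \<Omega> x + \<bar>u x\<bar> powr p" for x
  proof (cases "\<bar>u x\<bar> \<le> 1")
    case True
    then show ?thesis using X0_borel_zero[OF u, of x] by (cases "x \<in> \<Omega>") (auto simp: add_increasing2)
  next
    case False
    then have "\<bar>u x\<bar> powr 1 \<le> \<bar>u x\<bar> powr p" using p by (intro powr_mono) auto
    then show ?thesis by (simp add: add_increasing)
  qed
  have i: "integrable lborel (\<lambda>x. indicator \<Omega> x + \<bar>u x\<bar> powr p)"
    using integrable_on_\<Omega> X0_borel_integrable[OF u] by auto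
  show 1: "integrable lborel u"
  proof (rule Bochner_Integration.integrable_bound[OF i])
    show "AE x in lborel. norm (u x) \<le> norm (indicat_real \<Omega> x + \<bar>u x\<bar> powr p)"
      using le by (auto intro: order_trans[OF le abs_ge_self])
  qed measurable
  have "(LINT x|lborel. \<bar>u x\<bar>) \<le> (LINT x|lborel. indicator \<Omega> x + \<bar>u x\<bar> powr p)"
    using 1 i le by (intro integral_mono) auto
  also have "\<dots> = measure lborel \<Omega> + (LINT x|lborel. \<bar>u x\<bar> powr p)"
    using integrable_on_\<Omega> X0_borel_integrable[OF u] by simp
  finally show "(LINT x|lborel. \<bar>u x\<bar>) \<le> measure lborel \<Omega> + (LINT x|lborel. \<bar>u x\<bar> powr p)" .
qed

lemma cube_avg_bounded_support:
  obtains R where "\<And>j u x. u \<in> X0_borel \<Longrightarrow> cube_avg j u x \<noteq> 0 \<Longrightarrow> x \<in> cball 0 R"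
proof -
  obtain R where R: "0 < R" "\<And>x. x \<in> \<Omega> \<Longrightarrow> norm x \<le> R"
    using bounded_\<Omega> by (auto simp: bounded_pos)
  have "x \<in> cball 0 (R + DIM('a))" if u: "u \<in> X0_borel" and x: "cube_avg j u x \<noteq> 0" for j u x
  proof (rule ccontr)
    assume "x \<notin> cball 0 (R + DIM('a))"
    then have far: "R + DIM('a) < norm x" by simp
    have "(if same_cube j x y then u y else 0) = 0" for y
    proof (cases "same_cube j x y \<and> y \<in> \<Omega>")
      case True
      have "real DIM('a) / 2 ^ j \<le> real DIM('a)" by (simp add: divide_le_eq mult_le_cancel_left1)
      then have "norm (x - y) \<le> DIM('a)" using same_cube_dist[of j x y] True by linarith
      moreover have "norm x \<le> norm (x - y) + norm y" by (metis norm_triangle_sub add.commute)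
      ultimately show ?thesis using R(2)[of y] True far by linarith
    qed (use X0_borel_zero[OF u] in auto)
    then show False using x by (simp add: cube_avg_def)
  qed
  then show thesis using that by blast
qed

lemma cube_avg_powr_integrable:
  assumes u: "u \<in> X0_borel"
  shows "integrable lborel (\<lambda>x. \<bar>cube_avg j u x\<bar> powr p)"
proof -
  note [measurable] = X0_borel_measurable[OF u]
  obtain R where R: "\<And>j u x. u \<in> X0_borel \<Longrightarrow> cube_avg j u x \<noteq> 0 \<Longrightarrow> x \<in> cball 0 R"
    using cube_avg_bounded_support by blast
  define B where "B = (2 ^ (j * DIM('a)) * (LINT y|lborel. \<bar>u y\<bar>)) powr p"
  have B: "B \<ge> 0" by (simp add: B_def)
  show ?thesis
  proof (rule Bochner_Integration.integrable_bound)
    show "integrable lborel (\<lambda>x :: 'a. B * indicator (cball 0 R) x :: real)"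
      using emeasure_lborel_cball_finite[of "0::'a" R]
      by (intro integrable_mult_right) (simp add: integrable_indicator_iff)
    have "\<bar>cube_avg j u x\<bar> powr p \<le> B" for x
      unfolding B_def using abs_cube_avg_le[OF X0_borel_L1(1)[OF u]] p by (intro powr_mono2) auto
    then have "\<bar>cube_avg j u x\<bar> powr p \<le> B * indicator (cball 0 R) x" for x
      using R[OF u, of j x] B by (cases "cube_avg j u x = 0") auto
    then show "AE x in lborel. norm (\<bar>cube_avg j u x\<bar> powr p) \<le> norm (B * indicat_real (cball 0 R) x)"
      using B by auto
  qed measurable
qed

definition energy :: "('a \<Rightarrow> real) \<Rightarrow> real" where
  "energy u = (LINT z|lborel2. kern z * \<bar>u (fst z) - u (snd z)\<bar> powr p)"

lemma energy_nonneg: "0 \<le> energy u"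
  using kern_nonneg by (simp add: energy_def)

text \<open>Summing over scales beats the lack of smoothing of a logarithmic energy: no single scale need
  give a small error, but \<open>m\<close> scales share one energy, so the average error is of order \<open>1 / m\<close>.
  Only scales \<open>j \<ge> N\<close> are used, for which two points of one cube are at distance less than \<open>1\<close>.\<close>

lemma sum_cube_avg_error_le:
  assumes w: "w \<in> X0_borel" and J: "finite J" "\<And>j. j \<in> J \<Longrightarrow> DIM('a) \<le> j"
  shows "(\<Sum>j\<in>J. LINT x|lborel. \<bar>w x - cube_avg j w x\<bar> powr p) \<le> 2 * real DIM('a) ^ DIM('a) * energy w"
    and "j \<in> J \<Longrightarrow> integrable lborel (\<lambda>x. \<bar>w x - cube_avg j w x\<bar> powr p)"
proof -
  note [measurable] = X0_borel_measurable[OF w]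
  define c where "c = 2 * real DIM('a) ^ DIM('a)"
  have c: "0 \<le> c" by (simp add: c_def)
  define S where "S j z = (if same_cube j (fst z) (snd z) then 2 ^ (j * DIM('a)) else 0) * \<bar>w (fst z) - w (snd z)\<bar> powr p" for j and z :: "'a \<times> 'a"
  have [measurable]: "S j \<in> borel_measurable lborel2" for j unfolding S_def[abs_def] by measurable
  have S0: "0 \<le> S j z" for j z by (simp add: S_def)
  have sum_le: "(\<Sum>j\<in>I. S j z) \<le> c * (kern z * \<bar>w (fst z) - w (snd z)\<bar> powr p)" if I: "I \<subseteq> J" for z I
  proof (cases "fst z = snd z \<or> (\<forall>j\<in>I. \<not> same_cube j (fst z) (snd z))")
    case True
    then have "(\<Sum>j\<in>I. S j z) = 0" by (intro sum.neutral) (auto simp: S_def)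
    then show ?thesis using c kern_nonneg by simp
  next
    case False
    then obtain j where j: "j \<in> I" "same_cube j (fst z) (snd z)" by blast
    have "DIM('a) < 2 ^ j" using J(2)[of j] j I
      by (meson less_exp le_less_trans subset_iff)
    then have "real DIM('a) < 2 ^ j" by (metis of_nat_less_iff of_nat_numeral of_nat_power)
    then have "norm (fst z - snd z) < 1" using same_cube_dist[OF j(2)]
      by (meson divide_less_eq_1_pos le_less_trans zero_less_numeral zero_less_power)
    then have k: "kern z = 1 / norm (fst z - snd z) ^ DIM('a)" by (simp add: kern_def)
    have "(\<Sum>j\<in>I. S j z) = (\<Sum>j\<in>I. if same_cube j (fst z) (snd z) then 2 ^ (j * DIM('a)) else 0) * \<bar>w (fst z) - w (snd z)\<bar> powr p"
      by (simp add: S_def sum_distrib_right)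
    also have "\<dots> \<le> c * kern z * \<bar>w (fst z) - w (snd z)\<bar> powr p"
      unfolding c_def k using sum_cube_kernels_le[of I "fst z" "snd z"] False finite_subset[OF I J(1)]
      by (intro mult_right_mono) auto
    finally show ?thesis by simp
  qed
  have Sint: "integrable lborel2 (S j)" if "j \<in> J" for j
  proof (rule Bochner_Integration.integrable_bound)
    show "integrable lborel2 (\<lambda>z. c * (kern z * \<bar>w (fst z) - w (snd z)\<bar> powr p))" using X0_borel_energy[OF w] by auto
    show "AE z in lborel2. norm (S j z) \<le> norm (c * (kern z * \<bar>w (fst z) - w (snd z)\<bar> powr p))"
      using sum_le[of "{j}"] that S0 by (auto intro!: AE_I2 order_trans[OF _ abs_ge_self])
  qed measurable
  have jensen: "\<bar>w x - cube_avg j w x\<bar> powr p \<le> (LINT y|lborel. S j (x, y))" for j x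
  proof -
    have "(LINT y|lborel. S j (x, y)) = (LINT y|lborel. 2 ^ (j * DIM('a)) * (if same_cube j x y then \<bar>w x - w y\<bar> powr p else 0))"
      by (intro Bochner_Integration.integral_cong) (auto simp: S_def)
    then show ?thesis using cube_avg_powr_le[OF p X0_borel_L1(1)[OF w] X0_borel_integrable[OF w], of "w x" j x] by simp
  qed
  have Sx: "integrable lborel (\<lambda>x. LINT y|lborel. S j (x, y))" if "j \<in> J" for j
    using lborel_pair.integrable_fst'[OF Sint[OF that]] .
  show int: "integrable lborel (\<lambda>x. \<bar>w x - cube_avg j w x\<bar> powr p)" if "j \<in> J" for j
    by (rule Bochner_Integration.integrable_bound[OF Sx[OF that]])
      (use jensen in \<open>auto intro!: AE_I2 order_trans[OF _ abs_ge_self]\<close>)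
  have "(\<Sum>j\<in>J. LINT x|lborel. \<bar>w x - cube_avg j w x\<bar> powr p) \<le> (\<Sum>j\<in>J. LINT x|lborel. (LINT y|lborel. S j (x, y)))"
    by (intro sum_mono integral_mono int Sx jensen)
  also have "\<dots> = (\<Sum>j\<in>J. LINT z|lborel2. S j z)"
    by (intro sum.cong refl lborel_pair.integral_fst' Sint)
  also have "\<dots> = (LINT z|lborel2. (\<Sum>j\<in>J. S j z))"
    using Sint by (intro Bochner_Integration.integral_sum[symmetric])
  also have "\<dots> \<le> (LINT z|lborel2. c * (kern z * \<bar>w (fst z) - w (snd z)\<bar> powr p))"
    using Sint sum_le X0_borel_energy[OF w] by (intro integral_mono) auto
  also have "\<dots> = c * energy w" by (simp add: energy_def)
  finally show "(\<Sum>j\<in>J. LINT x|lborel. \<bar>w x - cube_avg j w x\<bar> powr p) \<le> 2 * real DIM('a) ^ DIM('a) * energy w"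
    by (simp add: c_def)
qed

text \<open>The compactness estimate: dividing by \<open>m\<close>, the energy contributes \<open>O(1/m)\<close>, and only finitely many
  scales of averages remain to be controlled.\<close>

lemma norm_le_energy_plus_averages:
  assumes w: "w \<in> X0_borel"
  shows "real m * (LINT x|lborel. \<bar>w x\<bar> powr p)
    \<le> 2 powr p * (2 * real DIM('a) ^ DIM('a) * energy w
       + (\<Sum>j\<in>{DIM('a)..<DIM('a) + m}. LINT x|lborel. \<bar>cube_avg j w x\<bar> powr p))"
proof -
  define J where "J = {DIM('a)..<DIM('a) + m}"
  note err = sum_cube_avg_error_le[OF w, of J]
  have "real m * (LINT x|lborel. \<bar>w x\<bar> powr p) = (\<Sum>j\<in>J. LINT x|lborel. \<bar>w x\<bar> powr p)"
    by (simp add: J_def)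
  also have "\<dots> \<le> (\<Sum>j\<in>J. LINT x|lborel. 2 powr p * (\<bar>w x - cube_avg j w x\<bar> powr p + \<bar>cube_avg j w x\<bar> powr p))"
  proof (intro sum_mono integral_mono)
    fix j x assume j: "j \<in> J"
    show "integrable lborel (\<lambda>x. \<bar>w x\<bar> powr p)" by (rule X0_borel_integrable[OF w])
    show "integrable lborel (\<lambda>x. 2 powr p * (\<bar>w x - cube_avg j w x\<bar> powr p + \<bar>cube_avg j w x\<bar> powr p))"
      using err(2)[of j] j cube_avg_powr_integrable[OF w, of j] by (auto simp: J_def)
    show "\<bar>w x\<bar> powr p \<le> 2 powr p * (\<bar>w x - cube_avg j w x\<bar> powr p + \<bar>cube_avg j w x\<bar> powr p)"
      using abs_add_powr_le[of p "w x - cube_avg j w x" "cube_avg j w x"] p by simp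
  qed
  also have "\<dots> = (\<Sum>j\<in>J. 2 powr p * ((LINT x|lborel. \<bar>w x - cube_avg j w x\<bar> powr p) + (LINT x|lborel. \<bar>cube_avg j w x\<bar> powr p)))"
  proof (rule sum.cong[OF refl])
    fix j assume "j \<in> J"
    then show "(LINT x|lborel. 2 powr p * (\<bar>w x - cube_avg j w x\<bar> powr p + \<bar>cube_avg j w x\<bar> powr p))
      = 2 powr p * ((LINT x|lborel. \<bar>w x - cube_avg j w x\<bar> powr p) + (LINT x|lborel. \<bar>cube_avg j w x\<bar> powr p))"
      using err(2)[of j] cube_avg_powr_integrable[OF w, of j] by (simp add: J_def)
  qed
  also have "\<dots> = 2 powr p * ((\<Sum>j\<in>J. LINT x|lborel. \<bar>w x - cube_avg j w x\<bar> powr p) + (\<Sum>j\<in>J. LINT x|lborel. \<bar>cube_avg j w x\<bar> powr p))"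
    by (simp add: sum_distrib_left[symmetric] sum.distrib)
  also have "\<dots> \<le> 2 powr p * (2 * real DIM('a) ^ DIM('a) * energy w + (\<Sum>j\<in>J. LINT x|lborel. \<bar>cube_avg j w x\<bar> powr p))"
    using err(1) by (intro mult_left_mono add_right_mono) (auto simp: J_def)
  finally show ?thesis by (simp add: J_def)
qed

end

section \<open>Compactness and existence of minimizers\<close>

lemma Fatou_integral_le:
  fixes F :: "nat \<Rightarrow> 'b \<Rightarrow> real"
  assumes F: "\<And>n. integrable M (F n)" and F0: "\<And>n x. 0 \<le> F n x"
    and [measurable]: "f \<in> borel_measurable M" and lim: "AE x in M. (\<lambda>n. F n x) \<longlonglongrightarrow> f x"
    and c: "eventually (\<lambda>n. (LINT x|M. F n x) \<le> c) sequentially"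
  shows "integrable M f" "(LINT x|M. f x) \<le> c"
proof -
  obtain n0 where n0: "\<And>n. n \<ge> n0 \<Longrightarrow> (LINT x|M. F n x) \<le> c"
    using c by (auto simp: eventually_sequentially)
  have "0 \<le> (LINT x|M. F n0 x)" using F0 by (intro integral_nonneg_AE) auto
  then have c0: "0 \<le> c" using n0[of n0] by simp
  have nn: "AE x in M. 0 \<le> f x"
    using lim by eventually_elim (use F0 in \<open>auto intro: LIMSEQ_le_const\<close>)
  have Fm [measurable]: "F n \<in> borel_measurable M" for n using F by auto
  have "(\<integral>\<^sup>+x. ennreal (f x) \<partial>M) = (\<integral>\<^sup>+x. liminf (\<lambda>n. ennreal (F n x)) \<partial>M)"
  proof (rule nn_integral_cong_AE)
    show "AE x in M. ennreal (f x) = liminf (\<lambda>n. ennreal (F n x))"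
      using lim
    proof eventually_elim
      case (elim x)
      then have "(\<lambda>n. ennreal (F n x)) \<longlonglongrightarrow> ennreal (f x)" by (rule tendsto_ennrealI)
      then show ?case by (intro lim_imp_Liminf[symmetric]) auto
    qed
  qed
  also have "\<dots> \<le> liminf (\<lambda>n. \<integral>\<^sup>+x. ennreal (F n x) \<partial>M)"
    by (intro nn_integral_liminf) auto
  also have "\<dots> \<le> ennreal c"
  proof (rule Liminf_le)
    show "eventually (\<lambda>n. (\<integral>\<^sup>+x. ennreal (F n x) \<partial>M) \<le> ennreal c) sequentially"
      using c
    proof eventually_elim
      case (elim n)
      have "(\<integral>\<^sup>+x. ennreal (F n x) \<partial>M) = ennreal (LINT x|M. F n x)"
        using F F0 by (intro nn_integral_eq_integral) auto
      then show ?case using elim by (simp add: ennreal_leI)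
    qed
  qed simp
  finally have le: "(\<integral>\<^sup>+x. ennreal (f x) \<partial>M) \<le> ennreal c" .
  then show int: "integrable M f"
    using nn by (intro integrableI_nonneg) (auto intro: order_le_less_trans)
  have "ennreal (LINT x|M. f x) \<le> ennreal c"
    using le nn_integral_eq_integral[OF int nn] by simp
  then show "(LINT x|M. f x) \<le> c" using c0 by simp
qed

context log_laplacian_domain
begin

lemma X0_borel_diff: "u \<in> X0_borel \<Longrightarrow> v \<in> X0_borel \<Longrightarrow> (\<lambda>x. u x - v x) \<in> X0_borel"
  using X0_borel_add[of u v "-1"] by simp

lemma energy_diff_le:
  assumes u: "u \<in> X0_borel" and v: "v \<in> X0_borel"
  shows "energy (\<lambda>x. u x - v x) \<le> 2 powr p * (energy u + energy v)"
proof -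
  have "energy (\<lambda>x. u x - v x) \<le> (LINT z|lborel2. 2 powr p * (kern z * \<bar>u (fst z) - u (snd z)\<bar> powr p + kern z * \<bar>v (fst z) - v (snd z)\<bar> powr p))"
    unfolding energy_def
  proof (rule integral_mono[OF X0_borel_energy[OF X0_borel_diff[OF u v]]])
    show "integrable lborel2 (\<lambda>z. 2 powr p * (kern z * \<bar>u (fst z) - u (snd z)\<bar> powr p + kern z * \<bar>v (fst z) - v (snd z)\<bar> powr p))"
      using X0_borel_energy[OF u] X0_borel_energy[OF v] by auto
    fix z
    have "u (fst z) - v (fst z) - (u (snd z) - v (snd z)) = (u (fst z) - u (snd z)) + - (v (fst z) - v (snd z))"
      by simp
    then have "\<bar>u (fst z) - v (fst z) - (u (snd z) - v (snd z))\<bar> powr p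
      \<le> 2 powr p * (\<bar>u (fst z) - u (snd z)\<bar> powr p + \<bar>v (fst z) - v (snd z)\<bar> powr p)"
      using abs_add_powr_le[of p "u (fst z) - u (snd z)" "- (v (fst z) - v (snd z))"] p
      by (simp only: abs_minus_cancel)
    then have "kern z * \<bar>u (fst z) - v (fst z) - (u (snd z) - v (snd z))\<bar> powr p
      \<le> kern z * (2 powr p * (\<bar>u (fst z) - u (snd z)\<bar> powr p + \<bar>v (fst z) - v (snd z)\<bar> powr p))"
      using kern_nonneg by (rule mult_left_mono)
    also have "\<dots> = 2 powr p * (kern z * \<bar>u (fst z) - u (snd z)\<bar> powr p + kern z * \<bar>v (fst z) - v (snd z)\<bar> powr p)"
      by (simp add: algebra_simps)
    finally show "kern z * \<bar>u (fst z) - v (fst z) - (u (snd z) - v (snd z))\<bar> powr p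
      \<le> 2 powr p * (kern z * \<bar>u (fst z) - u (snd z)\<bar> powr p + kern z * \<bar>v (fst z) - v (snd z)\<bar> powr p)" .
  qed
  also have "\<dots> = 2 powr p * (energy u + energy v)"
    using X0_borel_energy[OF u] X0_borel_energy[OF v] by (simp add: energy_def)
  finally show ?thesis .
qed

text \<open>At scale \<open>j\<close> the averages are bounded by \<open>2\<^sup>j\<^sup>N B\<close>; dividing by \<open>2\<^sup>j\<^sup>N\<close> gives the uniform bound that the
  diagonal argument over the countable set of scales and base points requires.\<close>

lemma cube_avg_convergent_subsequence:
  assumes u: "\<And>n. u n \<in> X0_borel" and L1: "\<And>n. (LINT x|lborel. \<bar>u n x\<bar>) \<le> B"
  obtains r :: "nat \<Rightarrow> nat" where "strict_mono r" "\<And>j x. convergent (\<lambda>n. cube_avg j (u (r n)) x)"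
proof -
  obtain D :: "'a set" where D: "countable D" "\<And>S::'a set. open S \<Longrightarrow> S \<noteq> {} \<Longrightarrow> \<exists>d\<in>D. d \<in> S"
    by (rule countable_dense_setE) blast
  define f where "f n jx = cube_avg (fst jx) (u n) (snd jx) / 2 ^ (fst jx * DIM('a))" for n and jx :: "nat \<times> 'a"
  have "countable (UNIV \<times> D :: (nat \<times> 'a) set)" using D by auto
  moreover have "norm (f n jx) \<le> B" for n jx
  proof -
    have "\<bar>cube_avg (fst jx) (u n) (snd jx)\<bar> \<le> 2 ^ (fst jx * DIM('a)) * (LINT x|lborel. \<bar>u n x\<bar>)"
      by (rule abs_cube_avg_le[OF X0_borel_L1(1)[OF u]])
    also have "\<dots> \<le> 2 ^ (fst jx * DIM('a)) * B" using L1 by (intro mult_left_mono) auto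
    finally show ?thesis by (simp add: f_def divide_le_eq mult.commute)
  qed
  ultimately obtain r :: "nat \<Rightarrow> nat" where r: "strict_mono r" "\<And>jx. jx \<in> UNIV \<times> D \<Longrightarrow> \<exists>l. (\<lambda>n. f (r n) jx) \<longlonglongrightarrow> l"
    using function_convergent_subsequence[of "UNIV \<times> D" f B] by metis
  have "convergent (\<lambda>n. cube_avg j (u (r n)) x)" for j x
  proof -
    obtain d where d: "d \<in> D" "same_cube j x d" using same_cube_meets_dense[of D] D(2) by metis
    obtain l where "(\<lambda>n. f (r n) (j, d)) \<longlonglongrightarrow> l" using r(2)[of "(j, d)"] d by auto
    then have "(\<lambda>n. f (r n) (j, d) * 2 ^ (j * DIM('a))) \<longlonglongrightarrow> l * 2 ^ (j * DIM('a))" by (intro tendsto_intros)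
    then show ?thesis using cube_avg_cong[OF d(2)] by (auto simp: f_def convergent_def)
  qed
  then show thesis using that r(1) by blast
qed

text \<open>At a fixed scale the averages are uniformly bounded and supported in one ball, so pointwise convergence
  is convergence in \<open>L\<^sup>p\<close> by dominated convergence.\<close>

lemma cube_avg_Cauchy:
  assumes u: "\<And>n. u n \<in> X0_borel" and L1: "\<And>n. (LINT x|lborel. \<bar>u n x\<bar>) \<le> B"
    and conv: "\<And>x. convergent (\<lambda>n. cube_avg j (u n) x)" and e: "0 < e"
  obtains n0 where "\<And>n m. n \<ge> n0 \<Longrightarrow> m \<ge> n0 \<Longrightarrow> (LINT x|lborel. \<bar>cube_avg j (\<lambda>x. u n x - u m x) x\<bar> powr p) < e"
proof -
  note [measurable] = X0_borel_measurable[OF u]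
  define L where "L x = lim (\<lambda>n. cube_avg j (u n) x)" for x
  have L: "(\<lambda>n. cube_avg j (u n) x) \<longlonglongrightarrow> L x" for x
    using conv by (simp add: L_def convergent_LIMSEQ_iff)
  have [measurable]: "L \<in> borel_measurable borel" unfolding L_def[abs_def] by measurable
  obtain R where R: "\<And>j u x. u \<in> X0_borel \<Longrightarrow> cube_avg j u x \<noteq> 0 \<Longrightarrow> x \<in> cball 0 R"
    using cube_avg_bounded_support by blast
  define b where "b = 2 ^ (j * DIM('a)) * B"
  have b: "\<bar>cube_avg j (u n) x\<bar> \<le> b" for n x
    unfolding b_def using abs_cube_avg_le[OF X0_borel_L1(1)[OF u], of j n x] L1[of n]
    by (meson mult_left_mono order_trans zero_le_numeral zero_le_power)
  have bL: "\<bar>L x\<bar> \<le> b" for x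
    by (rule LIMSEQ_le_const2[OF tendsto_rabs[OF L]]) (use b in auto)
  have b0: "0 \<le> b" using b[of 0 0] by linarith
  have supp: "cube_avg j (u n) x = 0" if "x \<notin> cball 0 R" for n x using R[OF u] that by blast
  have suppL: "L x = 0" if "x \<notin> cball 0 R" for x
    using L[of x] by (simp add: supp[OF that] LIMSEQ_const_iff)
  define d where "d n = (LINT x|lborel. \<bar>cube_avg j (u n) x - L x\<bar> powr p)" for n
  have dom: "\<bar>cube_avg j (u n) x - L x\<bar> powr p \<le> (2 * b) powr p * indicator (cball 0 R) x" for n x
  proof (cases "x \<in> cball 0 R")
    case True
    have "\<bar>cube_avg j (u n) x - L x\<bar> \<le> 2 * b" using b[of n x] bL[of x] by linarith
    then show ?thesis using True p by (simp add: powr_mono2)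
  next
    case False
    then show ?thesis using supp[OF False] suppL[OF False] by simp
  qed
  have wint: "integrable lborel (\<lambda>x :: 'a. (2 * b) powr p * indicator (cball 0 R) x)"
    using emeasure_lborel_cball_finite[of "0::'a" R]
    by (intro integrable_mult_right) (simp add: integrable_indicator_iff)
  have int: "integrable lborel (\<lambda>x. \<bar>cube_avg j (u n) x - L x\<bar> powr p)" for n
    by (rule Bochner_Integration.integrable_bound[OF wint])
      (use dom in \<open>auto intro!: AE_I2 order_trans[OF dom abs_ge_self]\<close>)
  have "d \<longlonglongrightarrow> (LINT x|(lborel :: 'a measure). 0)"
    unfolding d_def[abs_def]
  proof (rule integral_dominated_convergence[OF _ _ wint])
    show "AE x in lborel. (\<lambda>n. \<bar>cube_avg j (u n) x - L x\<bar> powr p) \<longlonglongrightarrow> 0"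
    proof (rule AE_I2)
      fix x
      have "(\<lambda>n. \<bar>cube_avg j (u n) x - L x\<bar>) \<longlonglongrightarrow> 0" using L[of x] by (intro tendsto_rabs_zero) (simp add: LIM_zero)
      then have "(\<lambda>n. \<bar>cube_avg j (u n) x - L x\<bar> powr p) \<longlonglongrightarrow> 0 powr p" using p by (intro tendsto_powr') auto
      then show "(\<lambda>n. \<bar>cube_avg j (u n) x - L x\<bar> powr p) \<longlonglongrightarrow> 0" by simp
    qed
  qed (use dom in auto)
  then have "d \<longlonglongrightarrow> 0" by simp
  moreover define \<eta> where "\<eta> = e / (2 * 2 powr p)"
  moreover have "0 < \<eta>" using e by (simp add: \<eta>_def)
  ultimately have "eventually (\<lambda>n. d n < \<eta>) sequentially" by (intro order_tendstoD(2))
  then obtain n0 where n0: "\<And>n. n \<ge> n0 \<Longrightarrow> d n < \<eta>" by (auto simp: eventually_sequentially)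
  show thesis
  proof
    fix n m assume nm: "n \<ge> n0" "m \<ge> n0"
    have "(LINT x|lborel. \<bar>cube_avg j (\<lambda>x. u n x - u m x) x\<bar> powr p)
      \<le> (LINT x|lborel. 2 powr p * (\<bar>cube_avg j (u n) x - L x\<bar> powr p + \<bar>cube_avg j (u m) x - L x\<bar> powr p))"
    proof (rule integral_mono[OF cube_avg_powr_integrable[OF X0_borel_diff[OF u u]]])
      show "integrable lborel (\<lambda>x. 2 powr p * (\<bar>cube_avg j (u n) x - L x\<bar> powr p + \<bar>cube_avg j (u m) x - L x\<bar> powr p))"
        using int by auto
      show "\<bar>cube_avg j (\<lambda>x. u n x - u m x) x\<bar> powr p \<le> 2 powr p * (\<bar>cube_avg j (u n) x - L x\<bar> powr p + \<bar>cube_avg j (u m) x - L x\<bar> powr p)" for x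
        using abs_add_powr_le[of p "cube_avg j (u n) x - L x" "- (cube_avg j (u m) x - L x)"] p
        unfolding cube_avg_diff[OF X0_borel_L1(1)[OF u] X0_borel_L1(1)[OF u]] by (simp add: abs_minus_commute[of "L x"])
    qed
    also have "\<dots> = 2 powr p * (d n + d m)" using int by (simp add: d_def)
    also have "\<dots> < 2 powr p * (\<eta> + \<eta>)" using n0[OF nm(1)] n0[OF nm(2)] by (intro mult_strict_left_mono) auto
    also have "\<dots> = e" by (simp add: \<eta>_def)
    finally show "(LINT x|lborel. \<bar>cube_avg j (\<lambda>x. u n x - u m x) x\<bar> powr p) < e" .
  qed
qed

lemma abs_le_Lp_interpolation:
  fixes a \<eta> :: real
  assumes "0 < \<eta>"
  shows "\<bar>a\<bar> \<le> \<eta> + \<eta> powr (1 - p) * \<bar>a\<bar> powr p"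
proof (cases "\<bar>a\<bar> \<le> \<eta>")
  case True
  then show ?thesis by (simp add: add_increasing2)
next
  case False
  then have "1 * \<bar>a\<bar> \<le> (\<bar>a\<bar> / \<eta>) powr (p - 1) * \<bar>a\<bar>"
    using assms p by (intro mult_right_mono ge_one_powr_ge_zero) (auto simp: field_simps)
  also have "\<dots> = \<eta> powr (1 - p) * (\<bar>a\<bar> powr (p - 1) * \<bar>a\<bar>)"
    using assms by (simp add: powr_divide powr_minus_divide[of \<eta> "p - 1", simplified])
  finally show ?thesis using assms by (simp add: powr_pred_mult add_increasing)
qed

text \<open>The averages converge along a subsequence, so the subsequence is Cauchy in \<open>L\<^sup>p\<close>. On the bounded set \<open>\<Omega>\<close>
  it is also Cauchy in \<open>L\<^sup>1\<close>, which yields a further subsequence converging almost everywhere; Fatou's lemma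
  identifies the limit in \<open>L\<^sup>p\<close>.\<close>

lemma compact_embedding:
  assumes u: "\<And>n. u n \<in> X0_borel" and Lp: "\<And>n. (LINT x|lborel. \<bar>u n x\<bar> powr p) \<le> 1" and en: "\<And>n. energy (u n) \<le> E"
  obtains r :: "nat \<Rightarrow> nat" and v where "strict_mono r" "v \<in> borel_measurable borel" "\<And>x. x \<notin> \<Omega> \<Longrightarrow> v x = 0"
    "AE x in lborel. (\<lambda>n. u (r n) x) \<longlonglongrightarrow> v x"
    "\<And>n. integrable lborel (\<lambda>x. \<bar>u (r n) x - v x\<bar> powr p)"
    "(\<lambda>n. LINT x|lborel. \<bar>u (r n) x - v x\<bar> powr p) \<longlonglongrightarrow> 0"
proof -
  define B where "B = measure lborel \<Omega> + 1"
  have L1: "(LINT x|lborel. \<bar>u n x\<bar>) \<le> B" for n using X0_borel_L1(2)[OF u, of n] Lp[of n] by (simp add: B_def)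
  obtain r where r: "strict_mono r" "\<And>j x. convergent (\<lambda>n. cube_avg j (u (r n)) x)"
    by (rule cube_avg_convergent_subsequence[of u, OF u L1]) blast
  define w where "w n = u (r n)" for n
  have w: "w n \<in> X0_borel" for n using u by (simp add: w_def)
  note [measurable] = X0_borel_measurable[OF w]
  define P where "P n m = (LINT x|lborel. \<bar>w n x - w m x\<bar> powr p)" for n m
  have Pint: "integrable lborel (\<lambda>x. \<bar>w n x - w m x\<bar> powr p)" for n m using X0_borel_integrable[OF X0_borel_diff[OF w w]] .
  have cau: "\<exists>n0. \<forall>n\<ge>n0. \<forall>m\<ge>n0. P n m < e" if e: "0 < e" for e
  proof -
    define K where "K = 2 powr p * (2 * real DIM('a) ^ DIM('a) * (2 powr p * (2 * E)))"
    \<comment> \<open>The number \<open>m\<close> of scales is chosen such that the energy contributes at most \<open>e / 2\<close> after division by \<open>m\<close>.\<close>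
    obtain k where k: "K * 2 / e < real (Suc k)" using reals_Archimedean2 less_trans of_nat_less_iff lessI by metis
    define m where "m = Suc k"
    define J where "J = {DIM('a)..<DIM('a) + m}"
    define e' where "e' = e / (2 * 2 powr p)"
    have e': "0 < e'" using e by (simp add: e'_def)
    have "\<exists>n0. \<forall>n\<ge>n0. \<forall>m\<ge>n0. (LINT x|lborel. \<bar>cube_avg j (\<lambda>x. w n x - w m x) x\<bar> powr p) < e'" for j
      using cube_avg_Cauchy[of w B j e'] w L1 r(2) e' unfolding w_def by metis
    then obtain n0 where n0: "\<And>j n m. n \<ge> n0 j \<Longrightarrow> m \<ge> n0 j \<Longrightarrow> (LINT x|lborel. \<bar>cube_avg j (\<lambda>x. w n x - w m x) x\<bar> powr p) < e'"
      by metis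
    define n1 where "n1 = Max (n0 ` J)"
    have n1: "n0 j \<le> n1" if "j \<in> J" for j unfolding n1_def using that by (intro Max_ge) (auto simp: J_def)
    have "P n n' < e" if nn: "n \<ge> n1" "n' \<ge> n1" for n n'
    proof -
      have en': "energy (\<lambda>x. w n x - w n' x) \<le> 2 powr p * (2 * E)"
        using energy_diff_le[OF w w, of n n'] en[of "r n"] en[of "r n'"]
        by (smt (verit) mult_left_mono powr_ge_zero w_def)
      have avg: "(\<Sum>j\<in>J. LINT x|lborel. \<bar>cube_avg j (\<lambda>x. w n x - w n' x) x\<bar> powr p) \<le> (\<Sum>j\<in>J. e')"
        using n0 nn n1 by (intro sum_mono less_imp_le) (meson order_trans)
      have "real m * P n n' \<le> 2 powr p * (2 * real DIM('a) ^ DIM('a) * energy (\<lambda>x. w n x - w n' x)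
         + (\<Sum>j\<in>J. LINT x|lborel. \<bar>cube_avg j (\<lambda>x. w n x - w n' x) x\<bar> powr p))"
        unfolding P_def J_def by (rule norm_le_energy_plus_averages[OF X0_borel_diff[OF w w]])
      also have "\<dots> \<le> 2 powr p * (2 * real DIM('a) ^ DIM('a) * (2 powr p * (2 * E)) + (\<Sum>j\<in>J. e'))"
        using en' avg by (intro mult_left_mono add_mono) auto
      also have "\<dots> = K + real m * (e / 2)" by (simp add: K_def J_def e'_def distrib_left)
      also have "\<dots> < real m * (e / 2) + real m * (e / 2)"
        using k e by (simp add: m_def field_simps)
      finally have "real m * P n n' < real m * e" by (simp add: mult.commute)
      then show ?thesis by (simp add: m_def)
    qed
    then show ?thesis by blast
  qed
  have L1cau: "\<exists>N. \<forall>i\<ge>N. \<forall>j\<ge>N. (LINT x|lborel. norm (w i x - w j x)) < e" if e: "0 < e" for e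
  proof -
    define Y where "Y = measure lborel \<Omega> + 1"
    define \<eta> where "\<eta> = e / (2 * Y)"
    have den: "0 < Y" using measure_nonneg[of lborel \<Omega>] unfolding Y_def by linarith
    have \<eta>: "0 < \<eta>" using e den by (simp add: \<eta>_def)
    have "0 < e / 2 / \<eta> powr (1 - p)" using e \<eta> by simp
    from cau[OF this] obtain n0 where n0: "\<And>n m. n \<ge> n0 \<Longrightarrow> m \<ge> n0 \<Longrightarrow> P n m < e / 2 / \<eta> powr (1 - p)" by blast
    have "(LINT x|lborel. norm (w i x - w j x)) < e" if "i \<ge> n0" "j \<ge> n0" for i j
    proof -
      have "(LINT x|lborel. norm (w i x - w j x)) \<le> (LINT x|lborel. \<eta> * indicator \<Omega> x + \<eta> powr (1 - p) * \<bar>w i x - w j x\<bar> powr p)"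
      proof (rule integral_mono)
        show "integrable lborel (\<lambda>x. norm (w i x - w j x))" using X0_borel_L1(1)[OF w] by auto
        show "integrable lborel (\<lambda>x. \<eta> * indicator \<Omega> x + \<eta> powr (1 - p) * \<bar>w i x - w j x\<bar> powr p)"
          using integrable_on_\<Omega> Pint by auto
        show "norm (w i x - w j x) \<le> \<eta> * indicator \<Omega> x + \<eta> powr (1 - p) * \<bar>w i x - w j x\<bar> powr p" for x
          using abs_le_Lp_interpolation[OF \<eta>, of "w i x - w j x"] X0_borel_zero[OF w, of x]
          by (cases "x \<in> \<Omega>") auto
      qed
      also have "\<dots> = \<eta> * measure lborel \<Omega> + \<eta> powr (1 - p) * P i j"
        using integrable_on_\<Omega> Pint by (simp add: P_def)
      also have "\<dots> < e / 2 + e / 2"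
      proof (rule add_le_less_mono)
        have "\<eta> * measure lborel \<Omega> \<le> \<eta> * Y" unfolding Y_def using \<eta> by (intro mult_left_mono) auto
        also have "\<dots> = e / 2" using den by (simp add: \<eta>_def)
        finally show "\<eta> * measure lborel \<Omega> \<le> e / 2" .
        show "\<eta> powr (1 - p) * P i j < e / 2" using n0[OF that] \<eta> by (simp add: field_simps)
      qed
      finally show ?thesis by simp
    qed
    then show ?thesis by blast
  qed
  obtain s where s: "strict_mono s" "AE x in lborel. Cauchy (\<lambda>i. w (s i) x)"
    using cauchy_L1_AE_cauchy_subseq[OF X0_borel_L1(1)[OF w] L1cau] by metis
  define v where "v x = lim (\<lambda>i. w (s i) x)" for x
  have [measurable]: "v \<in> borel_measurable borel" unfolding v_def[abs_def] by measurable
  have vlim: "AE x in lborel. (\<lambda>i. w (s i) x) \<longlonglongrightarrow> v x"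
    using s(2) by eventually_elim (simp add: v_def Cauchy_convergent_iff convergent_LIMSEQ_iff)
  have v0: "v x = 0" if "x \<notin> \<Omega>" for x
    using X0_borel_zero[OF w that] by (simp add: v_def)
  have fatou: "integrable lborel (\<lambda>x. \<bar>w n x - v x\<bar> powr p) \<and> (LINT x|lborel. \<bar>w n x - v x\<bar> powr p) \<le> c"
    if ev: "eventually (\<lambda>i. P n (s i) \<le> c) sequentially" for n c
  proof -
    have "AE x in lborel. (\<lambda>i. \<bar>w n x - w (s i) x\<bar> powr p) \<longlonglongrightarrow> \<bar>w n x - v x\<bar> powr p"
      using vlim
    proof eventually_elim
      case (elim x)
      then have "(\<lambda>i. \<bar>w n x - w (s i) x\<bar>) \<longlonglongrightarrow> \<bar>w n x - v x\<bar>" by (intro tendsto_intros)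
      then show ?case using p by (intro tendsto_powr') auto
    qed
    from Fatou_integral_le[OF Pint _ _ this ev[unfolded P_def]] show ?thesis by auto
  qed
  have sinf: "eventually (\<lambda>i. n0 \<le> s i) sequentially" for n0
    using filterlim_subseq[OF s(1)] by (simp add: filterlim_at_top)
  have fatou': "\<exists>n0. \<forall>n\<ge>n0. integrable lborel (\<lambda>x. \<bar>w n x - v x\<bar> powr p) \<and> (LINT x|lborel. \<bar>w n x - v x\<bar> powr p) \<le> c"
    if c: "0 < c" for c
  proof -
    obtain n0 where n0: "\<And>n m. n \<ge> n0 \<Longrightarrow> m \<ge> n0 \<Longrightarrow> P n m < c" using cau[OF c] by blast
    have "integrable lborel (\<lambda>x. \<bar>w n x - v x\<bar> powr p) \<and> (LINT x|lborel. \<bar>w n x - v x\<bar> powr p) \<le> c" if "n \<ge> n0" for n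
      by (rule fatou, rule eventually_mono[OF sinf[of n0]]) (simp add: n0 that less_imp_le)
    then show ?thesis by blast
  qed
  obtain n2 where n2: "\<And>n. n \<ge> n2 \<Longrightarrow> integrable lborel (\<lambda>x. \<bar>w n x - v x\<bar> powr p)" using fatou'[of 1] by auto
  \<comment> \<open>Integrability of \<open>\<bar>w n - v\<bar>\<^sup>p\<close> is known only for large \<open>n\<close>, so an initial segment is dropped.\<close>
  define s' where "s' n = s (n + n2)" for n
  have s': "strict_mono s'" using s(1) by (auto simp: s'_def strict_mono_def)
  have s'n: "n + n2 \<le> s' n" for n unfolding s'_def by (rule strict_mono_imp_increasing[OF s(1)])
  show thesis
  proof (rule that[of "r \<circ> s'" v])
    show "strict_mono (r \<circ> s')" using r(1) s' by (rule strict_mono_o)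
    show "AE x in lborel. (\<lambda>n. u ((r \<circ> s') n) x) \<longlonglongrightarrow> v x"
      using vlim
    proof eventually_elim
      case (elim x)
      from LIMSEQ_ignore_initial_segment[OF this, of n2] show ?case by (simp add: s'_def w_def)
    qed
    show "integrable lborel (\<lambda>x. \<bar>u ((r \<circ> s') n) x - v x\<bar> powr p)" for n
      using n2[of "s' n"] s'n[of n] by (simp add: w_def)
    show "(\<lambda>n. LINT x|lborel. \<bar>u ((r \<circ> s') n) x - v x\<bar> powr p) \<longlonglongrightarrow> 0"
    proof (rule LIMSEQ_I)
      fix e :: real assume e: "0 < e"
      then obtain n0 where n0: "\<And>n. n \<ge> n0 \<Longrightarrow> (LINT x|lborel. \<bar>w n x - v x\<bar> powr p) \<le> e / 2" using fatou'[of "e / 2"] by auto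
      have "norm ((LINT x|lborel. \<bar>u ((r \<circ> s') n) x - v x\<bar> powr p) - 0) < e" if "n \<ge> n0" for n
      proof -
        have "(LINT x|lborel. \<bar>w (s' n) x - v x\<bar> powr p) \<le> e / 2" using n0[of "s' n"] s'n[of n] that by simp
        moreover have "0 \<le> (LINT x|lborel. \<bar>w (s' n) x - v x\<bar> powr p)" by simp
        ultimately show ?thesis using e by (simp add: w_def)
      qed
      then show "\<exists>no. \<forall>n\<ge>no. norm ((LINT x|lborel. \<bar>u ((r \<circ> s') n) x - v x\<bar> powr p) - 0) < e" by blast
    qed
  qed (use v0 in auto)
qed

text \<open>By \<open>powr_diff_le\<close>, the integrals differ by \<open>O(\<eta>)\<close> plus a multiple, depending on \<open>\<eta>\<close>, of the \<open>L\<^sup>p\<close> distance.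
  With the potential as weight this is the continuity of the indefinite part of the form.\<close>

lemma weighted_norm_tendsto:
  fixes W :: "'a \<Rightarrow> real"
  assumes [measurable]: "W \<in> borel_measurable borel" and W: "\<And>x. \<bar>W x\<bar> \<le> b"
    and u: "\<And>n. u n \<in> borel_measurable borel" "\<And>n. integrable lborel (\<lambda>x. \<bar>u n x\<bar> powr p)"
      "\<And>n. (LINT x|lborel. \<bar>u n x\<bar> powr p) \<le> 1"
    and v: "v \<in> borel_measurable borel" "integrable lborel (\<lambda>x. \<bar>v x\<bar> powr p)"
    and d: "\<And>n. integrable lborel (\<lambda>x. \<bar>u n x - v x\<bar> powr p)" "(\<lambda>n. LINT x|lborel. \<bar>u n x - v x\<bar> powr p) \<longlonglongrightarrow> 0"
  shows "(\<lambda>n. LINT x|lborel. W x * \<bar>u n x\<bar> powr p) \<longlonglongrightarrow> (LINT x|lborel. W x * \<bar>v x\<bar> powr p)"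
proof (rule LIMSEQ_I)
  fix e :: real assume e: "0 < e"
  note [measurable] = u(1) v(1)
  define V where "V = (LINT x|lborel. \<bar>v x\<bar> powr p)"
  have V: "0 \<le> V" by (simp add: V_def)
  have b: "0 \<le> b" using W[of 0] by linarith
  have Wint: "integrable lborel (\<lambda>x. W x * f x)" if "integrable lborel f" for f :: "'a \<Rightarrow> real"
  proof (rule Bochner_Integration.integrable_bound)
    have [measurable]: "f \<in> borel_measurable borel" using that by auto
    show "integrable lborel (\<lambda>x. b * f x)" using that by auto
    show "(\<lambda>x. W x * f x) \<in> borel_measurable lborel" by measurable
    show "AE x in lborel. norm (W x * f x) \<le> norm (b * f x)"
      using W b by (auto simp: abs_mult intro!: mult_right_mono)
  qed
  define Y where "Y = (b + 1) * p * (1 + V + 1)"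
  define \<eta> where "\<eta> = e / (2 * Y)"
  have Y: "0 < Y" unfolding Y_def using b p V by (intro mult_pos_pos) auto
  have \<eta>: "0 < \<eta>" using e Y by (simp add: \<eta>_def)
  define k where "k = b * p * \<eta> powr (1 - p)"
  have k: "0 \<le> k" using b p by (simp add: k_def)
  have "0 < e / (2 * (k + 1))" using e k by simp
  from order_tendstoD(2)[OF d(2) this]
  obtain n0 where n0: "\<And>n. n \<ge> n0 \<Longrightarrow> (LINT x|lborel. \<bar>u n x - v x\<bar> powr p) < e / (2 * (k + 1))"
    by (auto simp: eventually_sequentially)
  have "norm ((LINT x|lborel. W x * \<bar>u n x\<bar> powr p) - (LINT x|lborel. W x * \<bar>v x\<bar> powr p)) < e" if n: "n \<ge> n0" for n
  proof -
    define D where "D = (LINT x|lborel. \<bar>u n x - v x\<bar> powr p)"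
    have "0 \<le> D" by (simp add: D_def)
    have "\<bar>(LINT x|lborel. W x * \<bar>u n x\<bar> powr p) - (LINT x|lborel. W x * \<bar>v x\<bar> powr p)\<bar>
       = \<bar>LINT x|lborel. W x * \<bar>u n x\<bar> powr p - W x * \<bar>v x\<bar> powr p\<bar>"
      using Wint[OF u(2)] Wint[OF v(2)] by simp
    also have "\<dots> \<le> (LINT x|lborel. \<bar>W x * \<bar>u n x\<bar> powr p - W x * \<bar>v x\<bar> powr p\<bar>)"
      by (rule integral_abs_bound)
    also have "\<dots> \<le> (LINT x|lborel. b * (p * (\<eta> * (\<bar>u n x\<bar> powr p + \<bar>v x\<bar> powr p) + \<eta> powr (1 - p) * \<bar>u n x - v x\<bar> powr p)))"
    proof (rule integral_mono)
      show "integrable lborel (\<lambda>x. \<bar>W x * \<bar>u n x\<bar> powr p - W x * \<bar>v x\<bar> powr p\<bar>)"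
        using Wint[OF u(2)] Wint[OF v(2)] by auto
      show "integrable lborel (\<lambda>x. b * (p * (\<eta> * (\<bar>u n x\<bar> powr p + \<bar>v x\<bar> powr p) + \<eta> powr (1 - p) * \<bar>u n x - v x\<bar> powr p)))"
        using u(2) v(2) d(1) by auto
      fix x
      have "\<bar>W x * \<bar>u n x\<bar> powr p - W x * \<bar>v x\<bar> powr p\<bar> = \<bar>W x\<bar> * \<bar>\<bar>u n x\<bar> powr p - \<bar>v x\<bar> powr p\<bar>"
        by (simp add: abs_mult flip: right_diff_distrib)
      also have "\<dots> \<le> b * (p * (\<eta> * (\<bar>u n x\<bar> powr p + \<bar>v x\<bar> powr p) + \<eta> powr (1 - p) * \<bar>u n x - v x\<bar> powr p))"
        using b by (intro mult_mono W powr_diff_le p \<eta>) auto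
      finally show "\<bar>W x * \<bar>u n x\<bar> powr p - W x * \<bar>v x\<bar> powr p\<bar>
        \<le> b * (p * (\<eta> * (\<bar>u n x\<bar> powr p + \<bar>v x\<bar> powr p) + \<eta> powr (1 - p) * \<bar>u n x - v x\<bar> powr p))" .
    qed
    also have "\<dots> = b * (p * (\<eta> * ((LINT x|lborel. \<bar>u n x\<bar> powr p) + V) + \<eta> powr (1 - p) * D))"
      using u(2) v(2) d(1) by (simp add: V_def D_def)
    also have "\<dots> \<le> b * (p * (\<eta> * (1 + V) + \<eta> powr (1 - p) * D))"
      using b p \<eta> u(3) by (intro mult_left_mono add_mono) auto
    also have "\<dots> = b * p * (1 + V) * \<eta> + k * D" by (simp add: k_def algebra_simps)
    also have "\<dots> < e / 2 + e / 2"
    proof (rule add_le_less_mono)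
      have "b * p * (1 + V) * \<eta> \<le> Y * \<eta>"
        unfolding Y_def using b p V \<eta> by (intro mult_right_mono mult_mono) auto
      also have "\<dots> = e / 2" using Y by (simp add: \<eta>_def)
      finally show "b * p * (1 + V) * \<eta> \<le> e / 2" .
      have "k * D \<le> (k + 1) * D" using \<open>0 \<le> D\<close> by (simp add: distrib_right)
      also have "\<dots> < e / 2" using n0[OF n] k by (simp add: D_def field_simps)
      finally show "k * D < e / 2" .
    qed
    finally show ?thesis by simp
  qed
  then show "\<exists>no. \<forall>n\<ge>no. norm ((LINT x|lborel. W x * \<bar>u n x\<bar> powr p) - (LINT x|lborel. W x * \<bar>v x\<bar> powr p)) < e" by blast
qed

lemma form_energy: "form u u = C_const DIM('a) p / 2 * energy u + (LINT x|lborel. pot x * \<bar>u x\<bar> powr p)"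
  by (simp add: form_self energy_def)

lemma abs_potential_term_le:
  assumes u: "u \<in> X0_borel"
  shows "\<bar>LINT x|lborel. pot x * \<bar>u x\<bar> powr p\<bar> \<le> pot_bound * (LINT x|lborel. \<bar>u x\<bar> powr p)"
proof -
  have "\<bar>LINT x|lborel. pot x * \<bar>u x\<bar> powr p\<bar> \<le> (LINT x|lborel. \<bar>pot x * \<bar>u x\<bar> powr p\<bar>)"
    by (rule integral_abs_bound)
  also have "\<dots> \<le> (LINT x|lborel. pot_bound * \<bar>u x\<bar> powr p)"
    by (intro integral_mono integrable_abs integrable_pot integrable_mult_right X0_borel_integrable[OF u])
      (simp add: abs_mult mult_right_mono abs_pot_le)
  finally show ?thesis by simp
qed

text \<open>The direct method: the potential part of the form is bounded on the unit sphere, so a minimizing sequence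
  has bounded energy. Along a subsequence the potential part and the norm converge, and the energy is lower
  semicontinuous by Fatou's lemma.\<close>

lemma minimizer_exists:
  assumes ne: "v0 \<in> X0_borel" "(LINT x|lborel. \<bar>v0 x\<bar> powr p) = 1"
  obtains u where "u \<in> X0_borel" "(LINT x|lborel. \<bar>u x\<bar> powr p) = 1"
    "\<And>v. v \<in> X0_borel \<Longrightarrow> (LINT x|lborel. \<bar>v x\<bar> powr p) = 1 \<Longrightarrow> form u u \<le> form v v"
proof -
  define S where "S = {form v v | v. v \<in> X0_borel \<and> (LINT x|lborel. \<bar>v x\<bar> powr p) = 1}"
  define C where "C = C_const DIM('a) p"
  have C: "0 < C" using C_pos by (simp add: C_def)
  have pot_term: "\<bar>LINT x|lborel. pot x * \<bar>v x\<bar> powr p\<bar> \<le> pot_bound" if "v \<in> X0_borel" "(LINT x|lborel. \<bar>v x\<bar> powr p) = 1" for v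
    using abs_potential_term_le[OF that(1)] that(2) by simp
  have lower: "- pot_bound \<le> form v v" if "v \<in> X0_borel" "(LINT x|lborel. \<bar>v x\<bar> powr p) = 1" for v
  proof -
    have "0 \<le> C / 2 * energy v" using C energy_nonneg by simp
    then show ?thesis using pot_term[OF that] unfolding form_energy C_def by linarith
  qed
  have S_ne: "S \<noteq> {}" using ne by (auto simp: S_def)
  have S_bdd: "bdd_below S" using lower by (auto simp: S_def intro!: bdd_belowI[of _ "- pot_bound"])
  define \<mu> where "\<mu> = Inf S"
  have \<mu>_le: "\<mu> \<le> form v v" if "v \<in> X0_borel" "(LINT x|lborel. \<bar>v x\<bar> powr p) = 1" for v
    unfolding \<mu>_def using that S_bdd by (intro cInf_lower) (auto simp: S_def)
  have "\<exists>v. v \<in> X0_borel \<and> (LINT x|lborel. \<bar>v x\<bar> powr p) = 1 \<and> form v v < \<mu> + 1 / real (Suc n)" for n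
  proof -
    have "Inf S < \<mu> + 1 / real (Suc n)" by (simp add: \<mu>_def)
    then obtain s where "s \<in> S" "s < \<mu> + 1 / real (Suc n)" using cInf_lessD[OF S_ne] by blast
    then show ?thesis by (auto simp: S_def)
  qed
  then obtain w where w: "\<And>n. w n \<in> X0_borel" "\<And>n. (LINT x|lborel. \<bar>w n x\<bar> powr p) = 1" "\<And>n. form (w n) (w n) < \<mu> + 1 / real (Suc n)"
    by metis
  define E where "E = (\<mu> + 1 + pot_bound) * 2 / C"
  have en: "energy (w n) \<le> E" for n
  proof -
    have "1 / real (Suc n) \<le> 1" by simp
    then have "C / 2 * energy (w n) \<le> \<mu> + 1 + pot_bound"
      using w(3)[of n] pot_term[OF w(1,2), of n] unfolding form_energy C_def by linarith
    then show ?thesis using C by (simp add: E_def field_simps)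
  qed
  obtain r v where r: "strict_mono r" and v [measurable]: "v \<in> borel_measurable borel" and v0: "\<And>x. x \<notin> \<Omega> \<Longrightarrow> v x = 0"
    and AE: "AE x in lborel. (\<lambda>n. w (r n) x) \<longlonglongrightarrow> v x"
    and di: "\<And>n. integrable lborel (\<lambda>x. \<bar>w (r n) x - v x\<bar> powr p)"
    and dl: "(\<lambda>n. LINT x|lborel. \<bar>w (r n) x - v x\<bar> powr p) \<longlonglongrightarrow> 0"
    by (rule compact_embedding[of w E, OF w(1) eq_refl[OF w(2)] en]) blast
  note wm [measurable] = X0_borel_measurable[OF w(1)]
  have AEp: "AE x in lborel. (\<lambda>n. \<bar>w (r n) x\<bar> powr p) \<longlonglongrightarrow> \<bar>v x\<bar> powr p"
    using AE by eventually_elim (use p in \<open>auto intro!: tendsto_powr' tendsto_rabs\<close>)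
  have vi: "integrable lborel (\<lambda>x. \<bar>v x\<bar> powr p)"
    by (rule Fatou_integral_le(1)[OF X0_borel_integrable[OF w(1)] _ _ AEp, of 1]) (use w(2) in auto)
  have lim_pot: "(\<lambda>n. LINT x|lborel. pot x * \<bar>w (r n) x\<bar> powr p) \<longlonglongrightarrow> (LINT x|lborel. pot x * \<bar>v x\<bar> powr p)"
    using w(2) X0_borel_integrable[OF w(1)] by (intro weighted_norm_tendsto[OF _ abs_pot_le _ _ _ v vi di dl]) auto
  have "(\<lambda>n. LINT x|lborel. 1 * \<bar>w (r n) x\<bar> powr p) \<longlonglongrightarrow> (LINT x|lborel. 1 * \<bar>v x\<bar> powr p)"
    using w(2) X0_borel_integrable[OF w(1)] by (intro weighted_norm_tendsto[OF _ _ _ _ _ v vi di dl, of _ 1]) auto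
  then have v1: "(LINT x|lborel. \<bar>v x\<bar> powr p) = 1"
    using w(2) by (simp add: LIMSEQ_const_iff)
  define Z where "Z = (LINT x|lborel. pot x * \<bar>v x\<bar> powr p)"
  have AEe: "AE z in lborel2. (\<lambda>n. kern z * \<bar>w (r n) (fst z) - w (r n) (snd z)\<bar> powr p) \<longlonglongrightarrow> kern z * \<bar>v (fst z) - v (snd z)\<bar> powr p"
    using AE_lborel2_fst[OF AE] AE_lborel2_snd[OF AE]
    by eventually_elim (use p in \<open>auto intro!: tendsto_mult tendsto_powr' tendsto_rabs tendsto_diff\<close>)
  have ev: "eventually (\<lambda>n. (LINT z|lborel2. kern z * \<bar>w (r n) (fst z) - w (r n) (snd z)\<bar> powr p) \<le> (\<mu> - Z + e) * 2 / C) sequentially" if e: "0 < e" for e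
  proof -
    have "(\<lambda>n. 1 / real (Suc n)) \<longlonglongrightarrow> 0" by (rule LIMSEQ_Suc[OF lim_1_over_n])
    then have "(\<lambda>n. 1 / real (Suc (r n))) \<longlonglongrightarrow> 0"
      using LIMSEQ_subseq_LIMSEQ[OF _ r, of "\<lambda>n. 1 / real (Suc n)" 0] by (simp add: o_def)
    then have "eventually (\<lambda>n. 1 / real (Suc (r n)) < e / 2) sequentially" using e by (intro order_tendstoD(2)) auto
    moreover have "eventually (\<lambda>n. Z - e / 2 < (LINT x|lborel. pot x * \<bar>w (r n) x\<bar> powr p)) sequentially"
      using lim_pot e by (intro order_tendstoD(1)) (auto simp: Z_def)
    ultimately show ?thesis
    proof eventually_elim
      case (elim n)
      have "C / 2 * energy (w (r n)) \<le> \<mu> - Z + e"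
        using w(3)[of "r n"] elim unfolding form_energy C_def by linarith
      then show ?case using C by (simp add: energy_def field_simps)
    qed
  qed
  note F = Fatou_integral_le[OF X0_borel_energy[OF w(1)] X0_borel_energy_nonneg _ AEe ev]
  have ei: "integrable lborel2 (\<lambda>z. kern z * \<bar>v (fst z) - v (snd z)\<bar> powr p)" by (rule F(1)[of 1]) auto
  have vX: "v \<in> X0_borel" using vi ei v0 by (simp add: X0_borel_def)
  have "form v v \<le> \<mu> + e" if "0 < e" for e
  proof -
    have "energy v \<le> (\<mu> - Z + e) * 2 / C" unfolding energy_def by (rule F(2)[OF _ that]) measurable
    then have "C / 2 * energy v \<le> \<mu> - Z + e" using C by (simp add: field_simps)
    then show ?thesis by (simp add: form_energy C_def Z_def)
  qed
  then have "form v v \<le> \<mu>" by (rule field_le_epsilon)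
  then show thesis using that[OF vX v1] \<mu>_le by (meson order_trans)
qed

end

section \<open>The equivalence\<close>

context log_laplacian_domain
begin

lemma X0_borel_abs: "u \<in> X0_borel \<Longrightarrow> (\<lambda>x. \<bar>u x\<bar>) \<in> X0_borel"
  by (rule X0_borel_contraction) auto

lemma form_abs_le:
  assumes u: "u \<in> X0_borel"
  shows "form (\<lambda>x. \<bar>u x\<bar>) (\<lambda>x. \<bar>u x\<bar>) \<le> form u u"
proof -
  have "energy (\<lambda>x. \<bar>u x\<bar>) \<le> energy u"
    unfolding energy_def using X0_borel_energy[OF X0_borel_abs[OF u]] X0_borel_energy[OF u] kern_nonneg p
    by (intro integral_mono mult_left_mono powr_mono2) auto
  then show ?thesis using C_pos by (simp add: form_energy)
qed

text \<open>Passing from a minimizer to its absolute value keeps the norm and does not increase the form, since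
  increments shrink.\<close>

lemma nonneg_minimizer_equation:
  assumes "\<not> lambda1 p \<Omega> > 0"
  obtains u \<mu> where "u \<in> X0_borel" "\<And>x. 0 \<le> u x" "(LINT x|lborel. \<bar>u x\<bar> powr p) = 1" "\<mu> \<le> 0"
    "\<And>\<phi>. \<phi> \<in> X0_borel \<Longrightarrow> form u \<phi> = \<mu> * (LINT x|lborel. g_pow p (u x) * \<phi> x)"
proof -
  obtain v0 where "v0 \<in> X0_borel" "(LINT x|lborel. \<bar>v0 x\<bar> powr p) = 1"
    using lambda1_nonpos_imp_form_small[OF assms zero_less_one] by metis
  then obtain w where w: "w \<in> X0_borel" "(LINT x|lborel. \<bar>w x\<bar> powr p) = 1"
    "\<And>v. v \<in> X0_borel \<Longrightarrow> (LINT x|lborel. \<bar>v x\<bar> powr p) = 1 \<Longrightarrow> form w w \<le> form v v"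
    by (rule minimizer_exists) blast
  define u where "u x = \<bar>w x\<bar>" for x
  define \<mu> where "\<mu> = form u u"
  have u: "u \<in> X0_borel" "(LINT x|lborel. \<bar>u x\<bar> powr p) = 1"
    using X0_borel_abs[OF w(1)] w(2) by (auto simp: u_def[abs_def])
  have min: "\<mu> \<le> form v v" if "v \<in> X0_borel" "(LINT x|lborel. \<bar>v x\<bar> powr p) = 1" for v
    using w(3)[OF that] form_abs_le[OF w(1)] by (simp add: \<mu>_def u_def[abs_def])
  have "\<mu> \<le> e" if "0 < e" for e
    using lambda1_nonpos_imp_form_small[OF assms that] min by (metis less_imp_le order_trans)
  then have \<mu>: "\<mu> \<le> 0" using field_le_epsilon[of \<mu> 0] by simp
  have ge: "\<mu> * (LINT x|lborel. \<bar>v x\<bar> powr p) \<le> form v v" if v: "v \<in> X0_borel" for v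
  proof (cases "(LINT x|lborel. \<bar>v x\<bar> powr p) = 0")
    case True
    then have "AE x in lborel. 0 = v x" using X0_borel_norm_zero_iff[OF v] by (auto elim: eventually_mono)
    then have "form v v = form (\<lambda>x. 0) (\<lambda>x. 0)"
      using E_form_eq_form[OF v v, of "\<lambda>x. 0" "\<lambda>x. 0"] E_form_eq_form[OF X0_borel_zero_fun X0_borel_zero_fun, of "\<lambda>x. 0" "\<lambda>x. 0"] by simp
    then show ?thesis using True by (simp add: form_def)
  next
    case False
    moreover have "0 \<le> (LINT x|lborel. \<bar>v x\<bar> powr p)" by simp
    ultimately have "0 < (LINT x|lborel. \<bar>v x\<bar> powr p)" by linarith
    from normalize_X0_borel[OF v this] obtain c where c: "0 < c" "(LINT x|lborel. \<bar>c * v x\<bar> powr p) = 1"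
      "c powr p * (LINT x|lborel. \<bar>v x\<bar> powr p) = 1" by metis
    have "\<mu> * (c powr p * (LINT x|lborel. \<bar>v x\<bar> powr p)) \<le> c powr p * form v v"
      using min[OF X0_borel_scale[OF v] c(2)] form_scale[OF v, of c] c by simp
    then have "c powr p * (\<mu> * (LINT x|lborel. \<bar>v x\<bar> powr p)) \<le> c powr p * form v v" by (simp only: mult.left_commute)
    then show ?thesis using c(1) by simp
  qed
  show thesis
  proof
    show "form u \<phi> = \<mu> * (LINT x|lborel. g_pow p (u x) * \<phi> x)" if "\<phi> \<in> X0_borel" for \<phi>
      using ge u(2) by (intro Euler_Lagrange[OF u(1) that]) (auto simp: \<mu>_def)
  qed (use u \<mu> in \<open>auto simp: u_def\<close>)
qed

lemma supersolution_nonneg: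
  assumes lam: "lambda1 p \<Omega> > 0" and u: "u \<in> X0_borel"
    and super: "\<And>\<phi>. \<phi> \<in> X0_borel \<Longrightarrow> (\<And>x. 0 \<le> \<phi> x) \<Longrightarrow> 0 \<le> form u \<phi>"
  shows "AE x in lborel. 0 \<le> u x"
proof -
  define n where "n x = max 0 (- u x)" for x
  have n: "n \<in> X0_borel" unfolding n_def[abs_def] by (rule X0_borel_contraction[OF u]) auto
  have "0 \<le> form u n" by (rule super[OF n]) (simp add: n_def)
  also have "form u n \<le> - form n n"
  proof -
    have 1: "kern z * (g_pow p (u (fst z) - u (snd z)) * (n (fst z) - n (snd z))) \<le> - (kern z * \<bar>n (fst z) - n (snd z)\<bar> powr p)" for z
      using mult_left_mono[OF g_pow_neg_part_le[OF p, of "u (fst z)" "u (snd z)"] kern_nonneg[of z]] by (simp add: n_def)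
    have I: "(LINT z|lborel2. kern z * (g_pow p (u (fst z) - u (snd z)) * (n (fst z) - n (snd z)))) \<le> (LINT z|lborel2. - (kern z * \<bar>n (fst z) - n (snd z)\<bar> powr p))"
      by (intro integral_mono X0_borel_integrable_kern_g u n 1 Bochner_Integration.integrable_minus X0_borel_energy)
    have 2: "g_pow p (u x) * n x = - (\<bar>n x\<bar> powr p)" for x
    proof (cases "u x \<le> 0")
      case True
      then show ?thesis using powr_pred_mult[of "- u x" p] by (simp add: n_def g_pow_nonpos)
    qed (use p in \<open>simp add: n_def\<close>)
    have "C_const DIM('a) p / 2 * (LINT z|lborel2. kern z * (g_pow p (u (fst z) - u (snd z)) * (n (fst z) - n (snd z))))
      \<le> C_const DIM('a) p / 2 * (LINT z|lborel2. - (kern z * \<bar>n (fst z) - n (snd z)\<bar> powr p))"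
      using C_pos I by (intro mult_left_mono) auto
    then show ?thesis unfolding form_self[of n] unfolding form_def 2 by simp
  qed
  finally have "form n n \<le> 0" by simp
  from lambda1_pos_imp_form_pos[OF lam n this] show ?thesis
    by eventually_elim (auto simp: n_def max_def split: if_splits)
qed

lemma weak_supersolution_representative:
  assumes u: "u \<in> X0_borel" and u': "AE x in lborel. u' x = u x"
    and super: "weak_supersolution p \<Omega> u'"
  shows "\<And>\<phi>. \<phi> \<in> X0_borel \<Longrightarrow> (\<And>x. 0 \<le> \<phi> x) \<Longrightarrow> 0 \<le> form u \<phi>"
proof -
  fix \<phi> assume \<phi>: "\<phi> \<in> X0_borel" "\<And>x. 0 \<le> \<phi> x"
  have "0 \<le> E_form p u' \<phi>"
    using super X0_borel_imp_X0[OF \<phi>(1)] \<phi>(2) by (auto simp: weak_supersolution_def)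
  then show "0 \<le> form u \<phi>" using E_form_eq_form[OF u \<phi>(1) u', of \<phi>] by simp
qed

lemma strong_maximum_principle:
  assumes lam: "lambda1 p \<Omega> > 0" and super: "weak_supersolution p \<Omega> u"
  shows "(AE x in lebesgue. x \<in> \<Omega> \<longrightarrow> u x = 0) \<or> (\<forall>K. compact K \<and> K \<subseteq> \<Omega> \<longrightarrow> ess_inf K u > 0)"
proof -
  have "u \<in> X0 p \<Omega>" using super by (simp add: weak_supersolution_def)
  then obtain v where v: "v \<in> X0_borel" "AE x in lborel. u x = v x" by (rule X0_representative)
  have nn: "AE x in lborel. 0 \<le> v x"
    by (rule supersolution_nonneg[OF lam v(1) weak_supersolution_representative[OF v super]])
  define w where "w x = max 0 (v x)" for x
  have w: "w \<in> X0_borel" unfolding w_def[abs_def] by (rule X0_borel_contraction[OF v(1)]) auto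
  have uw: "AE x in lborel. u x = w x"
    using v(2) nn by eventually_elim (simp add: w_def)
  show ?thesis
  proof (cases "AE x in lborel. w x = 0")
    case True
    then have "AE x in lborel. x \<in> \<Omega> \<longrightarrow> u x = 0" using uw by eventually_elim simp
    then show ?thesis by (simp add: AE_completion_iff)
  next
    case False
    have "ess_inf K u > 0" if K: "compact K" "K \<subseteq> \<Omega>" for K
    proof -
      obtain \<epsilon> where \<epsilon>: "0 < \<epsilon>" "AE x in lborel. x \<in> K \<longrightarrow> \<epsilon> \<le> w x"
        by (rule nonneg_supersolution_locally_bounded_below[OF w _ weak_supersolution_representative[OF w uw super] False K])
          (auto simp: w_def)
      have "AE x in lborel. x \<in> K \<longrightarrow> ereal \<epsilon> \<le> ereal (u x)"
        using \<epsilon>(2) uw by eventually_elim simp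
      then have "ereal \<epsilon> \<le> ess_inf K u"
        unfolding ess_inf_def by (intro Sup_upper) (simp add: AE_completion_iff)
      moreover have "0 < ereal \<epsilon>" using \<epsilon> by simp
      ultimately show ?thesis by (rule less_le_trans[rotated])
    qed
    then show ?thesis by blast
  qed
qed

text \<open>For a minimizer \<open>u \<ge> 0\<close> with \<open>\<mu> \<le> 0\<close>, oddness of \<open>g\<close> gives \<open>E(- u, \<phi>) = - \<mu> \<integral> g(u) \<phi> \<ge> 0\<close> for \<open>\<phi> \<ge> 0\<close>.
  So \<open>- u\<close> is a supersolution; it is not zero, and it is nonpositive on every ball in \<open>\<Omega>\<close>.\<close>

lemma maximum_principle_imp_lambda1_pos:
  assumes ne: "\<Omega> \<noteq> {}"
    and smp: "\<And>u. weak_supersolution p \<Omega> u \<Longrightarrow>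
       (AE x in lebesgue. x \<in> \<Omega> \<longrightarrow> u x = 0) \<or> (\<forall>K. compact K \<and> K \<subseteq> \<Omega> \<longrightarrow> ess_inf K u > 0)"
  shows "lambda1 p \<Omega> > 0"
proof (rule ccontr)
  assume "\<not> lambda1 p \<Omega> > 0"
  then obtain u \<mu> where u: "u \<in> X0_borel" "\<And>x. 0 \<le> u x" "(LINT x|lborel. \<bar>u x\<bar> powr p) = 1" "\<mu> \<le> 0"
    "\<And>\<phi>. \<phi> \<in> X0_borel \<Longrightarrow> form u \<phi> = \<mu> * (LINT x|lborel. g_pow p (u x) * \<phi> x)"
    by (rule nonneg_minimizer_equation) blast
  have mu: "(\<lambda>x. - u x) \<in> X0_borel" using X0_borel_scale[OF u(1), of "-1"] by simp
  have "0 \<le> E_form p (\<lambda>x. - u x) \<phi>" if \<phi>: "\<phi> \<in> X0 p \<Omega>" "AE x in lebesgue. 0 \<le> \<phi> x" for \<phi>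
  proof -
    obtain f where f: "f \<in> X0_borel" "AE x in lborel. \<phi> x = f x" using X0_representative[OF \<phi>(1)] .
    have "AE x in lborel. 0 \<le> f x" using f(2) \<phi>(2)[unfolded AE_completion_iff] by eventually_elim simp
    then have "AE x in lborel. 0 \<le> g_pow p (u x) * f x"
      by eventually_elim (use u(2) in \<open>simp add: g_pow_nonneg\<close>)
    then have "0 \<le> (LINT x|lborel. g_pow p (u x) * f x)" by (rule integral_nonneg_AE)
    then have "form u f \<le> 0" using u(4) by (simp add: u(5)[OF f(1)] mult_nonpos_nonneg)
    then show ?thesis using E_form_eq_form[OF mu f(1) _ f(2)] by (simp add: form_uminus_left)
  qed
  then have "weak_supersolution p \<Omega> (\<lambda>x. - u x)"
    using X0_borel_imp_X0[OF mu] by (simp add: weak_supersolution_def)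
  from smp[OF this] show False
  proof
    assume "AE x in lebesgue. x \<in> \<Omega> \<longrightarrow> - u x = 0"
    then have "AE x in lborel. u x = 0"
      unfolding AE_completion_iff by eventually_elim (use X0_borel_zero[OF u(1)] in auto)
    then show False using X0_borel_norm_zero_iff[OF u(1)] u(3) by simp
  next
    assume *: "\<forall>K. compact K \<and> K \<subseteq> \<Omega> \<longrightarrow> ess_inf K (\<lambda>x. - u x) > 0"
    obtain x0 r where r: "0 < r" "cball x0 r \<subseteq> \<Omega>" using ne open_\<Omega> by (meson ex_in_conv open_contains_cball)
    then have "0 < ess_inf (cball x0 r) (\<lambda>x. - u x)" using * by simp
    then obtain c where c: "0 < c" "AE x in lborel. x \<in> cball x0 r \<longrightarrow> c \<le> ereal (- u x)"
      unfolding ess_inf_def less_Sup_iff by (auto simp: AE_completion_iff)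
    have "AE x in lborel. x \<notin> cball x0 r"
      using c(2)
    proof eventually_elim
      case (elim x)
      have "ereal (- u x) \<le> 0" using u(2)[of x] by simp
      then show ?case using elim c(1) by (meson leD order_trans)
    qed
    then have "cball x0 r \<in> null_sets lborel" by (intro AE_iff_null_sets[THEN iffD2]) auto
    then have "emeasure lborel (ball x0 r) = 0"
      using emeasure_mono[of "ball x0 r" "cball x0 r" lborel] by (auto simp: null_sets_def)
    then have "unit_ball_vol DIM('a) * r ^ DIM('a) \<le> 0" using r by (simp add: emeasure_ball ennreal_eq_0_iff)
    moreover have "0 < unit_ball_vol DIM('a) * r ^ DIM('a)" using r by (intro mult_pos_pos unit_ball_vol_pos) auto
    ultimately show False by simp
  qed
qed

end

theorem theorem1p7:
  fixes \<Omega> :: "'a::euclidean_space set" and p :: real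
  assumes "1 < p" and "open \<Omega>" and "bounded \<Omega>" and "\<Omega> \<noteq> {}"
  shows "lambda1 p \<Omega> > 0 \<longleftrightarrow>
    (\<forall>u. weak_supersolution p \<Omega> u \<longrightarrow>
       (AE x in lebesgue. x \<in> \<Omega> \<longrightarrow> u x = 0) \<or>
       (\<forall>K. compact K \<and> K \<subseteq> \<Omega> \<longrightarrow> ess_inf K u > 0))"
proof -
  interpret log_laplacian_domain p \<Omega> using assms by unfold_locales
  show ?thesis
    using strong_maximum_principle maximum_principle_imp_lambda1_pos[OF assms(4)] by blast
qed

end
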